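(* Let $\{\xi(t),t\ge 0\}$ be a Lévy process such that $\psi(u):=\log \mathbb E e^{u\xi(1)}$ is finite for all $u\in\mathbb R$, and let $\xi_i$, $i\in\mathbb N$, be independent copies of $\xi$. Let $Z_N(t)=\sum_{i=1}^N e^{\xi_i(t)}$, $t\ge0$ (i.e. the case $s_N=0$). Then for every $T>0$, \[ \frac{Z_N(\cdot)-\mathbb E Z_N(\cdot)}{\sqrt N}\Longrightarrow \mathcal G(\cdot),\qquad N\to\infty, \] weakly on the Skorokhod space $D[0,T]$, where $\{\mathcal G(t),t\ge0\}$ is a zero-mean Gaussian process with covariance \[ \operatorname{Cov}(\mathcal G(t_1),\mathcal G(t_2))=e^{\psi(2)t_1+\psi(1)(t_2-t_1)}-e^{\psi(1)(t_1+t_2)},\qquad 0\le t_1\le t_2 . \]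
   Context: A Lévy process is a process with stationary independent increments and càdlàg sample paths, started at $0$. It is assumed throughout that $\xi(1)$ is not almost surely constant. *)

theory Defs
  imports "HOL-Probability.Probability"
begin

definition cadlag_on :: "real set \<Rightarrow> (real \<Rightarrow> real) \<Rightarrow> bool" where
  "cadlag_on S f \<longleftrightarrow>
     (\<forall>t\<in>S. continuous (at t within (S \<inter> {t..})) f) \<and>
     (\<forall>t\<in>S. \<exists>l. (f \<longlongrightarrow> l) (at t within (S \<inter> {..<t})))"

definition levy_process :: "'a measure \<Rightarrow> (real \<Rightarrow> 'a \<Rightarrow> real) \<Rightarrow> bool" where
  "levy_process M X \<longleftrightarrow>
     prob_space M \<and>
     (\<forall>t\<ge>0. X t \<in> borel_measurable M) \<and>
     (\<forall>\<omega>\<in>space M. X 0 \<omega> = 0) \<and>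
     (\<forall>\<omega>\<in>space M. cadlag_on {0..} (\<lambda>t. X t \<omega>)) \<and>
     (\<forall>s t. 0 \<le> s \<longrightarrow> s \<le> t \<longrightarrow>
        distr M borel (\<lambda>\<omega>. X t \<omega> - X s \<omega>) = distr M borel (X (t - s))) \<and>
     (\<forall>(tt :: nat \<Rightarrow> real) n. 0 \<le> tt 0 \<longrightarrow> strict_mono tt \<longrightarrow>
        prob_space.indep_vars M (\<lambda>_. borel) (\<lambda>k \<omega>. X (tt (Suc k)) \<omega> - X (tt k) \<omega>) {..<n})"

definition path_of :: "(real \<Rightarrow> 'a \<Rightarrow> real) \<Rightarrow> 'a \<Rightarrow> (real \<Rightarrow> real)" where
  "path_of X \<omega> = restrict (\<lambda>t. X t \<omega>) {0..}"

definition path_space :: "(real \<Rightarrow> real) measure" where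
  "path_space = PiM {0..} (\<lambda>_. borel)"

definition skor_D :: "real \<Rightarrow> (real \<Rightarrow> real) set" where
  "skor_D T = {x. cadlag_on {0..T} x}"

definition time_changes :: "real \<Rightarrow> (real \<Rightarrow> real) set" where
  "time_changes T = {l. strict_mono_on {0..T} l \<and> continuous_on {0..T} l \<and> l ` {0..T} = {0..T}}"

definition skor_dist :: "real \<Rightarrow> (real \<Rightarrow> real) \<Rightarrow> (real \<Rightarrow> real) \<Rightarrow> real" where
  "skor_dist T x y = Inf ((\<lambda>l. max (SUP t\<in>{0..T}. \<bar>l t - t\<bar>) (SUP t\<in>{0..T}. \<bar>x t - y (l t)\<bar>)) ` time_changes T)"

definition skor_open :: "real \<Rightarrow> (real \<Rightarrow> real) set \<Rightarrow> bool" where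
  "skor_open T U \<longleftrightarrow> U \<subseteq> skor_D T \<and>
     (\<forall>x\<in>U. \<exists>e>0. \<forall>y\<in>skor_D T. skor_dist T x y < e \<longrightarrow> y \<in> U)"

definition skor_borel :: "real \<Rightarrow> (real \<Rightarrow> real) measure" where
  "skor_borel T = sigma (skor_D T) {U. skor_open T U}"

definition skor_continuous :: "real \<Rightarrow> ((real \<Rightarrow> real) \<Rightarrow> real) \<Rightarrow> bool" where
  "skor_continuous T f \<longleftrightarrow> (\<forall>x\<in>skor_D T. \<forall>e>0. \<exists>d>0. \<forall>y\<in>skor_D T.
      skor_dist T x y < d \<longrightarrow> \<bar>f y - f x\<bar> < e)"

definition skor_bounded :: "real \<Rightarrow> ((real \<Rightarrow> real) \<Rightarrow> real) \<Rightarrow> bool" where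
  "skor_bounded T f \<longleftrightarrow> (\<exists>B. \<forall>x\<in>skor_D T. \<bar>f x\<bar> \<le> B)"

definition skor_weak_conv ::
  "real \<Rightarrow> 'a measure \<Rightarrow> (nat \<Rightarrow> 'a \<Rightarrow> (real \<Rightarrow> real)) \<Rightarrow> (real \<Rightarrow> real) measure \<Rightarrow> bool" where
  "skor_weak_conv T M Y mu \<longleftrightarrow>
     (\<forall>f. skor_continuous T f \<longrightarrow> skor_bounded T f \<longrightarrow>
        (\<lambda>N. \<integral>\<omega>. f (Y N \<omega>) \<partial>M) \<longlonglongrightarrow> (\<integral>x. f x \<partial>mu))"

definition centered_gaussian_on ::
  "real \<Rightarrow> (real \<Rightarrow> real) measure \<Rightarrow> (real \<Rightarrow> real \<Rightarrow> real) \<Rightarrow> bool" where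
  "centered_gaussian_on T mu K \<longleftrightarrow>
     (\<forall>n (tt :: nat \<Rightarrow> real) (c :: nat \<Rightarrow> real). (\<forall>k<n. tt k \<in> {0..T}) \<longrightarrow>
        (\<lambda>x. \<Sum>k<n. c k * x (tt k)) \<in> borel_measurable mu \<and>
        (\<forall>u. char (distr mu borel (\<lambda>x. \<Sum>k<n. c k * x (tt k))) u =
              complex_of_real (exp (- ((\<Sum>i<n. \<Sum>j<n. c i * c j * K (tt i) (tt j)) * u\<^sup>2 / 2)))))"

end

theory Submission
  imports Defs
begin

text \<open>
  Normalise \<open>X\<^sub>i(t) = exp (\<xi>\<^sub>i(t) - t \<psi>(1))\<close> and \<open>V\<^sub>N = (\<Sum>i<N. X\<^sub>i - 1) / sqrt N\<close>. The rescaled sum is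
  \<open>exp (t \<psi>(1)) V\<^sub>N(t)\<close>, the \<open>X\<^sub>i\<close> are martingales with covariance \<open>exp (b min s t) - 1\<close>, where
  \<open>b = \<psi>(2) - 2 \<psi>(1) \<ge> 0\<close>, and the limit is \<open>exp (t \<psi>(1)) W(exp (b t) - 1)\<close> for a Brownian motion \<open>W\<close>,
  which is built from its Levy-Ciesielski series. The finite-dimensional laws converge by the central
  limit theorem. The oscillation of \<open>V\<^sub>N\<close> on an interval of length \<open>h\<close> is controlled by the maximal
  inequality for the fourth moment, which is of order \<open>h\<^sup>2 + 1/N\<close>; summed over \<open>1/h\<close> intervals this
  vanishes as \<open>N \<rightarrow> \<infinity>\<close> and then \<open>h \<rightarrow> 0\<close>.

  Since the limit has continuous paths, no compactness argument is needed: a bounded Skorokhod-continuous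
  function is, at continuous paths, the increasing limit of its inf-convolutions with the uniform distance,
  which are Lipschitz and hence depend on a path, up to a small error, only through its values on a grid.
\<close>

section \<open>Cadlag paths and the Skorokhod distance\<close>

text \<open>The fourth moment is forced by the union bound: a second moment of order h per interval,
  summed over 1/h intervals, would not vanish. Its 1/N part comes from the fourth moment of a single
  copy and is the reason why the mesh is fixed before N grows. The test functions are continuous for
  the Skorokhod topology, whereas freezing a path on a fixed grid makes an error that is controlled
  in the uniform distance; inf-convolution connects the two. It produces minorants and thus only a
  lower bound for the limit inferior; the upper bound is the same statement for \<open>- f\<close>.
  Oscillations are estimated for the martingale alone, and the continuous deterministic weight
  multiplies it afterwards. Brownian motion is needed on the unit interval only, since exp (b t) - 1
  is bounded on [0, T] and Brownian scaling does the rest. No filtration occurs: the martingale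
  property is replaced by the independence of two blocks of an array of increments.\<close>

lemma cadlag_on_right:
  assumes "cadlag_on S f" "t \<in> S" "e > 0"
  obtains d where "d > 0" "\<And>s. s \<in> S \<Longrightarrow> t \<le> s \<Longrightarrow> s < t + d \<Longrightarrow> \<bar>f s - f t\<bar> < e"
proof -
  have "(f \<longlongrightarrow> f t) (at t within (S \<inter> {t..}))"
    using assms unfolding cadlag_on_def continuous_within by blast
  from tendstoD[OF this \<open>e > 0\<close>] obtain d where d: "d > 0"
    "\<And>s. s \<in> S \<inter> {t..} \<Longrightarrow> s \<noteq> t \<Longrightarrow> dist s t < d \<Longrightarrow> dist (f s) (f t) < e"
    unfolding eventually_at by blast
  have "\<bar>f s - f t\<bar> < e" if "s \<in> S" "t \<le> s" "s < t + d" for s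
    using d(2)[of s] that \<open>e > 0\<close> by (cases "s = t") (auto simp: dist_real_def)
  with d(1) that show ?thesis by blast
qed

lemma cadlag_on_left:
  assumes "cadlag_on S f" "t \<in> S" "e > 0"
  obtains d l where "d > 0" "\<And>s. s \<in> S \<Longrightarrow> s < t \<Longrightarrow> t - d < s \<Longrightarrow> \<bar>f s - l\<bar> < e"
proof -
  obtain l where "(f \<longlongrightarrow> l) (at t within (S \<inter> {..<t}))"
    using assms unfolding cadlag_on_def by blast
  from tendstoD[OF this \<open>e > 0\<close>] obtain d where d: "d > 0"
    "\<And>s. s \<in> S \<inter> {..<t} \<Longrightarrow> s \<noteq> t \<Longrightarrow> dist s t < d \<Longrightarrow> dist (f s) l < e"
    unfolding eventually_at by blast
  have "\<bar>f s - l\<bar> < e" if "s \<in> S" "s < t" "t - d < s" for s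
    using d(2)[of s] that by (auto simp: dist_real_def)
  with d(1) that show ?thesis by blast
qed

text \<open>Bolzano bisection: near each point the path stays within 1 of its value there (to the
  right) or of its left limit (to the left), and bounds on adjacent intervals combine. This makes
  the real suprema in the Skorokhod distance meaningful.\<close>

lemma cadlag_on_bounded:
  assumes "cadlag_on {a..b} f"
  shows "\<exists>B. \<forall>t\<in>{a..b}. \<bar>f t\<bar> \<le> B"
proof (cases "a \<le> b")
  case True
  define P where "P u v \<longleftrightarrow> (\<exists>B. \<forall>t\<in>{a..b} \<inter> {u..v}. \<bar>f t\<bar> \<le> B)" for u v
  have "P a b" using True
  proof (induction rule: Bolzano)
    case (trans u v w)
    then obtain B1 B2 where B: "\<forall>t\<in>{a..b} \<inter> {u..v}. \<bar>f t\<bar> \<le> B1" "\<forall>t\<in>{a..b} \<inter> {v..w}. \<bar>f t\<bar> \<le> B2"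
      unfolding P_def by blast
    have "\<bar>f t\<bar> \<le> max B1 B2" if "t \<in> {a..b} \<inter> {u..w}" for t
      using B that by (cases "t \<le> v") (auto simp: le_max_iff_disj)
    then show ?case unfolding P_def by blast
  next
    case (local x)
    then have x: "x \<in> {a..b}" by auto
    obtain d1 where d1: "d1 > 0" "\<And>s. s \<in> {a..b} \<Longrightarrow> x \<le> s \<Longrightarrow> s < x + d1 \<Longrightarrow> \<bar>f s - f x\<bar> < 1"
      using cadlag_on_right[OF assms x, of 1] by (metis zero_less_one)
    obtain d2 l where d2: "d2 > 0" "\<And>s. s \<in> {a..b} \<Longrightarrow> s < x \<Longrightarrow> x - d2 < s \<Longrightarrow> \<bar>f s - l\<bar> < 1"
      using cadlag_on_left[OF assms x, of 1] by (metis zero_less_one)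
    have "\<bar>f t\<bar> \<le> max (\<bar>f x\<bar> + 1) (\<bar>l\<bar> + 1)"
      if "u \<le> x" "x \<le> v" "v - u < min d1 d2" "t \<in> {a..b} \<inter> {u..v}" for u v t
    proof (cases "t < x")
      case True
      with d2(2)[of t] that show ?thesis by auto
    next
      case False
      with d1(2)[of t] that show ?thesis by auto
    qed
    moreover have "min d1 d2 > 0" using d1 d2 by auto
    ultimately show ?case unfolding P_def by blast
  qed
  then show ?thesis unfolding P_def by auto
qed auto

lemma cadlag_on_subset:
  assumes "cadlag_on S f" "S' \<subseteq> S" shows "cadlag_on S' f"
  unfolding cadlag_on_def
proof (intro conjI ballI)
  fix t assume "t \<in> S'"
  with assms have "continuous (at t within (S \<inter> {t..})) f" "\<exists>l. (f \<longlongrightarrow> l) (at t within (S \<inter> {..<t}))"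
    unfolding cadlag_on_def by blast+
  then show "continuous (at t within (S' \<inter> {t..})) f" "\<exists>l. (f \<longlongrightarrow> l) (at t within (S' \<inter> {..<t}))"
    using assms(2) by (auto intro: continuous_within_subset tendsto_within_subset)
qed

lemma cadlag_on_continuous:
  assumes "continuous_on S f" shows "cadlag_on S f"
  unfolding cadlag_on_def
proof (intro conjI ballI)
  fix t assume "t \<in> S"
  with assms have *: "continuous (at t within S) f"
    by (simp add: continuous_on_eq_continuous_within)
  then show "continuous (at t within (S \<inter> {t..})) f"
    by (rule continuous_within_subset) auto
  show "\<exists>l. (f \<longlongrightarrow> l) (at t within (S \<inter> {..<t}))"
    using * unfolding continuous_within by (blast intro: tendsto_within_subset)
qed

lemma cadlag_on_add:
  assumes "cadlag_on S f" "cadlag_on S g" shows "cadlag_on S (\<lambda>t. f t + g t :: real)"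
  using assms unfolding cadlag_on_def by (blast intro: continuous_add tendsto_add)

lemma cadlag_on_mult:
  assumes "cadlag_on S f" "cadlag_on S g" shows "cadlag_on S (\<lambda>t. f t * g t :: real)"
  using assms unfolding cadlag_on_def by (blast intro: continuous_mult tendsto_mult)

lemma cadlag_on_sum:
  assumes "\<And>i. i \<in> I \<Longrightarrow> cadlag_on S (f i)" shows "cadlag_on S (\<lambda>t. \<Sum>i\<in>I. f i t)"
  using assms
  by (induction I rule: infinite_finite_induct)
     (auto intro: cadlag_on_add cadlag_on_continuous)

lemma cadlag_on_exp:
  assumes "cadlag_on S f" shows "cadlag_on S (\<lambda>t. exp (f t))"
  using assms unfolding cadlag_on_def by (blast intro: continuous_exp tendsto_exp)

text \<open>The floor is constant on a short interval to the right of any point. On a short interval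
  to the left it equals \<open>\<lceil>c * t\<rceil> - 1\<close>, whether or not
  \<open>c * t\<close> is an integer, so an arbitrary \<open>z\<close> can be composed with
  it.\<close>

lemma cadlag_on_floor:
  assumes "c \<ge> 0"
  shows "cadlag_on S (\<lambda>t. z \<lfloor>c * t\<rfloor> :: real)"
proof (cases "c = 0")
  case False
  with assms have c: "c > 0" by simp
  show ?thesis unfolding cadlag_on_def
  proof (intro conjI ballI)
    fix t assume "t \<in> S"
    have "eventually (\<lambda>s. s \<in> S \<inter> {t..} \<longrightarrow> z \<lfloor>c * t\<rfloor> = z \<lfloor>c * s\<rfloor>) (nhds t)"
    proof -
      have "eventually (\<lambda>s. s < (of_int \<lfloor>c * t\<rfloor> + 1) / c) (nhds t)"
      proof (rule eventually_nhds_in_open[of "{..<(of_int \<lfloor>c * t\<rfloor> + 1) / c}", simplified])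
        show "t < (of_int \<lfloor>c * t\<rfloor> + 1) / c" using c by (simp add: field_simps) linarith
      qed
      then show ?thesis
      proof eventually_elim
        case (elim s)
        have "\<lfloor>c * s\<rfloor> = \<lfloor>c * t\<rfloor>" if "t \<le> s"
        proof -
          have "c * t \<le> c * s" using that c by simp
          moreover have "c * s < of_int \<lfloor>c * t\<rfloor> + 1" using elim c by (simp add: field_simps)
          ultimately show ?thesis by linarith
        qed
        then show ?case by auto
      qed
    qed
    then have "eventually (\<lambda>s. z \<lfloor>c * t\<rfloor> = z \<lfloor>c * s\<rfloor>) (at t within (S \<inter> {t..}))"
      unfolding eventually_at_filter by (auto elim: eventually_mono)
    then show "continuous (at t within (S \<inter> {t..})) (\<lambda>t. z \<lfloor>c * t\<rfloor>)"
      unfolding continuous_within by (rule Lim_transform_eventually[OF tendsto_const])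
  next
    fix t assume "t \<in> S"
    have "eventually (\<lambda>s. s \<in> S \<inter> {..<t} \<longrightarrow> z (\<lceil>c * t\<rceil> - 1) = z \<lfloor>c * s\<rfloor>) (nhds t)"
    proof -
      have "eventually (\<lambda>s. s > (of_int \<lceil>c * t\<rceil> - 1) / c) (nhds t)"
      proof (rule eventually_nhds_in_open[of "{(of_int \<lceil>c * t\<rceil> - 1) / c<..}", simplified])
        show "t > (of_int \<lceil>c * t\<rceil> - 1) / c" using c by (simp add: field_simps) linarith
      qed
      then show ?thesis
      proof eventually_elim
        case (elim s)
        have "\<lfloor>c * s\<rfloor> = \<lceil>c * t\<rceil> - 1" if "s < t"
        proof -
          have "c * s < c * t" using that c by simp
          moreover have "c * s > of_int \<lceil>c * t\<rceil> - 1" using elim c by (simp add: field_simps)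
          ultimately show ?thesis by linarith
        qed
        then show ?case by auto
      qed
    qed
    then have "eventually (\<lambda>s. z (\<lceil>c * t\<rceil> - 1) = z \<lfloor>c * s\<rfloor>) (at t within (S \<inter> {..<t}))"
      unfolding eventually_at_filter by (auto elim: eventually_mono)
    from Lim_transform_eventually[OF tendsto_const this]
    show "\<exists>l. ((\<lambda>t. z \<lfloor>c * t\<rfloor>) \<longlongrightarrow> l) (at t within (S \<inter> {..<t}))" by blast
  qed
qed (auto intro: cadlag_on_continuous)

section \<open>Step paths on a regular grid\<close>

definition step_path :: "real \<Rightarrow> nat \<Rightarrow> (nat \<Rightarrow> real) \<Rightarrow> real \<Rightarrow> real" where
  "step_path T m z t = z (nat \<lfloor>real m / T * t\<rfloor>)"

definition grid :: "real \<Rightarrow> nat \<Rightarrow> nat \<Rightarrow> real" where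
  "grid T m j = T * real j / real m"

lemma cadlag_step_path: "T > 0 \<Longrightarrow> cadlag_on S (step_path T m z)"
  using cadlag_on_floor[of "real m / T" S "\<lambda>i. z (nat i)"] unfolding step_path_def by simp

text \<open>The index \<open>m\<close> is attained at \<open>t = T\<close>, so on [0, T] a step path
  reads the m + 1 values \<open>z 0\<close>, ..., \<open>z m\<close>.\<close>

lemma grid_index_le:
  assumes "T > 0" "t \<in> {0..T}" shows "nat \<lfloor>real m / T * t\<rfloor> \<le> m"
proof -
  have "real m / T * t \<le> real m / T * T" using assms by (intro mult_left_mono) auto
  then have "real m / T * t \<le> real m" using assms by simp
  then show ?thesis by linarith
qed

lemma grid_floor_bounds:
  assumes "T > 0" "t \<in> {0..T}" "m > 0"
  defines "p \<equiv> grid T m (nat \<lfloor>real m / T * t\<rfloor>)"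
  shows "p \<le> t" "t < p + T / m" "p \<in> {0..T}"
proof -
  have nn: "0 \<le> real m / T * t" using assms by auto
  obtain q :: real where q: "real (nat \<lfloor>real m / T * t\<rfloor>) = q" by blast
  with nn have "q \<le> real m / T * t" "real m / T * t < q + 1" by linarith+
  then have "q * T \<le> real m * t" "real m * t < (q + 1) * T"
    using assms(1) by (simp_all add: field_simps)
  then show "p \<le> t" "t < p + T / m" unfolding p_def grid_def q using assms(1,3)
    by (simp_all add: pos_divide_le_eq pos_less_divide_eq add_divide_distrib[symmetric] algebra_simps del: times_divide_eq_left)
  moreover have "p \<ge> 0" unfolding p_def grid_def using assms by auto
  ultimately show "p \<in> {0..T}" using assms by auto
qed

lemma grid_mem: "T > 0 \<Longrightarrow> j \<le> m \<Longrightarrow> grid T m j \<in> {0..T}"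
  by (cases "m = 0") (auto simp: grid_def field_simps)

section \<open>Time changes and the Skorokhod distance\<close>

lemma time_changes_mem: "l \<in> time_changes T \<Longrightarrow> t \<in> {0..T} \<Longrightarrow> l t \<in> {0..T}"
  unfolding time_changes_def by blast

lemma id_time_changes: "(\<lambda>t. t) \<in> time_changes T"
  by (auto simp: time_changes_def strict_mono_on_def)

lemma time_change_bdd:
  assumes "l \<in> time_changes T" shows "bdd_above ((\<lambda>t. \<bar>l t - t\<bar>) ` {0..T})"
proof (rule bdd_aboveI2)
  fix t assume "t \<in> {0..T}"
  with time_changes_mem[OF assms this] show "\<bar>l t - t\<bar> \<le> T" by auto
qed

lemma skor_dist_bdd_below:
  assumes "T \<ge> 0"
  shows "bdd_below ((\<lambda>l. max (SUP t\<in>{0..T}. \<bar>l t - t\<bar>) (SUP t\<in>{0..T}. \<bar>x t - y (l t)\<bar>)) ` time_changes T)"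
proof (rule bdd_belowI2)
  fix l assume "l \<in> time_changes T"
  then have "\<bar>l 0 - 0\<bar> \<le> (SUP t\<in>{0..T}. \<bar>l t - t\<bar>)"
    using assms by (intro cSUP_upper time_change_bdd) auto
  then show "0 \<le> max (SUP t\<in>{0..T}. \<bar>l t - t\<bar>) (SUP t\<in>{0..T}. \<bar>x t - y (l t)\<bar>)" by linarith
qed

lemma skor_dist_le:
  assumes "T \<ge> 0" "l \<in> time_changes T"
    and "\<And>t. t \<in> {0..T} \<Longrightarrow> \<bar>l t - t\<bar> \<le> e" "\<And>t. t \<in> {0..T} \<Longrightarrow> \<bar>x t - y (l t)\<bar> \<le> e"
  shows "skor_dist T x y \<le> e"
proof -
  have "skor_dist T x y \<le> max (SUP t\<in>{0..T}. \<bar>l t - t\<bar>) (SUP t\<in>{0..T}. \<bar>x t - y (l t)\<bar>)"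
    unfolding skor_dist_def using assms by (intro cINF_lower skor_dist_bdd_below) auto
  also have "\<dots> \<le> e" using assms by (auto intro!: cSUP_least)
  finally show ?thesis .
qed

lemma skor_dist_le_uniform:
  assumes "T \<ge> 0" "\<And>t. t \<in> {0..T} \<Longrightarrow> \<bar>x t - y t\<bar> \<le> e"
  shows "skor_dist T x y \<le> e"
proof (rule skor_dist_le[OF assms(1) id_time_changes])
  have "0 \<le> e" using assms(2)[of 0] assms(1) by auto
  then show "\<bar>t - t\<bar> \<le> e" for t :: real by simp
qed (use assms in auto)

text \<open>An infimum below \<open>e\<close> is undercut by some time change. Reading its two
  suprema as pointwise bounds requires bounded sets, which is where boundedness of cadlag paths on
  [0, T] enters.\<close>

lemma skor_dist_lessE:
  assumes "x \<in> skor_D T" "y \<in> skor_D T" "skor_dist T x y < e"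
  obtains l where "l \<in> time_changes T" "\<And>t. t \<in> {0..T} \<Longrightarrow> \<bar>l t - t\<bar> < e"
    "\<And>t. t \<in> {0..T} \<Longrightarrow> \<bar>x t - y (l t)\<bar> < e"
proof -
  have "time_changes T \<noteq> {}" using id_time_changes by blast
  then obtain l where l: "l \<in> time_changes T"
    "max (SUP t\<in>{0..T}. \<bar>l t - t\<bar>) (SUP t\<in>{0..T}. \<bar>x t - y (l t)\<bar>) < e"
    using cInf_lessD[OF _ assms(3)[unfolded skor_dist_def]] by fastforce
  obtain B1 where B1: "\<forall>t\<in>{0..T}. \<bar>x t\<bar> \<le> B1" using cadlag_on_bounded assms(1) unfolding skor_D_def by blast
  obtain B2 where B2: "\<forall>t\<in>{0..T}. \<bar>y t\<bar> \<le> B2" using cadlag_on_bounded assms(2) unfolding skor_D_def by blast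
  have bdd: "bdd_above ((\<lambda>t. \<bar>x t - y (l t)\<bar>) ` {0..T})"
  proof (rule bdd_aboveI2)
    fix t assume t: "t \<in> {0..T}"
    with time_changes_mem[OF l(1) t] B1 B2 have "\<bar>x t\<bar> \<le> B1" "\<bar>y (l t)\<bar> \<le> B2" by blast+
    then show "\<bar>x t - y (l t)\<bar> \<le> B1 + B2" by linarith
  qed
  show ?thesis
  proof (rule that[OF l(1)])
    fix t assume t: "t \<in> {0..T}"
    show "\<bar>l t - t\<bar> < e" using cSUP_upper[OF t time_change_bdd[OF l(1)]] l(2) by simp
    show "\<bar>x t - y (l t)\<bar> < e" using cSUP_upper[OF t bdd] l(2) by simp
  qed
qed

lemma step_path_in_skor_D: "T > 0 \<Longrightarrow> step_path T m z \<in> skor_D T"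
  using cadlag_step_path by (simp add: skor_D_def)

definition grid_ceil :: "real \<Rightarrow> nat \<Rightarrow> real \<Rightarrow> real" where
  "grid_ceil T m a = T * of_int \<lceil>a * real m / T\<rceil> / real m"

text \<open>Closeness of the paths is demanded on the half-open interval only, so that a jump at
  \<open>b\<close> is left to the next piece. Prescribing both end values of \<open>l\<close> makes
  adjacent pieces fit together.\<close>

abbreviation aligns :: "real \<Rightarrow> (real \<Rightarrow> real) \<Rightarrow> real \<Rightarrow> nat \<Rightarrow> real \<Rightarrow> real \<Rightarrow> (real \<Rightarrow> real) \<Rightarrow> bool" where
  "aligns T x e m a b l \<equiv> strict_mono_on {a..b} l \<and> continuous_on {a..b} l \<and>
      l a = grid_ceil T m a \<and> l b = grid_ceil T m b \<and> (\<forall>t\<in>{a..b}. \<bar>l t - t\<bar> \<le> e) \<and>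
      (\<forall>t\<in>{a..<b}. \<bar>x t - step_path T m (\<lambda>j. x (grid T m j)) (l t)\<bar> \<le> e)"

text \<open>The time change sends a point to the next grid point, affinely in between, so that
  the grid interpolation of a path jumps exactly where the reparametrised path does.\<close>

lemma step_path_time_change:
  fixes x :: "real \<Rightarrow> real"
  assumes T: "T > 0" and x: "cadlag_on {0..T} x" and e: "e > 0"
  defines "P \<equiv> \<lambda>a b. 0 \<le> a \<longrightarrow> b \<le> T \<longrightarrow> (\<exists>M. \<forall>m\<ge>M. \<exists>l. aligns T x e m a b l)"
  shows "P 0 T"
proof -
  have g: "a \<le> grid_ceil T m a" "grid_ceil T m a < a + T / m" if "m > 0" for a and m :: nat
  proof -
    obtain q :: real where q: "of_int \<lceil>a * real m / T\<rceil> = q" by blast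
    then have "a * real m / T \<le> q" "q < a * real m / T + 1" by linarith+
    then have "a * real m \<le> q * T" "q * T < a * real m + T" using T by (simp_all add: field_simps)
    then show "a \<le> grid_ceil T m a" "grid_ceil T m a < a + T / m" unfolding grid_ceil_def q using that
      by (simp_all add: pos_le_divide_eq pos_divide_less_eq algebra_simps)
  qed
  \<comment> \<open>A piece on which \<open>x\<close> oscillates by at most \<open>e\<close> is
    handled by the affine map between the rounded end points.\<close>
  have lin: "P a b" if ab: "a \<le> b" and osc: "\<And>s t. s \<in> {0..T} \<Longrightarrow> t \<in> {0..T} \<Longrightarrow> s \<in> {a..<b} \<Longrightarrow> t \<in> {a..<b} \<Longrightarrow> \<bar>x s - x t\<bar> \<le> e" for a b
    unfolding P_def
  proof (intro impI)
    assume a0: "0 \<le> a" and bT: "b \<le> T"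
    \<comment> \<open>A mesh below \<open>b - a\<close> keeps the rounded end points distinct, and a
      mesh below \<open>e\<close> bounds the displacement. For \<open>a = b\<close> only the second
      condition makes sense.\<close>
    define d where "d = (if a < b then min e (b - a) else e)"
    have d: "d > 0" "d \<le> e" "a < b \<Longrightarrow> d \<le> b - a" using e by (auto simp: d_def)
    obtain M :: nat where M: "M > 0" "T / M < d"
    proof -
      obtain M :: nat where "T / d < M" using reals_Archimedean2 by blast
      moreover have "0 < T / d" using T d(1) by simp
      ultimately have "real M > 0" by linarith
      then show ?thesis using that[of M] d(1) \<open>T / d < M\<close> by (simp add: field_simps)
    qed
    show "\<exists>M. \<forall>m\<ge>M. \<exists>l. aligns T x e m a b l"
    proof (intro exI[of _ M] allI impI)
      fix m assume "M \<le> m"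
      then have m: "m > 0" "T / m < d"
      proof -
        show "m > 0" using M(1) \<open>M \<le> m\<close> by simp
        have "T / m \<le> T / M" using M(1) \<open>M \<le> m\<close> T by (intro divide_left_mono) auto
        then show "T / m < d" using M(2) by simp
      qed
      show "\<exists>l. aligns T x e m a b l"
      proof (cases "a < b")
        case False
        with ab have "a = b" by simp
        moreover have "\<bar>grid_ceil T m a - a\<bar> \<le> e" using g[OF m(1), of a] m(2) d(2) by linarith
        ultimately show ?thesis
          by (intro exI[of _ "\<lambda>_. grid_ceil T m a"]) (auto simp: strict_mono_on_def)
      next
        case True
        have gg: "grid_ceil T m a < grid_ceil T m b" using g[OF m(1), of a] g[OF m(1), of b] m(2) d(3)[OF True] by linarith
        define c where "c = (grid_ceil T m b - grid_ceil T m a) / (b - a)"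
        have c: "c > 0" "c * (b - a) = grid_ceil T m b - grid_ceil T m a" using gg True by (auto simp: c_def)
        define l where "l t = grid_ceil T m a + c * (t - a)" for t
        have lt: "\<bar>l t - t\<bar> \<le> e" "t < b \<Longrightarrow> l t < grid_ceil T m b" "grid_ceil T m a \<le> l t" if t: "t \<in> {a..b}" for t
        proof -
          \<comment> \<open>The displacement \<open>l t - t\<close> is the convex combination, with
            weight \<open>w\<close>, of the two rounding errors, each of which lies in
            [0, e].\<close>
          define w where "w = (t - a) / (b - a)"
          have w: "0 \<le> w" "w \<le> 1" using t True by (auto simp: w_def field_simps)
          have "w * (b - a) = t - a" using True by (simp add: w_def)
          then have "t = (1 - w) * a + w * b" by (simp add: algebra_simps)
          moreover have "l t = (1 - w) * grid_ceil T m a + w * grid_ceil T m b"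
          proof -
            have "c * (t - a) = w * (c * (b - a))"
              unfolding \<open>w * (b - a) = t - a\<close>[symmetric] by (simp only: mult_ac)
            then show ?thesis unfolding c(2) l_def by (simp add: algebra_simps)
          qed
          ultimately have "l t - t = (1 - w) * (grid_ceil T m a - a) + w * (grid_ceil T m b - b)"
            by (simp add: algebra_simps)
          moreover have "0 \<le> (1 - w) * (grid_ceil T m a - a) + w * (grid_ceil T m b - b)"
            using w g[OF m(1)] by (intro add_nonneg_nonneg mult_nonneg_nonneg) auto
          moreover have "(1 - w) * (grid_ceil T m a - a) + w * (grid_ceil T m b - b) \<le> e"
          proof -
            have "grid_ceil T m a - a \<le> e" "grid_ceil T m b - b \<le> e" using g[OF m(1), of a] g[OF m(1), of b] m(2) d(2) by linarith+
            with w show ?thesis by (intro convex_bound_le) auto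
          qed
          ultimately show "\<bar>l t - t\<bar> \<le> e" by linarith
          show "grid_ceil T m a \<le> l t" using c(1) t by (simp add: l_def)
          assume "t < b"
          then have "c * (t - a) < c * (b - a)" using c(1) by simp
          then show "l t < grid_ceil T m b" using c(2) unfolding l_def by simp
        qed
        have "\<bar>x t - step_path T m (\<lambda>j. x (grid T m j)) (l t)\<bar> \<le> e" if t: "t \<in> {a..<b}" for t
        proof -
          have gT: "grid_ceil T m b \<le> T"
          proof -
            have "b * real m / T \<le> real m" using bT m(1) T by (simp add: field_simps)
            then have "\<lceil>b * real m / T\<rceil> \<le> int m" by (simp add: ceiling_le_iff)
            then have "real_of_int \<lceil>b * real m / T\<rceil> \<le> real m" by linarith
            then show ?thesis using T m(1) by (simp add: grid_ceil_def field_simps)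
          qed
          have l1: "grid_ceil T m a \<le> l t" "l t < grid_ceil T m b" using lt[of t] t by auto
          then have lT: "l t \<in> {0..T}" using g[OF m(1), of a] a0 gT by auto
          \<comment> \<open>\<open>q\<close> is the cell of the grid that contains
            \<open>l t\<close>. Its left end lies in [a, b), so the value of \<open>x\<close> frozen
            there differs from \<open>x t\<close> by at most the oscillation on this piece.\<close>
          define q where "q = \<lfloor>real m / T * l t\<rfloor>"
          have qlt: "q \<ge> \<lceil>a * real m / T\<rceil>" "q < \<lceil>b * real m / T\<rceil>"
          proof -
            have "of_int \<lceil>a * real m / T\<rceil> \<le> real m / T * l t" using l1(1) m(1) T unfolding grid_ceil_def by (simp add: field_simps)
            then show "q \<ge> \<lceil>a * real m / T\<rceil>" unfolding q_def by linarith
            have "real m / T * l t < of_int \<lceil>b * real m / T\<rceil>" using l1(2) m(1) T unfolding grid_ceil_def by (simp add: field_simps)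
            then show "q < \<lceil>b * real m / T\<rceil>" unfolding q_def by linarith
          qed
          have "a * real m / T \<ge> 0" using a0 T by simp
          then have q0: "q \<ge> 0" using qlt(1) by linarith
          have "a * real m / T \<le> of_int q" "of_int q < b * real m / T" using qlt by linarith+
          then have "T * of_int q / real m \<in> {a..<b}" using T m(1) by (simp add: field_simps)
          moreover have "T * of_int q / real m = grid T m (nat q)" using q0 by (simp add: grid_def)
          ultimately have "grid T m (nat q) \<in> {a..<b}" by simp
          then have "\<bar>x t - x (grid T m (nat q))\<bar> \<le> e" using t a0 bT by (intro osc) auto
          then show ?thesis by (simp add: step_path_def q_def)
        qed
        moreover have "strict_mono_on {a..b} l" using c(1) by (auto simp: l_def strict_mono_on_def)
        moreover have "continuous_on {a..b} l" unfolding l_def by (intro continuous_intros)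
        moreover have "l a = grid_ceil T m a" "l b = grid_ceil T m b" using c(2) by (auto simp: l_def)
        ultimately show ?thesis using lt(1) by blast
      qed
    qed
  qed
  have tr: "P a c" if "P a b" "P b c" "a \<le> b" "b \<le> c" for a b c
    unfolding P_def
  proof (intro impI)
    assume a0: "0 \<le> a" and cT: "c \<le> T"
    from \<open>P a b\<close> a0 cT \<open>b \<le> c\<close> obtain M1 where M1: "\<forall>m\<ge>M1. \<exists>l. aligns T x e m a b l" unfolding P_def by fastforce
    from \<open>P b c\<close> a0 cT \<open>a \<le> b\<close> obtain M2 where M2: "\<forall>m\<ge>M2. \<exists>l. aligns T x e m b c l" unfolding P_def by fastforce
    show "\<exists>M. \<forall>m\<ge>M. \<exists>l. aligns T x e m a c l"
    proof (intro exI[of _ "max M1 M2"] allI impI)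
      fix m assume "max M1 M2 \<le> m"
      then have "M1 \<le> m" "M2 \<le> m" by auto
      from M1[rule_format, OF this(1)] M2[rule_format, OF this(2)] obtain l1 l2 where l1: "strict_mono_on {a..b} l1" "continuous_on {a..b} l1"
        "l1 a = grid_ceil T m a" "l1 b = grid_ceil T m b" "\<forall>t\<in>{a..b}. \<bar>l1 t - t\<bar> \<le> e"
        "\<forall>t\<in>{a..<b}. \<bar>x t - step_path T m (\<lambda>j. x (grid T m j)) (l1 t)\<bar> \<le> e"
        and l2: "strict_mono_on {b..c} l2" "continuous_on {b..c} l2"
        "l2 b = grid_ceil T m b" "l2 c = grid_ceil T m c" "\<forall>t\<in>{b..c}. \<bar>l2 t - t\<bar> \<le> e"
        "\<forall>t\<in>{b..<c}. \<bar>x t - step_path T m (\<lambda>j. x (grid T m j)) (l2 t)\<bar> \<le> e" by blast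
      define l where "l t = (if t \<le> b then l1 t else l2 t)" for t
      have lb: "l t = l2 t" if "t \<ge> b" for t using that l1(4) l2(3) by (auto simp: l_def)
      have "continuous_on ({a..b} \<union> {b..c}) l"
        unfolding l_def using l1 l2 that by (intro continuous_on_cases) auto
      then have "continuous_on {a..c} l" using that by (simp add: ivl_disj_un_two_touch)
      moreover have "strict_mono_on {a..c} l"
      proof (rule strict_mono_onI)
        fix r s assume rs: "r \<in> {a..c}" "s \<in> {a..c}" "r < s"
        consider "s \<le> b" | "b \<le> r" | "r < b" "b < s" by linarith
        then show "l r < l s"
        proof cases
          case 1 then show ?thesis using rs strict_mono_onD[OF l1(1), of r s] by (auto simp: l_def)
        next
          case 2 then show ?thesis using rs strict_mono_onD[OF l2(1), of r s] by (auto simp: lb)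
        next
          case 3
          then have "l1 r < l1 b" using rs that by (intro strict_mono_onD[OF l1(1)]) auto
          moreover have "l2 b < l2 s" using 3 rs that by (intro strict_mono_onD[OF l2(1)]) auto
          ultimately show ?thesis using 3 l1(4) l2(3) by (auto simp: l_def)
        qed
      qed
      moreover have "l a = grid_ceil T m a" using l1 that by (auto simp: l_def)
      moreover have "l c = grid_ceil T m c" using l2 that by (auto simp: lb)
      moreover have "\<forall>t\<in>{a..c}. \<bar>l t - t\<bar> \<le> e" using l1(5) l2(5) by (auto simp: l_def)
      moreover have "\<bar>x t - step_path T m (\<lambda>j. x (grid T m j)) (l t)\<bar> \<le> e" if "t \<in> {a..<c}" for t
      proof (cases "t < b")
        case True then show ?thesis using that l1(6) by (simp add: l_def)
      next
        case False then show ?thesis using that l2(6) by (simp add: lb)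
      qed
      ultimately show "\<exists>l. aligns T x e m a c l" by blast
    qed
  qed
  have "0 \<le> T" using T by simp
  then show "P 0 T"
  proof (induction rule: Bolzano)
    case (trans a b c) then show ?case using tr by blast
  next
    case (local z)
    then have z: "z \<in> {0..T}" by simp
    have e2: "e / 2 > 0" using e by simp
    obtain d1 where d1: "d1 > 0" "\<And>s. s \<in> {0..T} \<Longrightarrow> z \<le> s \<Longrightarrow> s < z + d1 \<Longrightarrow> \<bar>x s - x z\<bar> < e / 2"
      using cadlag_on_right[OF x z e2] by metis
    obtain d2 u where d2: "d2 > 0" "\<And>s. s \<in> {0..T} \<Longrightarrow> s < z \<Longrightarrow> z - d2 < s \<Longrightarrow> \<bar>x s - u\<bar> < e / 2"
      using cadlag_on_left[OF x z e2] by metis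
    \<comment> \<open>Splitting at \<open>z\<close> puts a possible jump at \<open>z\<close> at the
      left end of a half-open piece: left of \<open>z\<close> the path is near its left limit, from
      \<open>z\<close> on it is near \<open>x z\<close>.\<close>
    have "P a b" if ab: "a \<le> z" "z \<le> b" "b - a < min d1 d2" for a b
    proof (rule tr[OF lin lin ab(1,2)])
      fix s t assume st: "s \<in> {0..T}" "t \<in> {0..T}" "s \<in> {a..<z}" "t \<in> {a..<z}"
      have "z - d2 < s" "z - d2 < t" using st ab by auto
      then have "\<bar>x s - u\<bar> < e/2" "\<bar>x t - u\<bar> < e/2" using st by (auto intro!: d2(2) simp del: less_divide_eq_numeral1)
      then show "\<bar>x s - x t\<bar> \<le> e" by linarith
    next
      fix s t assume st: "s \<in> {0..T}" "t \<in> {0..T}" "s \<in> {z..<b}" "t \<in> {z..<b}"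
      have "s < z + d1" "t < z + d1" using st ab by auto
      then have "\<bar>x s - x z\<bar> < e/2" "\<bar>x t - x z\<bar> < e/2" using st by (auto intro!: d1(2) simp del: less_divide_eq_numeral1)
      then show "\<bar>x s - x t\<bar> \<le> e" by linarith
    qed (use ab in auto)
    moreover have "min d1 d2 > 0" using d1 d2 by simp
    ultimately show ?case by blast
  qed
qed

text \<open>Since 0 and T are grid points, the aligning map fixes them and is a genuine time change
  of [0, T]. The end point T, which the half-open alignment omits, is itself a grid point, and the
  step path is exact there.\<close>

lemma skor_dist_step_path_tendsto_0:
  assumes T: "T > 0" and x: "x \<in> skor_D T" and e: "e > 0"
  shows "\<exists>M. \<forall>m\<ge>M. skor_dist T x (step_path T m (\<lambda>j. x (grid T m j))) < e"
proof -
  from e have e2: "e / 2 > 0" by simp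
  from x have "cadlag_on {0..T} x" by (simp add: skor_D_def)
  from step_path_time_change[OF T this e2] obtain M where M: "\<forall>m\<ge>M. \<exists>l. aligns T x (e/2) m 0 T l" by auto
  have "skor_dist T x (step_path T m (\<lambda>j. x (grid T m j))) < e" if m: "m \<ge> max M 1" for m
  proof -
    have "M \<le> m" using m by simp
    from M[rule_format, OF this] obtain l where l: "strict_mono_on {0..T} l" "continuous_on {0..T} l"
      "l 0 = grid_ceil T m 0" "l T = grid_ceil T m T"
      "\<forall>t\<in>{0..T}. \<bar>l t - t\<bar> \<le> e/2"
      "\<forall>t\<in>{0..<T}. \<bar>x t - step_path T m (\<lambda>j. x (grid T m j)) (l t)\<bar> \<le> e/2" by blast
    have l0: "l 0 = 0" "l T = T" using l(3,4) T m by (auto simp: grid_ceil_def)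
    have "l ` {0..T} = {0..T}"
    proof (intro equalityI subsetI)
      fix y assume "y \<in> l ` {0..T}"
      then obtain t where t: "t \<in> {0..T}" "y = l t" by blast
      have "l 0 \<le> l t" "l t \<le> l T" using t T strict_mono_on_leD[OF l(1)] by auto
      then show "y \<in> {0..T}" using l0 t by simp
    next
      fix y assume "y \<in> {0..T}"
      then have "\<exists>t\<ge>0. t \<le> T \<and> l t = y" using l0 T l(2) by (intro IVT') auto
      then show "y \<in> l ` {0..T}" by auto
    qed
    then have "l \<in> time_changes T" using l by (simp add: time_changes_def)
    moreover have "\<bar>x t - step_path T m (\<lambda>j. x (grid T m j)) (l t)\<bar> \<le> e/2" if "t \<in> {0..T}" for t
    proof (cases "t = T")
      case True
      have "step_path T m (\<lambda>j. x (grid T m j)) T = x T"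
        using T m by (simp add: step_path_def grid_def)
      then show ?thesis using True l0 e by simp
    qed (use that l(6) in auto)
    ultimately have "skor_dist T x (step_path T m (\<lambda>j. x (grid T m j))) \<le> e/2"
      using T l(5) by (intro skor_dist_le) auto
    then show ?thesis using e by simp
  qed
  then show ?thesis by blast
qed

text \<open>The hypothesis says that \<open>F\<close> is continuous in its first m + 1 coordinates
  and ignores the others, hence continuous for the product topology.\<close>

lemma borel_measurable_finite_coords:
  fixes F :: "(nat \<Rightarrow> real) \<Rightarrow> real"
  assumes "\<And>z e. e > 0 \<Longrightarrow> \<exists>d>0. \<forall>z'. (\<forall>j\<le>m. \<bar>z' j - z j\<bar> < d) \<longrightarrow> \<bar>F z' - F z\<bar> < e"
  shows "F \<in> borel_measurable borel"
proof (rule borel_measurable_continuous_onI)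
  show "continuous_on UNIV F"
    unfolding continuous_on_eq_continuous_at[OF open_UNIV] continuous_at
  proof (intro ballI tendstoI)
    fix z :: "nat \<Rightarrow> real" and e :: real assume "e > 0"
    from assms[OF this] obtain d where d: "d > 0" "\<And>z'. (\<forall>j\<le>m. \<bar>z' j - z j\<bar> < d) \<Longrightarrow> \<bar>F z' - F z\<bar> < e" by blast
    have "((\<lambda>z. z j) \<longlongrightarrow> z j) (at z)" for j
    proof -
      have "continuous_on UNIV (\<lambda>z::nat \<Rightarrow> real. z j)" by (rule continuous_on_product_coordinates)
      then show ?thesis unfolding continuous_on_eq_continuous_at[OF open_UNIV] continuous_at by blast
    qed
    then have "eventually (\<lambda>z'. \<bar>z' j - z j\<bar> < d) (at z)" for j
      using tendstoD[OF _ d(1)] by (force simp: dist_real_def)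
    then have "eventually (\<lambda>z'. \<forall>j\<in>{..m}. \<bar>z' j - z j\<bar> < d) (at z)"
      by (intro eventually_ball_finite) auto
    then show "eventually (\<lambda>z'. dist (F z') (F z) < e) (at z)"
      by eventually_elim (use d(2) in \<open>auto simp: dist_real_def\<close>)
  qed
qed

text \<open>\<open>f\<close> of the path is the limit of \<open>f\<close> of its grid
  interpolations, each a continuous function of finitely many evaluations. This needs Skorokhod
  approximation by step paths for arbitrary cadlag paths, since the prelimit processes may
  jump.\<close>

lemma borel_measurable_skor_continuous:
  assumes T: "T > 0" and X: "\<And>\<omega>. \<omega> \<in> space M \<Longrightarrow> X \<omega> \<in> skor_D T"
    and meas: "\<And>t. t \<in> {0..T} \<Longrightarrow> (\<lambda>\<omega>. X \<omega> t) \<in> borel_measurable M"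
    and f: "skor_continuous T f"
  shows "(\<lambda>\<omega>. f (X \<omega>)) \<in> borel_measurable M"
proof (rule borel_measurable_LIMSEQ_real)
  fix \<omega> assume "\<omega> \<in> space M"
  with X have x: "X \<omega> \<in> skor_D T" by blast
  show "(\<lambda>m. f (step_path T m (\<lambda>j. X \<omega> (grid T m j)))) \<longlonglongrightarrow> f (X \<omega>)"
  proof (rule LIMSEQ_I)
    fix r :: real assume "r > 0"
    with f x obtain d where d: "d > 0" "\<And>y. y \<in> skor_D T \<Longrightarrow> skor_dist T (X \<omega>) y < d \<Longrightarrow> \<bar>f y - f (X \<omega>)\<bar> < r"
      unfolding skor_continuous_def by blast
    from skor_dist_step_path_tendsto_0[OF T x d(1)] obtain M where
      M: "\<And>m. m \<ge> M \<Longrightarrow> skor_dist T (X \<omega>) (step_path T m (\<lambda>j. X \<omega> (grid T m j))) < d" by blast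
    note D = step_path_in_skor_D[OF T]
    show "\<exists>no. \<forall>n\<ge>no. norm (f (step_path T n (\<lambda>j. X \<omega> (grid T n j))) - f (X \<omega>)) < r"
      unfolding real_norm_def using d(2)[OF D M] by blast
  qed
next
  fix m
  have F: "(\<lambda>z. f (step_path T m z)) \<in> borel_measurable borel"
  proof (rule borel_measurable_finite_coords)
    fix z :: "nat \<Rightarrow> real" and e :: real assume "e > 0"
    note D = step_path_in_skor_D[OF T, of m]
    with \<open>e > 0\<close> obtain d where d: "d > 0" "\<And>y. y \<in> skor_D T \<Longrightarrow> skor_dist T (step_path T m z) y < d \<Longrightarrow> \<bar>f y - f (step_path T m z)\<bar> < e"
      using f unfolding skor_continuous_def by blast
    have "\<bar>f (step_path T m z') - f (step_path T m z)\<bar> < e" if z': "\<forall>j\<le>m. \<bar>z' j - z j\<bar> < d/2" for z'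
    proof (rule d(2)[OF D])
      have "skor_dist T (step_path T m z) (step_path T m z') \<le> d/2"
      proof (rule skor_dist_le_uniform)
        fix t assume "t \<in> {0..T}"
        from grid_index_le[OF T this, of m] z' show "\<bar>step_path T m z t - step_path T m z' t\<bar> \<le> d/2"
          unfolding step_path_def by (metis abs_minus_commute less_imp_le)
      qed (use T in simp)
      then show "skor_dist T (step_path T m z) (step_path T m z') < d" using d(1) by simp
    qed
    then show "\<exists>d>0. \<forall>z'. (\<forall>j\<le>m. \<bar>z' j - z j\<bar> < d) \<longrightarrow> \<bar>f (step_path T m z') - f (step_path T m z)\<bar> < e"
      using d(1) by (intro exI[of _ "d/2"]) auto
  qed
  \<comment> \<open>Grid points beyond index \<open>m\<close> lie outside [0, T], where no
    measurability is assumed; the value 0 is a harmless default.\<close>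
  define z where "z \<omega> j = (if j \<le> m then X \<omega> (grid T m j) else 0)" for \<omega> j
  have "z \<in> borel_measurable M"
  proof (rule measurable_coordinatewise_then_product)
    fix i show "(\<lambda>x. z x i) \<in> borel_measurable M"
      unfolding z_def using meas grid_mem[OF T, of i m] by (cases "i \<le> m") auto
  qed
  from measurable_compose[OF this F] have "(\<lambda>\<omega>. f (step_path T m (z \<omega>))) \<in> borel_measurable M" .
  moreover have "f (step_path T m (z \<omega>)) = f (step_path T m (\<lambda>j. X \<omega> (grid T m j)))" for \<omega>
  proof -
    note D = step_path_in_skor_D[OF T, of m]
    \<comment> \<open>The two step paths agree on [0, T] but may differ elsewhere as functions on
      the reals, so equality of \<open>f\<close> is obtained from vanishing distance.\<close>
    have "skor_dist T (step_path T m (z \<omega>)) (step_path T m (\<lambda>j. X \<omega> (grid T m j))) \<le> 0"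
      using T grid_index_le[OF T, of _ m] by (intro skor_dist_le_uniform) (auto simp: step_path_def z_def)
    then have "\<bar>f (step_path T m (\<lambda>j. X \<omega> (grid T m j))) - f (step_path T m (z \<omega>))\<bar> < e" if "e > 0" for e
      using f D that unfolding skor_continuous_def by (meson le_less_trans)
    then show ?thesis by (metis abs_le_zero_iff eq_iff_diff_eq_0 field_le_epsilon add_0 less_imp_le)
  qed
  ultimately show "(\<lambda>\<omega>. f (step_path T m (\<lambda>j. X \<omega> (grid T m j)))) \<in> borel_measurable M" by simp
qed

section \<open>Skorokhod Borel sets and inf-convolutions\<close>

lemma skor_D_bounded: "x \<in> skor_D T \<Longrightarrow> \<exists>B. \<forall>t\<in>{0..T}. \<bar>x t\<bar> \<le> B"
  unfolding skor_D_def by (simp add: cadlag_on_bounded)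

lemma skor_open_subset: "{U. skor_open T U} \<subseteq> Pow (skor_D T)"
  unfolding skor_open_def by blast

lemma space_skor_borel: "space (skor_borel T) = skor_D T"
  unfolding skor_borel_def using skor_open_subset by (rule space_measure_of)

lemma sets_skor_borel: "sets (skor_borel T) = sigma_sets (skor_D T) {U. skor_open T U}"
  unfolding skor_borel_def using skor_open_subset by (rule sets_measure_of)

lemma skor_open_sets: "skor_open T U \<Longrightarrow> U \<in> sets (skor_borel T)"
  unfolding sets_skor_borel by (rule sigma_sets.Basic) simp

lemma skor_continuous_measurable:
  assumes "skor_continuous T f" shows "f \<in> borel_measurable (skor_borel T)"
proof (rule borel_measurableI)
  fix S :: "real set" assume S: "open S"
  have "skor_open T (f -` S \<inter> skor_D T)"
    unfolding skor_open_def
  proof (intro conjI ballI)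
    fix x assume x: "x \<in> f -` S \<inter> skor_D T"
    then obtain e where e: "e > 0" "\<And>r. \<bar>r - f x\<bar> < e \<Longrightarrow> r \<in> S"
      using S unfolding open_dist by (auto simp: dist_real_def)
    with assms x obtain d where "d > 0" "\<And>y. y \<in> skor_D T \<Longrightarrow> skor_dist T x y < d \<Longrightarrow> \<bar>f y - f x\<bar> < e"
      unfolding skor_continuous_def by blast
    with e show "\<exists>e>0. \<forall>y\<in>skor_D T. skor_dist T x y < e \<longrightarrow> y \<in> f -` S \<inter> skor_D T" by blast
  qed blast
  then show "f -` S \<inter> space (skor_borel T) \<in> sets (skor_borel T)"
    unfolding space_skor_borel by (rule skor_open_sets)
qed

lemma time_change_end:
  assumes "l \<in> time_changes T" "T \<ge> 0" shows "l T = T"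
proof -
  from assms obtain t where t: "t \<in> {0..T}" "l t = T" unfolding time_changes_def by force
  have "l t \<le> l T" using t assms strict_mono_on_leD[of "{0..T}" l t T] by (auto simp: time_changes_def)
  with t time_changes_mem[OF assms(1), of T] assms(2) show ?thesis by auto
qed

text \<open>Every time change fixes T, so evaluation at T is Skorokhod continuous, unlike evaluation
  at an interior point.\<close>

lemma skor_open_eval_end:
  assumes "T \<ge> 0" shows "skor_open T {x \<in> skor_D T. c < x T}"
  unfolding skor_open_def
proof (intro conjI ballI)
  fix x assume x: "x \<in> {x \<in> skor_D T. c < x T}"
  have "y \<in> {x \<in> skor_D T. c < x T}" if y: "y \<in> skor_D T" "skor_dist T x y < x T - c" for y
  proof -
    from x have xD: "x \<in> skor_D T" by simp
    obtain l where "l \<in> time_changes T" "\<And>t. t \<in> {0..T} \<Longrightarrow> \<bar>x t - y (l t)\<bar> < x T - c"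
      using skor_dist_lessE[OF xD y] by metis
    with time_change_end[of l T] assms have "\<bar>x T - y T\<bar> < x T - c" by force
    with y show ?thesis by simp
  qed
  then show "\<exists>e>0. \<forall>y\<in>skor_D T. skor_dist T x y < e \<longrightarrow> y \<in> {x \<in> skor_D T. c < x T}"
    using x by (intro exI[of _ "x T - c"]) auto
qed blast

text \<open>A time change closer to the identity than the distance from the witness \<open>s\<close>
  to the ends of the interval keeps it inside, and the level is still exceeded if the paths differ
  by less than the excess.\<close>

lemma skor_open_exceed:
  assumes "0 \<le> a" "b \<le> T" shows "skor_open T {x \<in> skor_D T. \<exists>s\<in>{a<..<b}. c < x s}"
  unfolding skor_open_def
proof (intro conjI ballI)
  fix x assume x: "x \<in> {x \<in> skor_D T. \<exists>s\<in>{a<..<b}. c < x s}"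
  then obtain s where s: "s \<in> {a<..<b}" "c < x s" and xD: "x \<in> skor_D T" by blast
  define e where "e = min (x s - c) (min (s - a) (b - s))"
  have "y \<in> {x \<in> skor_D T. \<exists>s\<in>{a<..<b}. c < x s}" if y: "y \<in> skor_D T" "skor_dist T x y < e" for y
  proof -
    obtain l where l: "\<And>t. t \<in> {0..T} \<Longrightarrow> \<bar>l t - t\<bar> < e" "\<And>t. t \<in> {0..T} \<Longrightarrow> \<bar>x t - y (l t)\<bar> < e"
      using skor_dist_lessE[OF xD y] by metis
    have "s \<in> {0..T}" using s assms by auto
    with l[of s] have "l s \<in> {a<..<b}" "c < y (l s)" by (auto simp: e_def)
    with y show ?thesis by blast
  qed
  moreover have "e > 0" using s by (auto simp: e_def)
  ultimately show "\<exists>e>0. \<forall>y\<in>skor_D T. skor_dist T x y < e \<longrightarrow> y \<in> {x \<in> skor_D T. \<exists>s\<in>{a<..<b}. c < x s}"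
    by blast
qed blast

text \<open>Evaluation at \<open>t < T\<close> is not continuous, but right continuity makes it the limit of the lower
  semicontinuous suprema over \<open>(t, t + 1/n)\<close>.\<close>

lemma skor_borel_measurable_eval:
  assumes T: "T > 0" and t: "t \<in> {0..T}"
  shows "(\<lambda>x. x t) \<in> borel_measurable (skor_borel T)"
proof (cases "t = T")
  case True
  show ?thesis unfolding borel_measurable_iff_greater space_skor_borel True
    using skor_open_eval_end[of T] T by (auto intro!: skor_open_sets)
next
  case False
  with t have t: "0 \<le> t" "t < T" by auto
  \<comment> \<open>The cap at T keeps the suprema inside the interval on which the paths are
    bounded.\<close>
  define b where "b n = min T (t + inverse (real (Suc n)))" for n
  have b: "t < b n" "b n \<le> T" for n using t by (auto simp: b_def)
  define S where "S n x = (SUP s\<in>{t<..<b n}. x s)" for n and x :: "real \<Rightarrow> real"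
  have bdd: "bdd_above (x ` {t<..<b n})" if xD: "x \<in> skor_D T" for x n
  proof -
    obtain B where "\<forall>s\<in>{0..T}. \<bar>x s\<bar> \<le> B" using skor_D_bounded[OF xD] by blast
    then have "x s \<le> B" if "s \<in> {t<..<b n}" for s
      using that b(2)[of n] t by (auto dest!: bspec[of _ _ s])
    then show ?thesis by (intro bdd_aboveI2) auto
  qed
  show ?thesis
  proof (rule borel_measurable_LIMSEQ_real)
    fix n
    have "{x \<in> skor_D T. c < S n x} = {x \<in> skor_D T. \<exists>s\<in>{t<..<b n}. c < x s}" for c
    proof -
      have "{t<..<b n} \<noteq> {}" using b(1)[of n] dense[of t "b n"] by auto
      then have "c < S n x \<longleftrightarrow> (\<exists>s\<in>{t<..<b n}. c < x s)" if "x \<in> skor_D T" for x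
        unfolding S_def using bdd[OF that] by (rule less_cSUP_iff)
      then show ?thesis by blast
    qed
    then show "S n \<in> borel_measurable (skor_borel T)"
      unfolding borel_measurable_iff_greater space_skor_borel
      using skor_open_exceed[OF t(1) b(2)[of n]] by (auto intro: skor_open_sets)
  next
    fix x assume "x \<in> space (skor_borel T)"
    then have xD: "x \<in> skor_D T" by (simp add: space_skor_borel)
    show "(\<lambda>n. S n x) \<longlonglongrightarrow> x t"
    proof (rule LIMSEQ_I)
      fix r :: real assume "r > 0"
      then have r2: "r / 2 > 0" by simp
      have "t \<in> {0..T}" using t by simp
      then obtain d where d: "d > 0" "\<And>s. s \<in> {0..T} \<Longrightarrow> t \<le> s \<Longrightarrow> s < t + d \<Longrightarrow> \<bar>x s - x t\<bar> < r / 2"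
        using cadlag_on_right[of "{0..T}" x t "r/2"] xD r2 unfolding skor_D_def by blast
      obtain N where N: "inverse (real (Suc N)) < d" using reals_Archimedean[OF d(1)] by blast
      have "norm (S n x - x t) < r" if n: "n \<ge> N" for n
      proof -
        have "inverse (real (Suc n)) \<le> inverse (real (Suc N))" using n by (intro le_imp_inverse_le) auto
        with N have "inverse (real (Suc n)) < d" by linarith
        then have cl: "\<bar>x s - x t\<bar> < r / 2" if "s \<in> {t<..<b n}" for s
          using that t by (intro d(2)) (auto simp: b_def)
        have ne: "(t + b n) / 2 \<in> {t<..<b n}" using b(1)[of n] by auto
        have "S n x \<le> x t + r / 2" unfolding S_def
        proof (rule cSUP_least)
          show "{t<..<b n} \<noteq> {}" using ne by blast
          show "x s \<le> x t + r / 2" if "s \<in> {t<..<b n}" for s using cl[OF that] by linarith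
        qed
        moreover have "x ((t + b n) / 2) \<le> S n x" unfolding S_def using ne bdd[OF xD] by (rule cSUP_upper)
        moreover have "x t - r / 2 \<le> x ((t + b n) / 2)" using cl[OF ne] by linarith
        ultimately show ?thesis using \<open>r > 0\<close> unfolding real_norm_def abs_less_iff by linarith
      qed
      then show "\<exists>no. \<forall>n\<ge>no. norm (S n x - x t) < r" by blast
    qed
  qed
qed

section \<open>Uniform distance and inf-convolutions\<close>

definition unif_dist :: "real \<Rightarrow> (real \<Rightarrow> real) \<Rightarrow> (real \<Rightarrow> real) \<Rightarrow> real" where
  "unif_dist T x y = (SUP t\<in>{0..T}. \<bar>x t - y t\<bar>)"

text \<open>The Pasch-Hausdorff envelope: for \<open>f\<close> bounded below, the largest minorant
  of \<open>f\<close> that is \<open>k\<close>-Lipschitz in the uniform distance.\<close>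

definition inf_conv :: "real \<Rightarrow> real \<Rightarrow> ((real \<Rightarrow> real) \<Rightarrow> real) \<Rightarrow> (real \<Rightarrow> real) \<Rightarrow> real" where
  "inf_conv T k f x = (INF y\<in>skor_D T. f y + k * unif_dist T x y)"

lemma unif_dist_upper:
  assumes "x \<in> skor_D T" "y \<in> skor_D T" "t \<in> {0..T}"
  shows "\<bar>x t - y t\<bar> \<le> unif_dist T x y"
  unfolding unif_dist_def
proof (rule cSUP_upper[OF assms(3)])
  obtain B1 B2 where "\<forall>t\<in>{0..T}. \<bar>x t\<bar> \<le> B1" "\<forall>t\<in>{0..T}. \<bar>y t\<bar> \<le> B2"
    using skor_D_bounded[OF assms(1)] skor_D_bounded[OF assms(2)] by blast
  then have "\<bar>x t - y t\<bar> \<le> B1 + B2" if "t \<in> {0..T}" for t using that by (force dest!: bspec[of _ _ t])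
  then show "bdd_above ((\<lambda>t. \<bar>x t - y t\<bar>) ` {0..T})" by (rule bdd_aboveI2)
qed

lemma unif_dist_least:
  "T \<ge> 0 \<Longrightarrow> (\<And>t. t \<in> {0..T} \<Longrightarrow> \<bar>x t - y t\<bar> \<le> e) \<Longrightarrow> unif_dist T x y \<le> e"
  unfolding unif_dist_def by (rule cSUP_least) auto

lemma unif_dist_nonneg:
  assumes "T \<ge> 0" "x \<in> skor_D T" "y \<in> skor_D T" shows "0 \<le> unif_dist T x y"
  using unif_dist_upper[OF assms(2,3), of 0] assms(1) by force

lemma inf_conv_bdd_below:
  assumes "T \<ge> 0" "k \<ge> 0" "x \<in> skor_D T" "\<And>y. y \<in> skor_D T \<Longrightarrow> - B \<le> f y"
  shows "bdd_below ((\<lambda>y. f y + k * unif_dist T x y) ` skor_D T)"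
proof (rule bdd_belowI2)
  fix y assume y: "y \<in> skor_D T"
  show "- B \<le> f y + k * unif_dist T x y"
    using assms(4)[OF y] mult_nonneg_nonneg[OF assms(2) unif_dist_nonneg[OF assms(1,3) y]] by linarith
qed

lemma zero_in_skor_D: "(\<lambda>_. 0) \<in> skor_D T"
  by (simp add: skor_D_def cadlag_on_continuous)

lemma inf_conv_le:
  assumes "T \<ge> 0" "k \<ge> 0" "x \<in> skor_D T" "\<And>y. y \<in> skor_D T \<Longrightarrow> - B \<le> f y"
  shows "inf_conv T k f x \<le> f x"
proof -
  have "inf_conv T k f x \<le> f x + k * unif_dist T x x"
    unfolding inf_conv_def by (rule cINF_lower[OF inf_conv_bdd_below[OF assms] assms(3)])
  moreover have "unif_dist T x x \<le> 0" using assms(1) by (intro unif_dist_least) auto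
  then have "k * unif_dist T x x \<le> 0" using assms(2) by (simp add: mult_nonneg_nonpos)
  ultimately show ?thesis by linarith
qed

lemma inf_conv_ge:
  assumes "T \<ge> 0" "k \<ge> 0" "x \<in> skor_D T" "\<And>y. y \<in> skor_D T \<Longrightarrow> - B \<le> f y"
  shows "- B \<le> inf_conv T k f x"
  unfolding inf_conv_def
proof (rule cINF_greatest)
  show "skor_D T \<noteq> {}" using zero_in_skor_D by blast
  fix y assume y: "y \<in> skor_D T"
  show "- B \<le> f y + k * unif_dist T x y"
    using assms(4)[OF y] mult_nonneg_nonneg[OF assms(2) unif_dist_nonneg[OF assms(1,3) y]] by linarith
qed

text \<open>Phrased with a pointwise bound \<open>e\<close>, the form in which estimates arrive. The
  case \<open>e = 0\<close> says that \<open>F\<close> does not see the values of a path outside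
  [0, T].\<close>

definition unif_lipschitz :: "real \<Rightarrow> real \<Rightarrow> ((real \<Rightarrow> real) \<Rightarrow> real) \<Rightarrow> bool" where
  "unif_lipschitz T L F \<longleftrightarrow> (\<forall>x\<in>skor_D T. \<forall>y\<in>skor_D T. \<forall>e. (\<forall>t\<in>{0..T}. \<bar>x t - y t\<bar> \<le> e) \<longrightarrow> \<bar>F x - F y\<bar> \<le> L * e)"

lemma unif_lipschitzD:
  assumes "unif_lipschitz T L F" "x \<in> skor_D T" "y \<in> skor_D T" "\<And>t. t \<in> {0..T} \<Longrightarrow> \<bar>x t - y t\<bar> \<le> e"
  shows "\<bar>F x - F y\<bar> \<le> L * e"
  using assms unfolding unif_lipschitz_def by blast

text \<open>An infimum of functions that are all \<open>k\<close>-Lipschitz in \<open>x\<close>, by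
  the triangle inequality, is \<open>k\<close>-Lipschitz.\<close>

lemma unif_lipschitz_inf_conv:
  assumes "T \<ge> 0" "k \<ge> 0" "\<And>y. y \<in> skor_D T \<Longrightarrow> - B \<le> f y"
  shows "unif_lipschitz T k (inf_conv T k f)"
proof -
  have le: "inf_conv T k f x \<le> inf_conv T k f x' + k * e"
    if x: "x \<in> skor_D T" "x' \<in> skor_D T" "\<And>t. t \<in> {0..T} \<Longrightarrow> \<bar>x t - x' t\<bar> \<le> e" for x x' e
  proof -
    have "inf_conv T k f x - k * e \<le> inf_conv T k f x'"
      unfolding inf_conv_def[of T k f x']
    proof (rule cINF_greatest)
      show "skor_D T \<noteq> {}" using zero_in_skor_D by blast
      fix y assume y: "y \<in> skor_D T"
      have "unif_dist T x y \<le> e + unif_dist T x' y"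
      proof (rule unif_dist_least[OF assms(1)])
        fix t assume t: "t \<in> {0..T}"
        show "\<bar>x t - y t\<bar> \<le> e + unif_dist T x' y" using x(3)[OF t] unif_dist_upper[OF x(2) y t] by linarith
      qed
      then have "k * unif_dist T x y \<le> k * (e + unif_dist T x' y)" using assms(2) by (rule mult_left_mono)
      moreover have "inf_conv T k f x \<le> f y + k * unif_dist T x y"
        unfolding inf_conv_def by (rule cINF_lower[OF inf_conv_bdd_below[OF assms(1,2) x(1) assms(3)] y])
      ultimately show "inf_conv T k f x - k * e \<le> f y + k * unif_dist T x' y" by (simp add: algebra_simps)
    qed
    then show ?thesis by linarith
  qed
  show ?thesis unfolding unif_lipschitz_def
  proof (intro ballI allI impI)
    fix x y e assume *: "x \<in> skor_D T" "y \<in> skor_D T" "\<forall>t\<in>{0..T}. \<bar>x t - y t\<bar> \<le> e"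
    then have "\<And>t. t \<in> {0..T} \<Longrightarrow> \<bar>y t - x t\<bar> \<le> e" by (metis abs_minus_commute)
    with le[of x y e] le[of y x e] * show "\<bar>inf_conv T k f x - inf_conv T k f y\<bar> \<le> k * e" by force
  qed
qed

text \<open>A competitor at distance at least \<open>d\<close> pays a penalty of
  \<open>k * d\<close>, which outweighs the whole range 2 B of \<open>f\<close>; so only competitors
  near \<open>x\<close> can lower the infimum.\<close>

lemma inf_conv_lower:
  assumes "T \<ge> 0" "k \<ge> 0" "x \<in> skor_D T" "\<And>y. y \<in> skor_D T \<Longrightarrow> \<bar>f y\<bar> \<le> B"
    and "d > 0" "2 * B \<le> k * d" "e \<ge> 0"
    and near: "\<And>y. y \<in> skor_D T \<Longrightarrow> unif_dist T x y < d \<Longrightarrow> f x - e \<le> f y"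
  shows "f x - e \<le> inf_conv T k f x"
  unfolding inf_conv_def
proof (rule cINF_greatest)
  show "skor_D T \<noteq> {}" using zero_in_skor_D by blast
  fix y assume y: "y \<in> skor_D T"
  have nn: "0 \<le> k * unif_dist T x y" using unif_dist_nonneg[OF assms(1,3) y] assms(2) by simp
  show "f x - e \<le> f y + k * unif_dist T x y"
  proof (cases "unif_dist T x y < d")
    case True with near[OF y] nn show ?thesis by linarith
  next
    case False
    then have "k * d \<le> k * unif_dist T x y" using assms(2) by (intro mult_left_mono) auto
    with assms(4)[OF y] assms(4)[OF assms(3)] assms(6,7) show ?thesis by linarith
  qed
qed

lemma skor_dist_le_unif_dist:
  assumes "T \<ge> 0" "x \<in> skor_D T" "y \<in> skor_D T" shows "skor_dist T x y \<le> unif_dist T x y"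
  using assms by (intro skor_dist_le_uniform unif_dist_upper)

text \<open>By uniform continuity a continuous path is approximated without any time change. This is
  where continuity of the limit paths pays off.\<close>

lemma step_path_uniform_approx:
  assumes T: "T > 0" and w: "continuous_on {0..T} w" and e: "e > 0"
  shows "\<exists>M. \<forall>m\<ge>M. \<forall>t\<in>{0..T}. \<bar>w t - step_path T m (\<lambda>j. w (grid T m j)) t\<bar> \<le> e"
proof -
  have "uniformly_continuous_on {0..T} w" using w by (intro compact_uniformly_continuous) auto
  then obtain d where d: "d > 0" "\<And>s t. s \<in> {0..T} \<Longrightarrow> t \<in> {0..T} \<Longrightarrow> dist s t < d \<Longrightarrow> dist (w s) (w t) < e"
    using e unfolding uniformly_continuous_on_def by metis
  obtain M :: nat where M: "T / d < M" using reals_Archimedean2 by blast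
  have "\<bar>w t - step_path T m (\<lambda>j. w (grid T m j)) t\<bar> \<le> e" if "m \<ge> M" "t \<in> {0..T}" for m t
  proof -
    have "0 < T / d" using T d(1) by simp
    then have m: "m > 0" "T / d < m" using M that(1) by linarith+
    then have "T / m < d" using d(1) by (simp add: field_simps)
    with grid_floor_bounds[OF T that(2) m(1)] have "dist t (grid T m (nat \<lfloor>real m / T * t\<rfloor>)) < d"
      by (auto simp: dist_real_def)
    from d(2)[OF that(2) grid_floor_bounds(3)[OF T that(2) m(1)] this]
    show ?thesis by (simp add: step_path_def dist_real_def)
  qed
  then show ?thesis by blast
qed

text \<open>Only the unweighted process is frozen on the grid, and the weight \<open>g\<close> is
  multiplied on afterwards: the oscillation bound concerns the process without its weight.\<close>

lemma weighted_step_path_in_skor_D: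
  assumes "T > 0" "continuous_on {0..T} g"
  shows "(\<lambda>t. g t * step_path T m z t) \<in> skor_D T"
  using cadlag_on_mult[OF cadlag_on_continuous[OF assms(2)] cadlag_step_path[OF assms(1)]] by (simp add: skor_D_def)

lemma unif_lipschitz_step_path:
  assumes T: "T > 0" and g: "continuous_on {0..T} g" "\<And>t. t \<in> {0..T} \<Longrightarrow> \<bar>g t\<bar> \<le> G"
    and F: "unif_lipschitz T L F" "L \<ge> 0"
    and z: "\<And>j. j \<le> m \<Longrightarrow> \<bar>z j - z' j\<bar> \<le> d"
  shows "\<bar>F (\<lambda>t. g t * step_path T m z t) - F (\<lambda>t. g t * step_path T m z' t)\<bar> \<le> L * G * d"
proof -
  have "\<bar>g t * step_path T m z t - g t * step_path T m z' t\<bar> \<le> G * d" if t: "t \<in> {0..T}" for t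
  proof -
    have "\<bar>g t * step_path T m z t - g t * step_path T m z' t\<bar> = \<bar>g t\<bar> * \<bar>step_path T m z t - step_path T m z' t\<bar>"
      by (simp add: abs_mult[symmetric] algebra_simps)
    also have "\<dots> \<le> G * d"
      using g(2)[OF t] z[OF grid_index_le[OF T t]] by (intro mult_mono) (auto simp: step_path_def intro: order_trans[OF abs_ge_zero])
    finally show ?thesis .
  qed
  then have "\<bar>F (\<lambda>t. g t * step_path T m z t) - F (\<lambda>t. g t * step_path T m z' t)\<bar> \<le> L * (G * d)"
    by (rule unif_lipschitzD[OF F(1) weighted_step_path_in_skor_D[OF T g(1)] weighted_step_path_in_skor_D[OF T g(1)]])
  then show ?thesis by (simp add: mult.assoc)
qed

lemma borel_measurable_unif_lipschitz_step_path:
  assumes T: "T > 0" and g: "continuous_on {0..T} g" "\<And>t. t \<in> {0..T} \<Longrightarrow> \<bar>g t\<bar> \<le> G"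
    and F: "unif_lipschitz T L F" "L \<ge> 0"
    and meas: "\<And>t. t \<in> {0..T} \<Longrightarrow> X t \<in> borel_measurable M"
  shows "(\<lambda>\<omega>. F (\<lambda>t. g t * step_path T m (\<lambda>j. X (grid T m j) \<omega>) t)) \<in> borel_measurable M"
proof -
  have G0: "G \<ge> 0" using g(2)[of 0] T by auto
  have F': "(\<lambda>z. F (\<lambda>t. g t * step_path T m z t)) \<in> borel_measurable borel"
  proof (rule borel_measurable_finite_coords)
    fix z :: "nat \<Rightarrow> real" and e :: real assume e: "e > 0"
    define d where "d = e / (L * G + 1)"
    have LG: "0 \<le> L * G" using G0 F(2) by simp
    then have d: "d > 0" using e by (simp add: d_def)
    have "L * G * d < e" using LG e by (simp add: d_def field_simps)
    moreover have "\<bar>F (\<lambda>t. g t * step_path T m z' t) - F (\<lambda>t. g t * step_path T m z t)\<bar> \<le> L * G * d"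
      if "\<forall>j\<le>m. \<bar>z' j - z j\<bar> < d" for z'
      using that by (intro unif_lipschitz_step_path[OF T g F]) (auto intro: less_imp_le)
    ultimately show "\<exists>d>0. \<forall>z'. (\<forall>j\<le>m. \<bar>z' j - z j\<bar> < d) \<longrightarrow>
        \<bar>F (\<lambda>t. g t * step_path T m z' t) - F (\<lambda>t. g t * step_path T m z t)\<bar> < e"
      using d by (intro exI[of _ d]) force
  qed
  define z where "z \<omega> j = (if j \<le> m then X (grid T m j) \<omega> else 0)" for \<omega> j
  have "z \<in> borel_measurable M"
  proof (rule measurable_coordinatewise_then_product)
    fix i show "(\<lambda>x. z x i) \<in> borel_measurable M"
      unfolding z_def using meas grid_mem[OF T, of i m] by (cases "i \<le> m") auto
  qed
  from measurable_compose[OF this F'] have "(\<lambda>\<omega>. F (\<lambda>t. g t * step_path T m (z \<omega>) t)) \<in> borel_measurable M" .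
  moreover have "F (\<lambda>t. g t * step_path T m (z \<omega>) t) = F (\<lambda>t. g t * step_path T m (\<lambda>j. X (grid T m j) \<omega>) t)" for \<omega>
    using unif_lipschitz_step_path[OF T g F, of m "z \<omega>" "\<lambda>j. X (grid T m j) \<omega>" 0] by (auto simp: z_def)
  ultimately show ?thesis by simp
qed

lemma unif_lipschitz_step_path_tendsto:
  assumes T: "T > 0" and g: "continuous_on {0..T} g" "\<And>t. t \<in> {0..T} \<Longrightarrow> \<bar>g t\<bar> \<le> G"
    and F: "unif_lipschitz T L F" "L \<ge> 0" and w: "continuous_on {0..T} w"
  shows "(\<lambda>m. F (\<lambda>t. g t * step_path T m (\<lambda>j. w (grid T m j)) t)) \<longlonglongrightarrow> F (\<lambda>t. g t * w t)"
proof (rule LIMSEQ_I)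
  fix r :: real assume r: "r > 0"
  have G0: "G \<ge> 0" using g(2)[of 0] T by auto
  define d where "d = r / (L * G + 1)"
  have LG: "0 \<le> L * G" using G0 F(2) by simp
  then have d: "d > 0" using r by (simp add: d_def)
  have lt: "L * (G * d) < r" using LG r by (simp add: d_def field_simps)
  from step_path_uniform_approx[OF T w d] obtain M where
    M: "\<And>m t. m \<ge> M \<Longrightarrow> t \<in> {0..T} \<Longrightarrow> \<bar>w t - step_path T m (\<lambda>j. w (grid T m j)) t\<bar> \<le> d" by blast
  have "norm (F (\<lambda>t. g t * step_path T m (\<lambda>j. w (grid T m j)) t) - F (\<lambda>t. g t * w t)) < r" if m: "m \<ge> M" for m
  proof -
    have "\<bar>g t * step_path T m (\<lambda>j. w (grid T m j)) t - g t * w t\<bar> \<le> G * d" if t: "t \<in> {0..T}" for t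
    proof -
      have "\<bar>g t * step_path T m (\<lambda>j. w (grid T m j)) t - g t * w t\<bar> = \<bar>g t\<bar> * \<bar>w t - step_path T m (\<lambda>j. w (grid T m j)) t\<bar>"
        by (simp add: abs_mult[symmetric] abs_minus_commute right_diff_distrib)
      also have "\<dots> \<le> G * d" using g(2)[OF t] M[OF m t] G0 by (intro mult_mono) auto
      finally show ?thesis .
    qed
    moreover have "(\<lambda>t. g t * w t) \<in> skor_D T" using g(1) w
      by (auto simp: skor_D_def intro!: cadlag_on_continuous continuous_intros)
    ultimately have "\<bar>F (\<lambda>t. g t * step_path T m (\<lambda>j. w (grid T m j)) t) - F (\<lambda>t. g t * w t)\<bar> \<le> L * (G * d)"
      by (intro unif_lipschitzD[OF F(1) weighted_step_path_in_skor_D[OF T g(1)]])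
    with lt show ?thesis by simp
  qed
  then show "\<exists>no. \<forall>m\<ge>no. norm (F (\<lambda>t. g t * step_path T m (\<lambda>j. w (grid T m j)) t) - F (\<lambda>t. g t * w t)) < r"
    by blast
qed

text \<open>The sigma-algebra is generated by open sets and not by evaluations, so each open
  \<open>U\<close> has to be reached. The inf-convolution \<open>F\<close> of its indicator is
  positive exactly on \<open>U\<close>, and being Lipschitz it is, along continuous paths, a limit
  of functions of finitely many evaluations.\<close>

lemma continuous_process_skor_measurable:
  assumes T: "T > 0" and cont: "\<And>\<omega>. \<omega> \<in> space M \<Longrightarrow> continuous_on {0..T} (X \<omega>)"
    and meas: "\<And>t. t \<in> {0..T} \<Longrightarrow> (\<lambda>\<omega>. X \<omega> t) \<in> borel_measurable M"
  shows "X \<in> measurable M (skor_borel T)"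
  unfolding skor_borel_def
proof (rule measurable_measure_of)
  have XD: "X \<omega> \<in> skor_D T" if "\<omega> \<in> space M" for \<omega>
    using cont[OF that] by (simp add: skor_D_def cadlag_on_continuous)
  then show "X \<in> space M \<rightarrow> skor_D T" by blast
  fix U assume "U \<in> {U. skor_open T U}"
  then have U: "skor_open T U" by simp
  define F where "F = inf_conv T 1 (indicat_real U)"
  have T0: "T \<ge> 0" using T by simp
  have bnd: "- 0 \<le> indicat_real U y" for y by simp
  have lip: "unif_lipschitz T 1 F" unfolding F_def using T0 bnd by (intro unif_lipschitz_inf_conv[where B = 0]) auto
  have "(\<lambda>\<omega>. F (X \<omega>)) \<in> borel_measurable M"
  proof (rule borel_measurable_LIMSEQ_real)
    fix m show "(\<lambda>\<omega>. F (\<lambda>t. 1 * step_path T m (\<lambda>j. X \<omega> (grid T m j)) t)) \<in> borel_measurable M"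
      by (rule borel_measurable_unif_lipschitz_step_path[OF T _ _ lip, of _ 1 "\<lambda>t \<omega>. X \<omega> t"]) (auto intro: meas)
  next
    fix \<omega> assume "\<omega> \<in> space M"
    from unif_lipschitz_step_path_tendsto[OF T _ _ lip _ cont[OF this], of "\<lambda>_. 1" 1]
    show "(\<lambda>m. F (\<lambda>t. 1 * step_path T m (\<lambda>j. X \<omega> (grid T m j)) t)) \<longlonglongrightarrow> F (X \<omega>)" by simp
  qed
  then have "{\<omega> \<in> space M. 0 < F (X \<omega>)} \<in> sets M" by (rule borel_measurable_less[OF borel_measurable_const])
  moreover have "(0 < F x) = (x \<in> U)" if x: "x \<in> skor_D T" for x
  proof
    assume "x \<in> U"
    with U obtain e where e: "e > 0" "\<And>y. y \<in> skor_D T \<Longrightarrow> skor_dist T x y < e \<Longrightarrow> y \<in> U"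
      unfolding skor_open_def by blast
    \<comment> \<open>A competitor in \<open>U\<close> costs at least 1 through the indicator, one
      outside \<open>U\<close> at least \<open>e\<close> through the distance.\<close>
    have "min 1 e \<le> F x" unfolding F_def inf_conv_def
    proof (rule cINF_greatest)
      show "skor_D T \<noteq> {}" using zero_in_skor_D by blast
      fix y assume y: "y \<in> skor_D T"
      show "min 1 e \<le> indicat_real U y + 1 * unif_dist T x y"
      proof (cases "y \<in> U")
        case True
        then show ?thesis using unif_dist_nonneg[OF T0 x y] by simp
      next
        case False
        with e(2)[OF y] have "e \<le> skor_dist T x y" by (meson not_less)
        with skor_dist_le_unif_dist[OF T0 x y] False show ?thesis by simp
      qed
    qed
    then show "0 < F x" using e(1) by linarith
  next
    assume "0 < F x"
    moreover have "F x \<le> indicat_real U x" unfolding F_def using T0 bnd x by (intro inf_conv_le[where B = 0]) auto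
    ultimately show "x \<in> U" by (cases "x \<in> U") auto
  qed
  then have "X -` U \<inter> space M = {\<omega> \<in> space M. 0 < F (X \<omega>)}" using XD by auto
  ultimately show "X -` U \<inter> space M \<in> sets M" by simp
qed (rule skor_open_subset)

section \<open>Convergence of characteristic functions\<close>

text \<open>Write |p - q| as (p - q) + 2 max 0 (q - p). The first part integrates to 0 because the
  masses agree, and the second is dominated by \<open>q\<close>.\<close>

lemma scheffe_L1:
  fixes p :: "nat \<Rightarrow> 'a \<Rightarrow> real"
  assumes p: "\<And>n. integrable M (p n)" "\<And>n x. 0 \<le> p n x" "\<And>n. integral\<^sup>L M (p n) = c"
    and q: "integrable M q" "\<And>x. 0 \<le> q x" "integral\<^sup>L M q = c"
    and lim: "\<And>x. x \<in> space M \<Longrightarrow> (\<lambda>n. p n x) \<longlonglongrightarrow> q x"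
  shows "(\<lambda>n. \<integral>x. \<bar>p n x - q x\<bar> \<partial>M) \<longlonglongrightarrow> 0"
proof -
  have [measurable]: "p n \<in> borel_measurable M" "q \<in> borel_measurable M" for n
    using p(1) q(1) by auto
  have int: "integrable M (\<lambda>x. max 0 (q x - p n x))" for n
    by (rule Bochner_Integration.integrable_bound[OF q(1)]) (use p(2) q(2) in \<open>auto intro!: AE_I2 simp: max_def\<close>)
  have "(\<lambda>n. \<integral>x. max 0 (q x - p n x) \<partial>M) \<longlonglongrightarrow> (\<integral>x. 0 \<partial>M)"
  proof (rule integral_dominated_convergence[OF _ _ q(1)])
    show "AE x in M. (\<lambda>n. max 0 (q x - p n x)) \<longlonglongrightarrow> 0"
    proof (rule AE_I2)
      fix x assume "x \<in> space M"
      from tendsto_max[OF tendsto_const[of 0] tendsto_diff[OF tendsto_const[of "q x"] lim[OF this]]]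
      show "(\<lambda>n. max 0 (q x - p n x)) \<longlonglongrightarrow> 0" by simp
    qed
  qed (use p(2) q(2) in \<open>auto intro!: AE_I2 simp: max_def\<close>)
  moreover have "(\<integral>x. \<bar>p n x - q x\<bar> \<partial>M) = 2 * (\<integral>x. max 0 (q x - p n x) \<partial>M)" for n
  proof -
    have "(\<integral>x. \<bar>p n x - q x\<bar> \<partial>M) = (\<integral>x. (p n x - q x) + 2 * max 0 (q x - p n x) \<partial>M)"
      by (intro Bochner_Integration.integral_cong) (auto simp: max_def abs_if)
    also have "\<dots> = 2 * (\<integral>x. max 0 (q x - p n x) \<partial>M)"
      using int p q by simp
    finally show ?thesis .
  qed
  ultimately show ?thesis by (auto intro: tendsto_mult_right_zero)
qed

section \<open>Gaussian smoothing and Fourier inversion\<close>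

abbreviation std_normal_PiM :: "nat \<Rightarrow> (nat \<Rightarrow> real) measure" where
  "std_normal_PiM m \<equiv> PiM {..m} (\<lambda>_. std_normal_distribution)"

abbreviation normal_prod :: "nat \<Rightarrow> real \<Rightarrow> (nat \<Rightarrow> real) \<Rightarrow> (nat \<Rightarrow> real) \<Rightarrow> real" where
  "normal_prod m \<sigma> x y \<equiv> (\<Prod>j\<le>m. normal_density (x j) \<sigma> (y j))"

abbreviation lborel_PiM :: "nat \<Rightarrow> (nat \<Rightarrow> real) measure" where
  "lborel_PiM m \<equiv> PiM {..m} (\<lambda>_. lborel)"

text \<open>The Lebesgue density of the vector (X 0, ..., X m) plus an independent Gaussian vector
  with independent centred coordinates of standard deviation \<open>\<sigma>\<close>.\<close>

definition smoothed_density :: "'a measure \<Rightarrow> (nat \<Rightarrow> 'a \<Rightarrow> real) \<Rightarrow> nat \<Rightarrow> real \<Rightarrow> (nat \<Rightarrow> real) \<Rightarrow> real" where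
  "smoothed_density M X m \<sigma> y = (\<integral>\<omega>. normal_prod m \<sigma> (\<lambda>j. X j \<omega>) y \<partial>M)"

lemma prob_space_std_normal_PiM: "prob_space (std_normal_PiM m)"
  by (intro prob_space_PiM) (use prob_space_normal_density in auto)

text \<open>The Gaussian is its own Fourier transform: the normal density at \<open>y\<close> is a
  multiple of the standard normal characteristic function at (y - \<mu>)/\<sigma>.\<close>

lemma normal_density_as_char:
  assumes "\<sigma> > 0"
  shows "complex_of_real (normal_density \<mu> \<sigma> y) =
    complex_of_real (1 / (\<sigma> * sqrt (2 * pi))) * (CLINT v|std_normal_distribution. iexp ((y - \<mu>) / \<sigma> * v))"
proof -
  have "(CLINT v|std_normal_distribution. iexp ((y - \<mu>) / \<sigma> * v)) = complex_of_real (exp (- (((y - \<mu>) / \<sigma>)\<^sup>2) / 2))"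
    using fun_cong[OF char_std_normal_distribution, of "(y - \<mu>) / \<sigma>"] unfolding char_def .
  moreover have "normal_density \<mu> \<sigma> y = 1 / (\<sigma> * sqrt (2 * pi)) * exp (- (((y - \<mu>) / \<sigma>)\<^sup>2) / 2)"
    using assms by (simp add: normal_density_def real_sqrt_mult power_divide mult_ac)
  ultimately show ?thesis by simp
qed

text \<open>Fourier inversion with Gaussian damping. Inserting the Fourier form of every factor and
  exchanging the integrals leaves an expression in which \<open>X\<close> occurs only through its
  joint characteristic function at - v/\<sigma>.\<close>

lemma smoothed_density_fourier:
  assumes M: "prob_space M" and X[measurable]: "\<And>j. X j \<in> borel_measurable M" and \<sigma>: "\<sigma> > 0"
  shows "complex_of_real (smoothed_density M X m \<sigma> y) =
    complex_of_real ((1 / (\<sigma> * sqrt (2 * pi))) ^ Suc m) *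
    (CLINT v|std_normal_PiM m. iexp (\<Sum>j\<le>m. y j / \<sigma> * v j) * (CLINT \<omega>|M. iexp (\<Sum>j\<le>m. (- v j / \<sigma>) * X j \<omega>)))"
proof -
  interpret M: prob_space M by fact
  interpret N: prob_space "std_normal_PiM m" by (rule prob_space_std_normal_PiM)
  interpret P: pair_prob_space M "std_normal_PiM m" ..
  interpret S: prob_space std_normal_distribution using prob_space_normal_density by auto
  interpret F: product_sigma_finite "\<lambda>_::nat. std_normal_distribution" ..
  let ?c = "1 / (\<sigma> * sqrt (2 * pi))"
  have prod: "complex_of_real (normal_prod m \<sigma> (\<lambda>j. X j \<omega>) y) = complex_of_real (?c ^ Suc m) *
     (CLINT v|std_normal_PiM m. iexp (\<Sum>j\<le>m. y j / \<sigma> * v j) * iexp (\<Sum>j\<le>m. (- v j / \<sigma>) * X j \<omega>))" for \<omega>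
  proof -
    have "complex_of_real (normal_prod m \<sigma> (\<lambda>j. X j \<omega>) y) =
      complex_of_real (?c ^ Suc m) * (\<Prod>j\<le>m. CLINT v|std_normal_distribution. iexp ((y j - X j \<omega>) / \<sigma> * v))"
      unfolding of_real_prod normal_density_as_char[OF \<sigma>] prod.distrib by simp
    also have "(\<Prod>j\<le>m. CLINT v|std_normal_distribution. iexp ((y j - X j \<omega>) / \<sigma> * v)) =
      (CLINT v|std_normal_PiM m. (\<Prod>j\<le>m. iexp ((y j - X j \<omega>) / \<sigma> * v j)))"
      by (intro F.product_integral_prod[symmetric] S.integrable_const_bound[where B = 1]) auto
    also have "\<dots> = (CLINT v|std_normal_PiM m. iexp (\<Sum>j\<le>m. y j / \<sigma> * v j) * iexp (\<Sum>j\<le>m. (- v j / \<sigma>) * X j \<omega>))"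
    proof (intro Bochner_Integration.integral_cong refl)
      fix v :: "nat \<Rightarrow> real"
      have "(\<Prod>j\<le>m. iexp ((y j - X j \<omega>) / \<sigma> * v j)) = exp (\<Sum>j\<le>m. \<i> * complex_of_real ((y j - X j \<omega>) / \<sigma> * v j))"
        by (rule exp_sum[symmetric]) simp
      also have "(\<Sum>j\<le>m. \<i> * complex_of_real ((y j - X j \<omega>) / \<sigma> * v j)) =
        \<i> * complex_of_real (\<Sum>j\<le>m. y j / \<sigma> * v j) + \<i> * complex_of_real (\<Sum>j\<le>m. (- v j / \<sigma>) * X j \<omega>)"
        unfolding sum_distrib_left[symmetric] distrib_left[symmetric] of_real_sum[symmetric] of_real_add[symmetric] sum.distrib[symmetric]
        by (simp add: field_simps diff_divide_distrib)
      finally show "(\<Prod>j\<le>m. iexp ((y j - X j \<omega>) / \<sigma> * v j)) = iexp (\<Sum>j\<le>m. y j / \<sigma> * v j) * iexp (\<Sum>j\<le>m. (- v j / \<sigma>) * X j \<omega>)"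
        by (simp add: exp_add)
    qed
    finally show ?thesis .
  qed
  have "complex_of_real (smoothed_density M X m \<sigma> y) =
    (CLINT \<omega>|M. complex_of_real (?c ^ Suc m) *
     (CLINT v|std_normal_PiM m. iexp (\<Sum>j\<le>m. y j / \<sigma> * v j) * iexp (\<Sum>j\<le>m. (- v j / \<sigma>) * X j \<omega>)))"
    unfolding smoothed_density_def integral_complex_of_real[symmetric] prod ..
  also have "\<dots> = complex_of_real (?c ^ Suc m) * (CLINT \<omega>|M.
     (CLINT v|std_normal_PiM m. iexp (\<Sum>j\<le>m. y j / \<sigma> * v j) * iexp (\<Sum>j\<le>m. (- v j / \<sigma>) * X j \<omega>)))"
    by simp
  \<comment> \<open>The integrand has modulus 1 and both measures are probabilities, so Fubini
    applies.\<close>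
  also have "(CLINT \<omega>|M. (CLINT v|std_normal_PiM m. iexp (\<Sum>j\<le>m. y j / \<sigma> * v j) * iexp (\<Sum>j\<le>m. (- v j / \<sigma>) * X j \<omega>))) =
    (CLINT v|std_normal_PiM m. (CLINT \<omega>|M. iexp (\<Sum>j\<le>m. y j / \<sigma> * v j) * iexp (\<Sum>j\<le>m. (- v j / \<sigma>) * X j \<omega>)))"
    by (rule P.Fubini_integral[symmetric], rule P.integrable_const_bound[where B = 1]) (auto simp: norm_mult)
  finally show ?thesis by simp
qed

lemma normal_density_prod_integral:
  fixes x :: "nat \<Rightarrow> real"
  assumes "\<sigma> > 0"
  shows "integrable (lborel_PiM m) (\<lambda>y. normal_prod m \<sigma> x y)"
    and "(\<integral>y. normal_prod m \<sigma> x y \<partial>lborel_PiM m) = 1"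
proof -
  interpret F: product_sigma_finite "\<lambda>_::nat. lborel :: real measure" ..
  show "integrable (lborel_PiM m) (\<lambda>y. normal_prod m \<sigma> x y)"
    by (rule F.product_integrable_prod[where f = "\<lambda>j. normal_density (x j) \<sigma>"]) (use assms in auto)
  show "(\<integral>y. normal_prod m \<sigma> x y \<partial>lborel_PiM m) = 1"
    by (subst F.product_integral_prod[where f = "\<lambda>j. normal_density (x j) \<sigma>"]) (use assms in auto)
qed

text \<open>\<sigma> sqrt (2/pi) is the mean absolute deviation of a centred normal variable; the
  other factors integrate to 1. It measures the error made by smoothing a Lipschitz
  function.\<close>

lemma normal_density_prod_first_moment:
  fixes i m :: nat
  assumes \<sigma>: "\<sigma> > 0" and i: "i \<le> m"
  shows "integrable (lborel_PiM m) (\<lambda>y. \<bar>y i - x i\<bar> * normal_prod m \<sigma> x y)"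
    and "(\<integral>y. \<bar>y i - x i\<bar> * normal_prod m \<sigma> x y \<partial>lborel_PiM m) = \<sigma> * sqrt (2 / pi)"
proof -
  interpret F: product_sigma_finite "\<lambda>_::nat. lborel :: real measure" ..
  define f where "f j z = (if j = i then normal_density (x j) \<sigma> z * \<bar>z - x j\<bar> else normal_density (x j) \<sigma> z)" for j z
  have eq: "\<bar>y i - x i\<bar> * normal_prod m \<sigma> x y = (\<Prod>j\<le>m. f j (y j))" for y :: "nat \<Rightarrow> real"
  proof -
    have "(\<Prod>j\<le>m. f j (y j)) = normal_prod m \<sigma> x y * (\<Prod>j\<le>m. if j = i then \<bar>y j - x j\<bar> else 1)"
      unfolding prod.distrib[symmetric] by (intro prod.cong) (auto simp: f_def)
    also have "(\<Prod>j\<le>m. if j = i then \<bar>y j - x j\<bar> else 1) = \<bar>y i - x i\<bar>" using i by (subst prod.delta) auto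
    finally show ?thesis by simp
  qed
  have m1: "has_bochner_integral lborel (\<lambda>z. normal_density (x i) \<sigma> z * \<bar>z - x i\<bar>) (\<sigma> * sqrt (2 / pi))"
    using normal_moment_abs_odd[OF \<sigma>, of "x i" 0] by (simp add: mult.commute)
  have f: "integrable lborel (f j)" "integral\<^sup>L lborel (f j) = (if j = i then \<sigma> * sqrt (2 / pi) else 1)" for j
    using m1 \<sigma> unfolding f_def[abs_def] by (cases "j = i"; simp add: has_bochner_integral_iff)+
  show "integrable (lborel_PiM m) (\<lambda>y. \<bar>y i - x i\<bar> * normal_prod m \<sigma> x y)"
    unfolding eq by (rule F.product_integrable_prod[where f = f]) (use f in auto)
  show "(\<integral>y. \<bar>y i - x i\<bar> * normal_prod m \<sigma> x y \<partial>lborel_PiM m) = \<sigma> * sqrt (2 / pi)"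
    unfolding eq by (subst F.product_integral_prod[where f = f]) (use f i in auto)
qed

text \<open>Fubini in both directions: integrating \<open>h\<close> against the smoothed density
  means averaging the Gaussian smoothing of \<open>h\<close> over the law of
  \<open>X\<close>.\<close>

lemma smoothed_density_integral:
  fixes h :: "(nat \<Rightarrow> real) \<Rightarrow> real"
  assumes M: "prob_space M" and X[measurable]: "\<And>j. X j \<in> borel_measurable M" and \<sigma>: "\<sigma> > 0"
    and h[measurable]: "h \<in> borel_measurable (lborel_PiM m)" and B: "\<And>y. \<bar>h y\<bar> \<le> B"
  shows "integrable (lborel_PiM m) (\<lambda>y. h y * smoothed_density M X m \<sigma> y)"
    and "(\<integral>y. h y * smoothed_density M X m \<sigma> y \<partial>lborel_PiM m) =
      (\<integral>\<omega>. (\<integral>y. h y * normal_prod m \<sigma> (\<lambda>j. X j \<omega>) y \<partial>lborel_PiM m) \<partial>M)"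
    and "integrable M (\<lambda>\<omega>. (\<integral>y. h y * normal_prod m \<sigma> (\<lambda>j. X j \<omega>) y \<partial>lborel_PiM m))"
proof -
  let ?L = "lborel_PiM m"
  interpret M: prob_space M by fact
  interpret F: product_sigma_finite "\<lambda>_::nat. lborel :: real measure" ..
  interpret L: sigma_finite_measure ?L by (rule F.sigma_finite) simp
  interpret P: pair_sigma_finite M ?L ..
  have [measurable]: "(\<lambda>(\<omega>, y). normal_prod m \<sigma> (\<lambda>j. X j \<omega>) y) \<in> borel_measurable (M \<Otimes>\<^sub>M ?L)"
    unfolding normal_density_def by measurable
  have int1: "integrable (M \<Otimes>\<^sub>M ?L) (\<lambda>(\<omega>, y). normal_prod m \<sigma> (\<lambda>j. X j \<omega>) y)"
  proof (rule P.Fubini_integrable)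
    have "(\<integral>y. norm (case (\<omega>, y) of (\<omega>, y) \<Rightarrow> normal_prod m \<sigma> (\<lambda>j. X j \<omega>) y) \<partial>?L) = 1" for \<omega>
      using normal_density_prod_integral(2)[OF \<sigma>, where x = "\<lambda>j. X j \<omega>" and m = m] by (simp add: prod_nonneg)
    then show "integrable M (\<lambda>\<omega>. \<integral>y. norm (case (\<omega>, y) of (\<omega>, y) \<Rightarrow> normal_prod m \<sigma> (\<lambda>j. X j \<omega>) y) \<partial>?L)"
      by simp
  qed (use normal_density_prod_integral(1)[OF \<sigma>] in auto)
  have int2: "integrable (M \<Otimes>\<^sub>M ?L) (\<lambda>(\<omega>, y). h y * normal_prod m \<sigma> (\<lambda>j. X j \<omega>) y)"
  proof (rule Bochner_Integration.integrable_bound[OF integrable_mult_right[OF int1, of B]])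
    have "\<bar>h y\<bar> * normal_prod m \<sigma> (\<lambda>j. X j \<omega>) y \<le> \<bar>B\<bar> * normal_prod m \<sigma> (\<lambda>j. X j \<omega>) y" for \<omega> y
      using B[of y] by (intro mult_right_mono) (auto simp: prod_nonneg)
    then show "AE x in M \<Otimes>\<^sub>M ?L. norm (case x of (\<omega>, y) \<Rightarrow> h y * normal_prod m \<sigma> (\<lambda>j. X j \<omega>) y)
      \<le> norm (B * (case x of (\<omega>, y) \<Rightarrow> normal_prod m \<sigma> (\<lambda>j. X j \<omega>) y))"
      by (auto simp: abs_mult prod_nonneg)
  qed measurable
  have eq: "(\<integral>\<omega>. h y * normal_prod m \<sigma> (\<lambda>j. X j \<omega>) y \<partial>M) = h y * smoothed_density M X m \<sigma> y" for y
    by (simp add: smoothed_density_def)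
  show "integrable ?L (\<lambda>y. h y * smoothed_density M X m \<sigma> y)"
    using P.integrable_snd[OF int2] unfolding eq .
  show "(\<integral>y. h y * smoothed_density M X m \<sigma> y \<partial>?L) =
      (\<integral>\<omega>. (\<integral>y. h y * normal_prod m \<sigma> (\<lambda>j. X j \<omega>) y \<partial>?L) \<partial>M)"
    using P.Fubini_integral[OF int2] unfolding eq .
  show "integrable M (\<lambda>\<omega>. (\<integral>y. h y * normal_prod m \<sigma> (\<lambda>j. X j \<omega>) y \<partial>?L))"
    using P.integrable_fst[OF int2] .
qed

text \<open>Convolving with a small Gaussian turns pointwise convergence of characteristic functions into
  pointwise convergence of densities, and hence, by Scheffe's lemma, into convergence of expectations.\<close>

lemma char_conv_imp_lipschitz_conv:
  fixes X :: "nat \<Rightarrow> nat \<Rightarrow> 'a \<Rightarrow> real" and Y :: "nat \<Rightarrow> 'b \<Rightarrow> real" and h :: "(nat \<Rightarrow> real) \<Rightarrow> real"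
  assumes M: "prob_space M" and Q: "prob_space Q"
    and X[measurable]: "\<And>n j. X n j \<in> borel_measurable M" and Y[measurable]: "\<And>j. Y j \<in> borel_measurable Q"
    and ch: "\<And>c. (\<lambda>n. CLINT \<omega>|M. iexp (\<Sum>j\<le>m. c j * X n j \<omega>)) \<longlonglongrightarrow> (CLINT \<omega>|Q. iexp (\<Sum>j\<le>m. c j * Y j \<omega>))"
    and B: "\<And>z. \<bar>h z\<bar> \<le> B" and L: "L \<ge> 0"
    and lip: "\<And>z z' d. (\<And>j. j \<le> m \<Longrightarrow> \<bar>z j - z' j\<bar> \<le> d) \<Longrightarrow> \<bar>h z - h z'\<bar> \<le> L * d"
  shows "(\<lambda>n. \<integral>\<omega>. h (\<lambda>j. X n j \<omega>) \<partial>M) \<longlonglongrightarrow> (\<integral>\<omega>. h (\<lambda>j. Y j \<omega>) \<partial>Q)"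
proof -
  interpret M: prob_space M by fact
  interpret Q: prob_space Q by fact
  let ?L = "lborel_PiM m"
  have h[measurable]: "h \<in> borel_measurable borel"
  proof (rule borel_measurable_finite_coords)
    fix z :: "nat \<Rightarrow> real" and e :: real assume e: "e > 0"
    have d: "e / (L + 1) > 0" "L * (e / (L + 1)) < e" using e L by (auto simp: field_simps)
    have "\<bar>h z' - h z\<bar> < e" if "\<forall>j\<le>m. \<bar>z' j - z j\<bar> < e / (L + 1)" for z'
      using lip[of z' z "e / (L + 1)"] that d(2) by (force intro: less_imp_le)
    with d(1) show "\<exists>d>0. \<forall>z'. (\<forall>j\<le>m. \<bar>z' j - z j\<bar> < d) \<longrightarrow> \<bar>h z' - h z\<bar> < e" by blast
  qed
  \<comment> \<open>Points of the product space over {..m} are \<open>undefined\<close> beyond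
    \<open>m\<close>, whereas \<open>h\<close> is measurable on full sequences; filling with 0
    connects the two.\<close>
  define h' where "h' y = h (\<lambda>j. if j \<le> m then y j else 0)" for y
  have [measurable]: "h' \<in> borel_measurable ?L"
    unfolding h'_def
  proof (rule measurable_compose[OF measurable_coordinatewise_then_product h])
    fix i show "(\<lambda>y. if i \<le> m then y i else 0) \<in> borel_measurable ?L" by (cases "i \<le> m") auto
  qed
  have h'B: "\<bar>h' y\<bar> \<le> B" for y unfolding h'_def by (rule B)
  have h'h: "\<bar>h' y - h x\<bar> \<le> L * (\<Sum>j\<le>m. \<bar>y j - x j\<bar>)" for x y
    unfolding h'_def
  proof (rule lip)
    fix j assume "j \<le> m"
    then show "\<bar>(if j \<le> m then y j else 0) - x j\<bar> \<le> (\<Sum>j\<le>m. \<bar>y j - x j\<bar>)"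
      using member_le_sum[of j "{..m}" "\<lambda>j. \<bar>y j - x j\<bar>"] by simp
  qed
  \<comment> \<open>The smoothing error is of order \<open>\<sigma>\<close> uniformly over all laws,
    so one \<open>\<sigma>\<close> serves the whole sequence and the limit.\<close>
  have close: "\<bar>(\<integral>\<omega>. h (\<lambda>j. Z j \<omega>) \<partial>P) - (\<integral>y. h' y * smoothed_density P Z m \<sigma> y \<partial>?L)\<bar> \<le> L * (real (Suc m) * (\<sigma> * sqrt (2 / pi)))"
    if \<sigma>: "\<sigma> > 0" and P: "prob_space P" and Z[measurable]: "\<And>j. Z j \<in> borel_measurable P" for \<sigma> and P :: "'c measure" and Z
  proof -
    interpret P: prob_space P by fact
    note sd = smoothed_density_integral[OF P Z \<sigma>, of h' m B]
    have 1: "\<bar>h x - (\<integral>y. h' y * normal_prod m \<sigma> x y \<partial>?L)\<bar> \<le> L * (real (Suc m) * (\<sigma> * sqrt (2 / pi)))" for x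
    proof -
      note i1 = normal_density_prod_integral[OF \<sigma>, where m = m and x = x]
      have i2: "integrable ?L (\<lambda>y. h' y * normal_prod m \<sigma> x y)"
      proof (rule Bochner_Integration.integrable_bound[OF integrable_mult_right[OF i1(1), of B]])
        have "\<bar>h' y\<bar> * normal_prod m \<sigma> x y \<le> \<bar>B\<bar> * normal_prod m \<sigma> x y" for y
          using h'B[of y] by (intro mult_right_mono) (auto simp: prod_nonneg)
        then show "AE y in ?L. norm (h' y * normal_prod m \<sigma> x y) \<le> norm (B * normal_prod m \<sigma> x y)"
          by (auto simp: abs_mult prod_nonneg)
      qed (use i1(1) in measurable)
      have "h x - (\<integral>y. h' y * normal_prod m \<sigma> x y \<partial>?L) =
        (\<integral>y. h x * normal_prod m \<sigma> x y - h' y * normal_prod m \<sigma> x y \<partial>?L)"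
        using i1 i2 by simp
      also have "\<bar>\<dots>\<bar> \<le> (\<integral>y. \<bar>h x * normal_prod m \<sigma> x y - h' y * normal_prod m \<sigma> x y\<bar> \<partial>?L)"
        by (rule integral_abs_bound)
      also have "\<dots> \<le> (\<integral>y. L * (\<Sum>i\<le>m. \<bar>y i - x i\<bar> * normal_prod m \<sigma> x y) \<partial>?L)"
      proof (rule integral_mono)
        fix y
        have "\<bar>h x * normal_prod m \<sigma> x y - h' y * normal_prod m \<sigma> x y\<bar>
          = \<bar>h' y - h x\<bar> * normal_prod m \<sigma> x y"
          by (simp add: left_diff_distrib[symmetric] abs_mult prod_nonneg abs_minus_commute)
        also have "\<dots> \<le> L * (\<Sum>j\<le>m. \<bar>y j - x j\<bar>) * normal_prod m \<sigma> x y"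
          using h'h by (intro mult_right_mono) (auto simp: prod_nonneg)
        also have "\<dots> = L * (\<Sum>i\<le>m. \<bar>y i - x i\<bar> * normal_prod m \<sigma> x y)"
          by (simp add: sum_distrib_right mult.assoc)
        finally show "\<bar>h x * normal_prod m \<sigma> x y - h' y * normal_prod m \<sigma> x y\<bar>
          \<le> L * (\<Sum>i\<le>m. \<bar>y i - x i\<bar> * normal_prod m \<sigma> x y)" .
      next
        show "integrable ?L (\<lambda>y. L * (\<Sum>i\<le>m. \<bar>y i - x i\<bar> * normal_prod m \<sigma> x y))"
          using normal_density_prod_first_moment(1)[OF \<sigma>]
          by (intro integrable_mult_right Bochner_Integration.integrable_sum) auto
      qed (use i1 i2 in simp)
      also have "\<dots> = L * (real (Suc m) * (\<sigma> * sqrt (2 / pi)))"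
        using normal_density_prod_first_moment[OF \<sigma>, where m = m and x = x] by (simp add: Bochner_Integration.integral_sum)
      finally show ?thesis .
    qed
    have int: "integrable P (\<lambda>\<omega>. h (\<lambda>j. Z j \<omega>))"
    proof (rule P.integrable_const_bound[where B = B])
      show "(\<lambda>\<omega>. h (\<lambda>j. Z j \<omega>)) \<in> borel_measurable P"
        by (rule measurable_compose[OF measurable_coordinatewise_then_product h]) measurable
    qed (use B in auto)
    have "\<bar>(\<integral>\<omega>. h (\<lambda>j. Z j \<omega>) \<partial>P) - (\<integral>y. h' y * smoothed_density P Z m \<sigma> y \<partial>?L)\<bar> =
      \<bar>\<integral>\<omega>. h (\<lambda>j. Z j \<omega>) - (\<integral>y. h' y * normal_prod m \<sigma> (\<lambda>j. Z j \<omega>) y \<partial>?L) \<partial>P\<bar>"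
      using sd h'B int by simp
    also have "\<dots> \<le> (\<integral>\<omega>. \<bar>h (\<lambda>j. Z j \<omega>) - (\<integral>y. h' y * normal_prod m \<sigma> (\<lambda>j. Z j \<omega>) y \<partial>?L)\<bar> \<partial>P)"
      by (rule integral_abs_bound)
    also have "\<dots> \<le> (\<integral>\<omega>. L * (real (Suc m) * (\<sigma> * sqrt (2 / pi))) \<partial>P)"
      using sd h'B int 1 by (intro integral_mono) auto
    finally show ?thesis by (simp add: P.prob_space)
  qed
  \<comment> \<open>In the Fourier formula the characteristic functions converge pointwise and are
    bounded by 1 under a probability measure.\<close>
  have dens: "(\<lambda>n. smoothed_density M (X n) m \<sigma> y) \<longlonglongrightarrow> smoothed_density Q Y m \<sigma> y" if \<sigma>: "\<sigma> > 0" for \<sigma> y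
  proof -
    interpret N: prob_space "std_normal_PiM m" by (rule prob_space_std_normal_PiM)
    interpret PM: pair_prob_space "std_normal_PiM m" M ..
    interpret PQ: pair_prob_space "std_normal_PiM m" Q ..
    have "(\<lambda>n. CLINT v|std_normal_PiM m. iexp (\<Sum>j\<le>m. y j / \<sigma> * v j) * (CLINT \<omega>|M. iexp (\<Sum>j\<le>m. (- v j / \<sigma>) * X n j \<omega>)))
      \<longlonglongrightarrow> (CLINT v|std_normal_PiM m. iexp (\<Sum>j\<le>m. y j / \<sigma> * v j) * (CLINT \<omega>|Q. iexp (\<Sum>j\<le>m. (- v j / \<sigma>) * Y j \<omega>)))"
    proof (rule integral_dominated_convergence[where w = "\<lambda>_. 1"])
      show "AE v in std_normal_PiM m. (\<lambda>n. iexp (\<Sum>j\<le>m. y j / \<sigma> * v j) * (CLINT \<omega>|M. iexp (\<Sum>j\<le>m. (- v j / \<sigma>) * X n j \<omega>)))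
        \<longlonglongrightarrow> iexp (\<Sum>j\<le>m. y j / \<sigma> * v j) * (CLINT \<omega>|Q. iexp (\<Sum>j\<le>m. (- v j / \<sigma>) * Y j \<omega>))"
        by (intro AE_I2 tendsto_mult tendsto_const ch)
      fix n
      have "norm (CLINT \<omega>|M. iexp (\<Sum>j\<le>m. (- v j / \<sigma>) * X n j \<omega>)) \<le> (\<integral>\<omega>. 1 \<partial>M)" for v
        by (rule order_trans[OF integral_norm_bound]) (auto intro!: integral_mono M.integrable_const_bound[where B = 1])
      then show "AE v in std_normal_PiM m. norm (iexp (\<Sum>j\<le>m. y j / \<sigma> * v j) * (CLINT \<omega>|M. iexp (\<Sum>j\<le>m. (- v j / \<sigma>) * X n j \<omega>))) \<le> 1"
        by (auto simp: norm_mult M.prob_space)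
    qed measurable
    from tendsto_mult[OF tendsto_const this, of "complex_of_real ((1 / (\<sigma> * sqrt (2 * pi))) ^ Suc m)"]
    have "(\<lambda>n. complex_of_real (smoothed_density M (X n) m \<sigma> y)) \<longlonglongrightarrow> complex_of_real (smoothed_density Q Y m \<sigma> y)"
      unfolding smoothed_density_fourier[OF M X[of _] \<sigma>] smoothed_density_fourier[OF Q Y \<sigma>] .
    from tendsto_Re[OF this] show ?thesis by simp
  qed
  let ?p = "\<lambda>\<sigma> n. smoothed_density M (X n) m \<sigma>" and ?q = "smoothed_density Q Y m"
  have sm: "(\<lambda>n. (\<integral>y. h' y * ?p \<sigma> n y \<partial>?L)) \<longlonglongrightarrow> (\<integral>y. h' y * ?q \<sigma> y \<partial>?L)"
    if \<sigma>: "\<sigma> > 0" for \<sigma>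
  proof -
    have nn: "0 \<le> smoothed_density P Z m \<sigma> y" for P :: "'c measure" and Z y
      unfolding smoothed_density_def by (intro Bochner_Integration.integral_nonneg) (auto simp: prod_nonneg)
    have nn': "0 \<le> smoothed_density P Z m \<sigma> y" for P :: "'d measure" and Z y
      unfolding smoothed_density_def by (intro Bochner_Integration.integral_nonneg) (auto simp: prod_nonneg)
    have one: "integrable ?L (smoothed_density M (X n) m \<sigma>)" "(\<integral>y. ?p \<sigma> n y \<partial>?L) = 1" for n
      using smoothed_density_integral(1,2)[OF M X[of n] \<sigma>, of "\<lambda>_. 1" m 1] normal_density_prod_integral(2)[OF \<sigma>]
      by (auto simp: M.prob_space)
    have one': "integrable ?L (smoothed_density Q Y m \<sigma>)" "(\<integral>y. ?q \<sigma> y \<partial>?L) = 1"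
      using smoothed_density_integral(1,2)[OF Q Y \<sigma>, of "\<lambda>_. 1" m 1] normal_density_prod_integral(2)[OF \<sigma>]
      by (auto simp: Q.prob_space)
    have S: "(\<lambda>n. \<integral>y. \<bar>?p \<sigma> n y - ?q \<sigma> y\<bar> \<partial>?L) \<longlonglongrightarrow> 0"
      by (rule scheffe_L1[where c = 1]) (use one one' dens[OF \<sigma>] nn nn' in auto)
    have "(\<lambda>n. (\<integral>y. h' y * ?p \<sigma> n y \<partial>?L) - (\<integral>y. h' y * ?q \<sigma> y \<partial>?L)) \<longlonglongrightarrow> 0"
    proof (rule Lim_null_comparison)
      show "(\<lambda>n. B * (\<integral>y. \<bar>?p \<sigma> n y - ?q \<sigma> y\<bar> \<partial>?L)) \<longlonglongrightarrow> 0"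
        using tendsto_mult_right_zero[OF S] by blast
      show "\<forall>\<^sub>F n in sequentially. norm ((\<integral>y. h' y * ?p \<sigma> n y \<partial>?L) - (\<integral>y. h' y * ?q \<sigma> y \<partial>?L))
        \<le> B * (\<integral>y. \<bar>?p \<sigma> n y - ?q \<sigma> y\<bar> \<partial>?L)"
      proof (rule always_eventually, rule allI)
        fix n
        note a = smoothed_density_integral(1)[OF M X[of n] \<sigma>, of h' m B] and b = smoothed_density_integral(1)[OF Q Y \<sigma>, of h' m B]
        have "(\<integral>y. h' y * ?p \<sigma> n y \<partial>?L) - (\<integral>y. h' y * ?q \<sigma> y \<partial>?L) =
          (\<integral>y. h' y * ?p \<sigma> n y - h' y * ?q \<sigma> y \<partial>?L)"
          using a b h'B by simp
        also have "norm \<dots> \<le> (\<integral>y. norm (h' y * ?p \<sigma> n y - h' y * ?q \<sigma> y) \<partial>?L)"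
          by (rule integral_norm_bound)
        also have "\<dots> \<le> (\<integral>y. B * \<bar>?p \<sigma> n y - ?q \<sigma> y\<bar> \<partial>?L)"
        proof (rule integral_mono)
          fix y show "norm (h' y * ?p \<sigma> n y - h' y * ?q \<sigma> y)
            \<le> B * \<bar>?p \<sigma> n y - ?q \<sigma> y\<bar>"
            using mult_right_mono[OF h'B[of y] abs_ge_zero] by (simp add: right_diff_distrib[symmetric] abs_mult)
        qed (use a b h'B one one' in auto)
        also have "\<dots> = B * (\<integral>y. \<bar>?p \<sigma> n y - ?q \<sigma> y\<bar> \<partial>?L)" by simp
        finally show "norm ((\<integral>y. h' y * ?p \<sigma> n y \<partial>?L) - (\<integral>y. h' y * ?q \<sigma> y \<partial>?L))
          \<le> B * (\<integral>y. \<bar>?p \<sigma> n y - ?q \<sigma> y\<bar> \<partial>?L)" .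
      qed
    qed
    then show ?thesis by (rule LIM_zero_cancel)
  qed
  show ?thesis
  proof (rule LIMSEQ_I)
    fix r :: real assume r: "r > 0"
    define C where "C = L * (real (Suc m) * sqrt (2 / pi))"
    have C: "C \<ge> 0" using L by (simp add: C_def)
    \<comment> \<open>Each of the two smoothing errors becomes at most r/4, which leaves r/2 for the
      convergence of the smoothed integrals; the summand 1 avoids a division by 0.\<close>
    define \<sigma> where "\<sigma> = r / (4 * (C + 1))"
    have \<sigma>: "\<sigma> > 0" using r C by (simp add: \<sigma>_def)
    have "C * \<sigma> \<le> r / 4" using r C by (simp add: \<sigma>_def field_simps)
    then have e: "L * (real (Suc m) * (\<sigma> * sqrt (2 / pi))) \<le> r / 4" by (simp add: C_def algebra_simps)
    from LIMSEQ_D[OF sm[OF \<sigma>], of "r / 2"] r obtain N where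
      N: "\<And>n. n \<ge> N \<Longrightarrow> \<bar>(\<integral>y. h' y * smoothed_density M (X n) m \<sigma> y \<partial>?L) - (\<integral>y. h' y * smoothed_density Q Y m \<sigma> y \<partial>?L)\<bar> < r / 2"
      by auto
    have "norm ((\<integral>\<omega>. h (\<lambda>j. X n j \<omega>) \<partial>M) - (\<integral>\<omega>. h (\<lambda>j. Y j \<omega>) \<partial>Q)) < r" if "n \<ge> N" for n
      using N[OF that] close[of \<sigma> M "X n", OF \<sigma> M X] close[of \<sigma> Q Y, OF \<sigma> Q Y] e unfolding real_norm_def by linarith
    then show "\<exists>no. \<forall>n\<ge>no. norm ((\<integral>\<omega>. h (\<lambda>j. X n j \<omega>) \<partial>M) - (\<integral>\<omega>. h (\<lambda>j. Y j \<omega>) \<partial>Q)) < r" by blast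
  qed
qed

section \<open>Weak convergence to a continuous limit\<close>

text \<open>\<open>skor_dist\<close> only looks at [0, T], so such paths are at distance at most 0
  and continuity leaves no room between the values.\<close>

lemma skor_continuous_cong:
  assumes "T \<ge> 0" "skor_continuous T f" "x \<in> skor_D T" "y \<in> skor_D T" "\<And>t. t \<in> {0..T} \<Longrightarrow> x t = y t"
  shows "f x = f y"
proof (rule ccontr)
  assume "f x \<noteq> f y"
  then have "\<bar>f y - f x\<bar> > 0" by simp
  with assms obtain d where d: "d > 0" "\<And>y'. y' \<in> skor_D T \<Longrightarrow> skor_dist T x y' < d \<Longrightarrow> \<bar>f y' - f x\<bar> < \<bar>f y - f x\<bar>"
    unfolding skor_continuous_def by metis
  have "skor_dist T x y \<le> 0" using assms by (intro skor_dist_le_uniform) auto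
  with d assms(4) show False by fastforce
qed

text \<open>The Skorokhod distance is at most the uniform one, so a Skorokhod ball on which
  \<open>f\<close> varies little contains a uniform ball, and a large enough \<open>k\<close> rules
  out all competitors outside it.\<close>

lemma inf_conv_tendsto:
  assumes T: "T \<ge> 0" and f: "skor_continuous T f" and B: "\<And>x. x \<in> skor_D T \<Longrightarrow> \<bar>f x\<bar> \<le> B" and x: "x \<in> skor_D T"
  shows "(\<lambda>k. inf_conv T (real k) f x) \<longlonglongrightarrow> f x"
proof (rule LIMSEQ_I)
  fix r :: real assume r: "r > 0"
  then have "r / 2 > 0" by simp
  with f x obtain d where d: "d > 0" "\<And>y. y \<in> skor_D T \<Longrightarrow> skor_dist T x y < d \<Longrightarrow> \<bar>f y - f x\<bar> < r / 2"
    unfolding skor_continuous_def by blast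
  obtain K :: nat where K: "2 * B / d < K" using reals_Archimedean2 by blast
  have lb: "- B \<le> f y" if "y \<in> skor_D T" for y using B[OF that] by linarith
  have "norm (inf_conv T (real k) f x - f x) < r" if k: "k \<ge> K" for k
  proof -
    have "2 * B / d \<le> k" using K k by linarith
    then have kd: "2 * B \<le> k * d" using d(1) by (simp add: field_simps)
    have "f x - r / 2 \<le> inf_conv T (real k) f x"
    proof (rule inf_conv_lower[OF T _ x B d(1) kd])
      fix y assume y: "y \<in> skor_D T" "unif_dist T x y < d"
      then have "skor_dist T x y < d" using skor_dist_le_unif_dist[OF T x y(1)] by linarith
      from d(2)[OF y(1) this] show "f x - r / 2 \<le> f y" unfolding abs_less_iff by linarith
    qed (use r in auto)
    moreover have "inf_conv T (real k) f x \<le> f x" using T x lb by (intro inf_conv_le[where B = B]) auto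
    ultimately show ?thesis using r unfolding real_norm_def abs_less_iff by linarith
  qed
  then show "\<exists>no. \<forall>k\<ge>no. norm (inf_conv T (real k) f x - f x) < r" by blast
qed

text \<open>In \<open>tight\<close> the mesh is chosen first and the threshold for \<open>n\<close>
  may depend on it; a failure probability of the form C/m + D m/n allows no more. Joint convergence
  is expressed by characteristic functions of linear combinations.\<close>

locale skor_approx =
  fixes T :: real and M :: "'a measure" and Q :: "'b measure" and g :: "real \<Rightarrow> real"
    and V :: "nat \<Rightarrow> real \<Rightarrow> 'a \<Rightarrow> real" and W :: "real \<Rightarrow> 'b \<Rightarrow> real"
  assumes T: "T > 0" and M: "prob_space M" and Q: "prob_space Q"
    and g: "continuous_on {0..T} g"
    and V_meas: "\<And>n t. t \<in> {0..T} \<Longrightarrow> V n t \<in> borel_measurable M"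
    and V_path: "\<And>n \<omega>. \<omega> \<in> space M \<Longrightarrow> (\<lambda>t. V n t \<omega>) \<in> skor_D T"
    and W_meas: "\<And>t. t \<in> {0..T} \<Longrightarrow> W t \<in> borel_measurable Q"
    and W_path: "\<And>\<omega>. \<omega> \<in> space Q \<Longrightarrow> continuous_on {0..T} (\<lambda>t. W t \<omega>)"
    and fdd: "\<And>m tt c. (\<And>j. j \<le> m \<Longrightarrow> tt j \<in> {0..T}) \<Longrightarrow>
      (\<lambda>n. CLINT \<omega>|M. iexp (\<Sum>j\<le>m. c j * V n (tt j) \<omega>)) \<longlonglongrightarrow> (CLINT \<omega>|Q. iexp (\<Sum>j\<le>(m::nat). c j * W (tt j) \<omega>))"
    and tight: "\<And>\<delta> \<eta>. \<delta> > 0 \<Longrightarrow> \<eta> > 0 \<Longrightarrow> \<exists>m0. \<forall>m\<ge>m0. \<exists>N0. \<forall>n\<ge>N0. \<exists>A\<in>sets M. measure M A \<le> \<eta> \<and>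
      (\<forall>\<omega>\<in>space M - A. \<forall>t\<in>{0..T}. \<bar>V n t \<omega> - V n (grid T m (nat \<lfloor>real m / T * t\<rfloor>)) \<omega>\<bar> \<le> \<delta>)"
begin

abbreviation gV :: "nat \<Rightarrow> 'a \<Rightarrow> real \<Rightarrow> real" where "gV n \<omega> \<equiv> \<lambda>t. g t * V n t \<omega>"

abbreviation gW :: "'b \<Rightarrow> real \<Rightarrow> real" where "gW \<omega> \<equiv> \<lambda>t. g t * W t \<omega>"

lemma gV_path: "\<omega> \<in> space M \<Longrightarrow> gV n \<omega> \<in> skor_D T"
  using V_path cadlag_on_mult[OF cadlag_on_continuous[OF g]] by (simp add: skor_D_def)

lemma gW_path: "\<omega> \<in> space Q \<Longrightarrow> gW \<omega> \<in> skor_D T"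
  using cadlag_on_mult[OF cadlag_on_continuous[OF g] cadlag_on_continuous[OF W_path]] by (simp add: skor_D_def)

lemma g_bounded: obtains G where "G \<ge> 0" "\<And>t. t \<in> {0..T} \<Longrightarrow> \<bar>g t\<bar> \<le> G"
proof -
  obtain G where G: "\<forall>t\<in>{0..T}. \<bar>g t\<bar> \<le> G" using cadlag_on_bounded[OF cadlag_on_continuous[OF g]] by blast
  then have "\<bar>g 0\<bar> \<le> G" using T by auto
  then have "G \<ge> 0" by linarith
  with G that show ?thesis by blast
qed

text \<open>On the side of \<open>V\<close> the replacement of \<open>f\<close> by its minorant
  costs nothing in this direction. Only on the side of the limit must the minorants approach
  \<open>f\<close>, and there bounded convergence suffices.\<close>

lemma lower_bound:
  assumes f: "skor_continuous T f" and B: "\<And>x. x \<in> skor_D T \<Longrightarrow> \<bar>f x\<bar> \<le> B" and e: "\<epsilon> > 0"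
  shows "\<exists>N. \<forall>n\<ge>N. (\<integral>\<omega>. f (gW \<omega>) \<partial>Q) - \<epsilon> \<le> (\<integral>\<omega>. f (gV n \<omega>) \<partial>M)"
proof -
  interpret M: prob_space M by (rule M)
  interpret Q: prob_space Q by (rule Q)
  obtain G where G: "G \<ge> 0" "\<And>t. t \<in> {0..T} \<Longrightarrow> \<bar>g t\<bar> \<le> G" using g_bounded by blast
  have T0: "T \<ge> 0" using T by simp
  have B0: "B \<ge> 0" using B[OF zero_in_skor_D] by linarith
  have lb: "- B \<le> f y" if "y \<in> skor_D T" for y using B[OF that] by linarith
  define F where "F k = inf_conv T (real k) f" for k :: nat
  have lip: "unif_lipschitz T (real k) (F k)" for k
    unfolding F_def using T0 lb by (intro unif_lipschitz_inf_conv[where B = B]) auto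
  have Fle: "F k x \<le> f x" if "x \<in> skor_D T" for k x
    unfolding F_def using T0 that lb by (intro inf_conv_le[where B = B]) auto
  have FB: "\<bar>F k x\<bar> \<le> B" if "x \<in> skor_D T" for k x
  proof -
    have "- B \<le> F k x" unfolding F_def using T0 that lb by (intro inf_conv_ge[where B = B]) auto
    with Fle[OF that, of k] B[OF that] show ?thesis by linarith
  qed
  have st: "(\<lambda>t. g t * step_path T m z t) \<in> skor_D T" for m z by (rule weighted_step_path_in_skor_D[OF T g])
  define AV where "AV k m n \<omega> = F k (\<lambda>t. g t * step_path T m (\<lambda>j. V n (grid T m j) \<omega>) t)" for k m n \<omega>
  define AW where "AW k m \<omega> = F k (\<lambda>t. g t * step_path T m (\<lambda>j. W (grid T m j) \<omega>) t)" for k m \<omega>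
  have AV_meas[measurable]: "AV k m n \<in> borel_measurable M" for k m n
    unfolding AV_def[abs_def] by (rule borel_measurable_unif_lipschitz_step_path[OF T g G(2) lip _ V_meas]) auto
  have AW_meas[measurable]: "AW k m \<in> borel_measurable Q" for k m
    unfolding AW_def[abs_def] by (rule borel_measurable_unif_lipschitz_step_path[OF T g G(2) lip _ W_meas]) auto
  have AV_B: "\<bar>AV k m n \<omega>\<bar> \<le> B" for k m n \<omega> unfolding AV_def by (rule FB[OF st])
  have AW_B: "\<bar>AW k m \<omega>\<bar> \<le> B" for k m \<omega> unfolding AW_def by (rule FB[OF st])
  have AW_lim: "(\<lambda>m. AW k m \<omega>) \<longlonglongrightarrow> F k (gW \<omega>)" if "\<omega> \<in> space Q" for k \<omega>
    unfolding AW_def by (rule unif_lipschitz_step_path_tendsto[OF T g G(2) lip _ W_path[OF that]]) auto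
  have FW_meas[measurable]: "(\<lambda>\<omega>. F k (gW \<omega>)) \<in> borel_measurable Q" for k
    by (rule borel_measurable_LIMSEQ_real[OF AW_lim]) auto
  have "(\<lambda>k. \<integral>\<omega>. F k (gW \<omega>) \<partial>Q) \<longlonglongrightarrow> (\<integral>\<omega>. f (gW \<omega>) \<partial>Q)"
  proof (rule integral_dominated_convergence[where w = "\<lambda>_. B"])
    show "(\<lambda>\<omega>. f (gW \<omega>)) \<in> borel_measurable Q"
      by (rule borel_measurable_skor_continuous[OF T gW_path _ f])
         (auto intro!: borel_measurable_times W_meas)
    show "AE \<omega> in Q. (\<lambda>k. F k (gW \<omega>)) \<longlonglongrightarrow> f (gW \<omega>)"
      unfolding F_def by (intro AE_I2 inf_conv_tendsto[OF T0 f B gW_path])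
  qed (use FB gW_path in auto)
  from LIMSEQ_D[OF this, of "\<epsilon> / 5"] e obtain k where
    "\<bar>(\<integral>\<omega>. F k (gW \<omega>) \<partial>Q) - (\<integral>\<omega>. f (gW \<omega>) \<partial>Q)\<bar> < \<epsilon> / 5" by auto
  then have k: "(\<integral>\<omega>. f (gW \<omega>) \<partial>Q) - \<epsilon> / 5 \<le> (\<integral>\<omega>. F k (gW \<omega>) \<partial>Q)" by linarith
  \<comment> \<open>The error is split into five parts of size \<epsilon>/5: minorant against
    \<open>f\<close>, grid against limit path, finite-dimensional convergence, oscillation on the
    good event (\<open>\<delta>\<close>), and the exceptional event (\<open>\<eta>\<close>).\<close>
  define \<delta> where "\<delta> = \<epsilon> / (5 * (real k * G + 1))"
  define \<eta> where "\<eta> = \<epsilon> / (10 * (B + 1))"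
  have kG: "real k * G \<ge> 0" using G(1) by simp
  have \<delta>: "\<delta> > 0" "real k * (G * \<delta>) \<le> \<epsilon> / 5"
  proof -
    have pos: "5 * (real k * G + 1) > 0" using kG by simp
    then show "\<delta> > 0" unfolding \<delta>_def using e by simp
    have "(real k * G) * \<delta> \<le> (real k * G + 1) * \<delta>" using \<open>\<delta> > 0\<close> by (intro mult_right_mono) auto
    also have "(real k * G + 1) * \<delta> = \<epsilon> / 5" unfolding \<delta>_def using kG by (simp add: field_simps)
    finally show "real k * (G * \<delta>) \<le> \<epsilon> / 5" by (simp add: mult.assoc)
  qed
  have \<eta>: "\<eta> > 0" "2 * B * \<eta> \<le> \<epsilon> / 5"
    using e B0 by (auto simp: \<eta>_def field_simps)
  from tight[OF \<delta>(1) \<eta>(1)] obtain m0 where m0: "\<And>m. m \<ge> m0 \<Longrightarrow> \<exists>N0. \<forall>n\<ge>N0. \<exists>A\<in>sets M. measure M A \<le> \<eta> \<and>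
      (\<forall>\<omega>\<in>space M - A. \<forall>t\<in>{0..T}. \<bar>V n t \<omega> - V n (grid T m (nat \<lfloor>real m / T * t\<rfloor>)) \<omega>\<bar> \<le> \<delta>)" by blast
  have "(\<lambda>m. \<integral>\<omega>. AW k m \<omega> \<partial>Q) \<longlonglongrightarrow> (\<integral>\<omega>. F k (gW \<omega>) \<partial>Q)"
    by (rule integral_dominated_convergence[where w = "\<lambda>_. B"]) (use AW_lim AW_B in auto)
  from LIMSEQ_D[OF this, of "\<epsilon> / 5"] e obtain m1 where
    "\<And>m. m \<ge> m1 \<Longrightarrow> \<bar>(\<integral>\<omega>. AW k m \<omega> \<partial>Q) - (\<integral>\<omega>. F k (gW \<omega>) \<partial>Q)\<bar> < \<epsilon> / 5" by auto
  moreover define m where "m = max m0 m1"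
  ultimately have "\<bar>(\<integral>\<omega>. AW k m \<omega> \<partial>Q) - (\<integral>\<omega>. F k (gW \<omega>) \<partial>Q)\<bar> < \<epsilon> / 5" by simp
  then have m: "(\<integral>\<omega>. F k (gW \<omega>) \<partial>Q) - \<epsilon> / 5 \<le> (\<integral>\<omega>. AW k m \<omega> \<partial>Q)" by linarith
  have "m \<ge> m0" by (simp add: m_def)
  from m0[OF this] obtain N0 where N0: "\<And>n. n \<ge> N0 \<Longrightarrow> \<exists>A\<in>sets M. measure M A \<le> \<eta> \<and>
      (\<forall>\<omega>\<in>space M - A. \<forall>t\<in>{0..T}. \<bar>V n t \<omega> - V n (grid T m (nat \<lfloor>real m / T * t\<rfloor>)) \<omega>\<bar> \<le> \<delta>)" by blast
  have "(\<lambda>n. \<integral>\<omega>. AV k m n \<omega> \<partial>M) \<longlonglongrightarrow> (\<integral>\<omega>. AW k m \<omega> \<partial>Q)"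
  proof -
    define h where "h z = F k (\<lambda>t. g t * step_path T m z t)" for z
    have hl: "\<bar>h z - h z'\<bar> \<le> real k * G * d" if "\<And>j. j \<le> m \<Longrightarrow> \<bar>z j - z' j\<bar> \<le> d" for z z' d
      unfolding h_def by (rule unif_lipschitz_step_path[OF T g G(2) lip _ that]) auto
    \<comment> \<open>The characteristic function criterion wants measurable variables for every
      index, so indices are clamped at \<open>m\<close>; a step path on [0, T] never reads beyond
      it.\<close>
    have gm: "grid T m (min j m) \<in> {0..T}" for j by (rule grid_mem[OF T]) simp
    have "(\<lambda>n. \<integral>\<omega>. h (\<lambda>j. V n (grid T m (min j m)) \<omega>) \<partial>M) \<longlonglongrightarrow> (\<integral>\<omega>. h (\<lambda>j. W (grid T m (min j m)) \<omega>) \<partial>Q)"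
    proof (rule char_conv_imp_lipschitz_conv[OF M Q, where m = m and B = B and L = "real k * G" and h = h
          and X = "\<lambda>n j. V n (grid T m (min j m))" and Y = "\<lambda>j. W (grid T m (min j m))"])
      show "(\<lambda>n. CLINT \<omega>|M. iexp (\<Sum>j\<le>m. c j * V n (grid T m (min j m)) \<omega>)) \<longlonglongrightarrow> (CLINT \<omega>|Q. iexp (\<Sum>j\<le>m. c j * W (grid T m (min j m)) \<omega>))" for c
        by (rule fdd[OF gm])
      show "\<bar>h z\<bar> \<le> B" for z unfolding h_def by (rule FB[OF st])
    qed (use V_meas[OF gm] W_meas[OF gm] kG hl in auto)
    moreover have "h (\<lambda>j. z (min j m)) = h z" for z
      using hl[of "\<lambda>j. z (min j m)" z 0] by simp
    note this[of "\<lambda>j. V _ (grid T m j) _"] this[of "\<lambda>j. W (grid T m j) _"]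
    ultimately show ?thesis by (simp add: AV_def[abs_def] AW_def[abs_def] h_def)
  qed
  from LIMSEQ_D[OF this, of "\<epsilon> / 5"] e obtain N1 where
    N1: "\<And>n. n \<ge> N1 \<Longrightarrow> \<bar>(\<integral>\<omega>. AV k m n \<omega> \<partial>M) - (\<integral>\<omega>. AW k m \<omega> \<partial>Q)\<bar> < \<epsilon> / 5" by auto
  have "(\<integral>\<omega>. f (gW \<omega>) \<partial>Q) - \<epsilon> \<le> (\<integral>\<omega>. f (gV n \<omega>) \<partial>M)" if n: "n \<ge> max N0 N1" for n
  proof -
    from N0[of n] n obtain A where A: "A \<in> sets M" "measure M A \<le> \<eta>"
      "\<And>\<omega> t. \<omega> \<in> space M - A \<Longrightarrow> t \<in> {0..T} \<Longrightarrow> \<bar>V n t \<omega> - V n (grid T m (nat \<lfloor>real m / T * t\<rfloor>)) \<omega>\<bar> \<le> \<delta>" by auto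
    have pt: "AV k m n \<omega> - \<epsilon> / 5 - 2 * B * indicat_real A \<omega> \<le> f (gV n \<omega>)" if w: "\<omega> \<in> space M" for \<omega>
    proof (cases "\<omega> \<in> A")
      case True
      with AV_B[of k m n \<omega>] lb[OF gV_path[OF w, of n]] e show ?thesis by auto
    next
      case False
      have "\<bar>g t * V n t \<omega> - g t * step_path T m (\<lambda>j. V n (grid T m j) \<omega>) t\<bar> \<le> G * \<delta>" if t: "t \<in> {0..T}" for t
      proof -
        have "\<bar>g t * V n t \<omega> - g t * step_path T m (\<lambda>j. V n (grid T m j) \<omega>) t\<bar> =
          \<bar>g t\<bar> * \<bar>V n t \<omega> - V n (grid T m (nat \<lfloor>real m / T * t\<rfloor>)) \<omega>\<bar>"
          by (simp add: abs_mult[symmetric] right_diff_distrib step_path_def)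
        also have "\<dots> \<le> G * \<delta>" using G(2)[OF t] A(3)[of \<omega> t] w False t G(1) by (intro mult_mono) auto
        finally show ?thesis .
      qed
      then have "\<bar>F k (gV n \<omega>) - AV k m n \<omega>\<bar> \<le> real k * (G * \<delta>)"
        unfolding AV_def by (intro unif_lipschitzD[OF lip gV_path[OF w] st])
      with \<delta>(2) Fle[OF gV_path[OF w, of n], of k] False show ?thesis by simp
    qed
    have int_f: "integrable M (\<lambda>\<omega>. f (gV n \<omega>))"
    proof (rule M.integrable_const_bound[where B = B])
      show "(\<lambda>\<omega>. f (gV n \<omega>)) \<in> borel_measurable M"
        by (rule borel_measurable_skor_continuous[OF T gV_path _ f]) (auto intro!: borel_measurable_times V_meas)
    qed (use B gV_path in auto)
    have int_A: "integrable M (AV k m n)" by (rule M.integrable_const_bound[where B = B]) (use AV_B in auto)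
    have "(\<integral>\<omega>. AV k m n \<omega> - \<epsilon> / 5 - 2 * B * indicat_real A \<omega> \<partial>M) \<le> (\<integral>\<omega>. f (gV n \<omega>) \<partial>M)"
      using int_A int_f A(1) pt by (intro integral_mono) (auto simp: M.emeasure_eq_measure)
    moreover have "(\<integral>\<omega>. AV k m n \<omega> - \<epsilon> / 5 - 2 * B * indicat_real A \<omega> \<partial>M) = (\<integral>\<omega>. AV k m n \<omega> \<partial>M) - \<epsilon> / 5 - 2 * B * measure M A"
      using int_A A(1) by (simp add: M.prob_space M.emeasure_eq_measure)
    moreover have "2 * B * measure M A \<le> 2 * B * \<eta>" using A(2) B0 by (intro mult_left_mono) auto
    moreover have "\<bar>(\<integral>\<omega>. AV k m n \<omega> \<partial>M) - (\<integral>\<omega>. AW k m \<omega> \<partial>Q)\<bar> < \<epsilon> / 5" using N1 n by simp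
    ultimately show ?thesis using k m \<eta>(2) by linarith
  qed
  then show ?thesis by blast
qed

text \<open>The lower bound applied to \<open>f\<close> and to \<open>- f\<close>.\<close>

lemma skor_weak_limit:
  assumes f: "skor_continuous T f" and B: "\<And>x. x \<in> skor_D T \<Longrightarrow> \<bar>f x\<bar> \<le> B"
  shows "(\<lambda>n. \<integral>\<omega>. f (gV n \<omega>) \<partial>M) \<longlonglongrightarrow> (\<integral>\<omega>. f (gW \<omega>) \<partial>Q)"
proof (rule LIMSEQ_I)
  fix r :: real assume r: "r > 0"
  then have r2: "r / 2 > 0" by simp
  have f': "skor_continuous T (\<lambda>x. - f x)"
    using f unfolding skor_continuous_def by (simp add: abs_minus_commute)
  from lower_bound[OF f B r2] obtain N1 where N1: "\<And>n. n \<ge> N1 \<Longrightarrow>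
    (\<integral>\<omega>. f (gW \<omega>) \<partial>Q) - r / 2 \<le> (\<integral>\<omega>. f (gV n \<omega>) \<partial>M)" by blast
  have "\<exists>N. \<forall>n\<ge>N. (\<integral>\<omega>. - f (gW \<omega>) \<partial>Q) - r / 2 \<le> (\<integral>\<omega>. - f (gV n \<omega>) \<partial>M)"
    by (rule lower_bound[OF f' _ r2, of B]) (use B in simp)
  then obtain N2 where N2: "\<And>n. n \<ge> N2 \<Longrightarrow>
    - (\<integral>\<omega>. f (gW \<omega>) \<partial>Q) - r / 2 \<le> - (\<integral>\<omega>. f (gV n \<omega>) \<partial>M)" by auto
  have "norm ((\<integral>\<omega>. f (gV n \<omega>) \<partial>M) - (\<integral>\<omega>. f (gW \<omega>) \<partial>Q)) < r" if "n \<ge> max N1 N2" for n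
    using N1[of n] N2[of n] that r unfolding real_norm_def abs_less_iff by simp
  then show "\<exists>no. \<forall>n\<ge>no. norm ((\<integral>\<omega>. f (gV n \<omega>) \<partial>M) - (\<integral>\<omega>. f (gW \<omega>) \<partial>Q)) < r" by blast
qed

end

section \<open>Brownian motion on the unit interval\<close>

text \<open>The tent of height 1 over [0, 1] with peak at 1/2, a primitive of the Haar wavelet up to
  scaling.\<close>

definition hat :: "real \<Rightarrow> real" where
  "hat u = max 0 (1 - \<bar>2 * u - 1\<bar>)"

text \<open>The covariance of the Brownian bridge, extended by 0 so that its recursion holds for all
  real arguments.\<close>

definition bridge_cov :: "real \<Rightarrow> real \<Rightarrow> real" where
  "bridge_cov u v = (if u \<in> {0..1} \<and> v \<in> {0..1} then min u v - u * v else 0)"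

text \<open>Level \<open>0\<close> is the linear function; the coefficients \<open>2^(-l/2) / 2\<close> at level \<open>l + 1\<close> are those
  of the Levy-Ciesielski expansion.\<close>

fun schauder :: "nat \<Rightarrow> nat \<Rightarrow> real \<Rightarrow> real" where
  "schauder 0 k t = t"
| "schauder (Suc l) k t = (1 / sqrt 2) ^ l / 2 * hat (2 ^ l * t - real k)"

text \<open>The truncated exponent \<open>l - 1\<close> yields a single function at level 0, as at
  level 1.\<close>

definition schauder_level :: "nat \<Rightarrow> (nat \<times> nat \<Rightarrow> real) \<Rightarrow> real \<Rightarrow> real" where
  "schauder_level l z t = (\<Sum>k<2 ^ (l - 1). schauder l k t * z (l, k))"

text \<open>The threshold 2^(l/4) is a compromise: together with coefficients of order 2^(-l/2) it
  leaves the summable bound 2^(-l/4), and yet Gaussian variables exceed it only finitely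
  often.\<close>

definition tame :: "(nat \<times> nat \<Rightarrow> real) \<Rightarrow> bool" where
  "tame z \<longleftrightarrow> (\<exists>L. \<forall>l\<ge>L. \<forall>k<2 ^ (l - 1). \<bar>z (l, k)\<bar> \<le> sqrt (sqrt 2) ^ l)"

text \<open>The default 0 off the tame set makes every path continuous, not just almost every
  one.\<close>

definition brownian :: "(nat \<times> nat \<Rightarrow> real) \<Rightarrow> real \<Rightarrow> real" where
  "brownian z t = (if tame z then (\<Sum>l. schauder_level l z t) else 0)"

abbreviation white_noise :: "(nat \<times> nat \<Rightarrow> real) measure" where
  "white_noise \<equiv> PiM UNIV (\<lambda>_. std_normal_distribution)"

lemma prob_space_white_noise: "prob_space white_noise"
  by (intro prob_space_PiM) (use prob_space_normal_density in auto)

text \<open>Self-similarity of the bridge: it is its midpoint value, of variance 1/4, times the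
  tent, plus independent bridges on the two halves with variances scaled by 1/2. Arguments in
  different halves see the tent alone.\<close>

lemma bridge_cov_rec:
  "bridge_cov u v = hat u * hat v / 4 + (bridge_cov (2 * u) (2 * v) + bridge_cov (2 * u - 1) (2 * v - 1)) / 2"
proof -
  consider "u < 0 \<or> u > 1 \<or> v < 0 \<or> v > 1" | "0 \<le> u" "u \<le> 1" "0 \<le> v" "v \<le> 1" by linarith
  then show ?thesis
  proof cases
    case 1
    have out: "hat x = 0" if "x < 0 \<or> x > 1" for x using that by (auto simp: hat_def)
    have "hat u * hat v = 0" using 1 out by auto
    moreover have "bridge_cov u v = 0" "bridge_cov (2 * u) (2 * v) = 0" "bridge_cov (2 * u - 1) (2 * v - 1) = 0"
      using 1 unfolding bridge_cov_def by auto
    ultimately show ?thesis by simp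
  next
    case 2
    have hl: "hat x = 2 * x" if "0 \<le> x" "x \<le> 1/2" for x using that by (simp add: hat_def)
    have hr: "hat x = 2 - 2 * x" if "1/2 \<le> x" "x \<le> 1" for x using that by (simp add: hat_def)
    consider "u \<le> 1/2" "v \<le> 1/2" | "u \<le> 1/2" "1/2 < v" | "1/2 < u" "v \<le> 1/2" | "1/2 < u" "1/2 < v" by linarith
    then show ?thesis
    proof cases
      case 1
      have "bridge_cov (2 * u - 1) (2 * v - 1) = 0" using 1 2 by (auto simp: bridge_cov_def)
      then show ?thesis using 1 2 hl by (auto simp: bridge_cov_def min_def field_simps)
    next
      case 2
      have "bridge_cov (2 * u) (2 * v) = 0" "bridge_cov (2 * u - 1) (2 * v - 1) = 0"
        using 2 \<open>u \<le> 1\<close> \<open>0 \<le> u\<close> \<open>v \<le> 1\<close> by (auto simp: bridge_cov_def)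
      moreover have "bridge_cov u v = u - u * v" using 2 \<open>0 \<le> u\<close> \<open>v \<le> 1\<close> by (simp add: bridge_cov_def)
      moreover have "hat u = 2 * u" "hat v = 2 - 2 * v" using 2 \<open>0 \<le> u\<close> \<open>v \<le> 1\<close> by (auto intro: hl hr)
      ultimately show ?thesis by (simp only:) (simp add: algebra_simps)
    next
      case 3
      have "bridge_cov (2 * u) (2 * v) = 0" "bridge_cov (2 * u - 1) (2 * v - 1) = 0"
        using 3 \<open>u \<le> 1\<close> \<open>0 \<le> v\<close> \<open>v \<le> 1\<close> by (auto simp: bridge_cov_def)
      moreover have "bridge_cov u v = v - u * v" using 3 \<open>0 \<le> v\<close> \<open>u \<le> 1\<close> by (simp add: bridge_cov_def)
      moreover have "hat v = 2 * v" "hat u = 2 - 2 * u" using 3 \<open>0 \<le> v\<close> \<open>u \<le> 1\<close> by (auto intro: hl hr)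
      ultimately show ?thesis by (simp only:) (simp add: algebra_simps)
    next
      case 4
      have "bridge_cov (2 * u) (2 * v) = 0" using 4 by (auto simp: bridge_cov_def)
      moreover have "bridge_cov u v = min u v - u * v" "bridge_cov (2 * u - 1) (2 * v - 1) = min (2 * u - 1) (2 * v - 1) - (2 * u - 1) * (2 * v - 1)"
        using 4 2 by (auto simp: bridge_cov_def)
      moreover have "hat u = 2 - 2 * u" "hat v = 2 - 2 * v" using 4 2 by (auto intro: hr)
      ultimately show ?thesis by (simp only: min_def) (simp add: algebra_simps add_divide_distrib diff_divide_distrib)
    qed
  qed
qed

text \<open>The integer translates of [0, 1) are disjoint, so at most one summand can be
  positive.\<close>

lemma sum_le_one_if_floor:
  fixes f :: "real \<Rightarrow> real"
  assumes f: "\<And>u. f u \<le> (if \<lfloor>u\<rfloor> = 0 then 1 else 0)"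
  shows "(\<Sum>k<n. f (x - real k)) \<le> 1"
proof -
  have "(\<Sum>k<n. f (x - real k)) \<le> (\<Sum>k<n. if k = nat \<lfloor>x\<rfloor> then 1 else 0)"
  proof (rule sum_mono)
    fix k :: nat
    have "\<lfloor>x - real k\<rfloor> = \<lfloor>x\<rfloor> - int k" by linarith
    then show "f (x - real k) \<le> (if k = nat \<lfloor>x\<rfloor> then 1 else 0)"
      using f[of "x - real k"] by (auto split: if_splits)
  qed
  also have "\<dots> \<le> 1" by simp
  finally show ?thesis .
qed

lemma floor_eq_0_iff': "\<lfloor>u::real\<rfloor> = 0 \<longleftrightarrow> 0 \<le> u \<and> u < 1" by linarith

lemma hat_nonneg: "0 \<le> hat u" by (simp add: hat_def)

lemma hat_sum_le: "(\<Sum>k<n. hat (x - real k)) \<le> 1"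
  by (rule sum_le_one_if_floor) (auto simp: hat_def floor_eq_0_iff' abs_if)

lemma bridge_cov_bounds: "0 \<le> bridge_cov u v" "bridge_cov u v \<le> (if \<lfloor>u\<rfloor> = 0 then 1 else 0)"
proof -
  have "min u v - u * v = min (u * (1 - v)) (v * (1 - u))" if "0 \<le> u" "0 \<le> v"
    by (simp add: min_def algebra_simps)
  moreover have "0 \<le> min (u * (1 - v)) (v * (1 - u))" if "u \<in> {0..1}" "v \<in> {0..1}" using that by simp
  ultimately show "0 \<le> bridge_cov u v" by (auto simp: bridge_cov_def)
  have "min u v - u * v \<le> 1" if "u \<in> {0..1}" "v \<in> {0..1}"
  proof -
    have "0 \<le> u * v" "min u v \<le> 1" using that by auto
    then show ?thesis by linarith
  qed
  then show "bridge_cov u v \<le> (if \<lfloor>u\<rfloor> = 0 then 1 else 0)"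
    by (auto simp: bridge_cov_def floor_eq_0_iff' min_def not_less)
qed

lemma sum_lessThan_double: "(\<Sum>k<2 * (m::nat). f k) = (\<Sum>k<m. f (2 * k) + f (2 * k + 1) :: real)"
  by (induction m) (simp_all add: algebra_simps)

text \<open>Iterating the self-similarity: the dyadic cell k has the children 2 k and 2 k +
  1.\<close>

lemma bridge_cov_expansion:
  "bridge_cov s t = (\<Sum>l<n. (1 / 2) ^ l / 4 * (\<Sum>k<2 ^ l. hat (2 ^ l * s - real k) * hat (2 ^ l * t - real k)))
     + (1 / 2) ^ n * (\<Sum>k<2 ^ n. bridge_cov (2 ^ n * s - real k) (2 ^ n * t - real k))"
proof (induction n)
  case (Suc n)
  have "(1 / 2) ^ n * (\<Sum>k<2 ^ n. bridge_cov (2 ^ n * s - real k) (2 ^ n * t - real k)) =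
    (1 / 2) ^ n * (\<Sum>k<2 ^ n. hat (2 ^ n * s - real k) * hat (2 ^ n * t - real k) / 4 +
      (bridge_cov (2 ^ Suc n * s - real (2 * k)) (2 ^ Suc n * t - real (2 * k)) +
       bridge_cov (2 ^ Suc n * s - real (2 * k + 1)) (2 ^ Suc n * t - real (2 * k + 1))) / 2)"
    by (intro arg_cong2[where f = "(*)"] refl sum.cong, subst bridge_cov_rec) (simp add: algebra_simps)
  also have "\<dots> = (1 / 2) ^ n / 4 * (\<Sum>k<2 ^ n. hat (2 ^ n * s - real k) * hat (2 ^ n * t - real k)) +
    (1 / 2) ^ Suc n * (\<Sum>k<2 ^ n. bridge_cov (2 ^ Suc n * s - real (2 * k)) (2 ^ Suc n * t - real (2 * k)) +
       bridge_cov (2 ^ Suc n * s - real (2 * k + 1)) (2 ^ Suc n * t - real (2 * k + 1)))"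
    by (simp add: sum.distrib sum_divide_distrib[symmetric] distrib_left)
  also have "(\<Sum>k<2 ^ n. bridge_cov (2 ^ Suc n * s - real (2 * k)) (2 ^ Suc n * t - real (2 * k)) +
       bridge_cov (2 ^ Suc n * s - real (2 * k + 1)) (2 ^ Suc n * t - real (2 * k + 1))) =
       (\<Sum>k<2 ^ Suc n. bridge_cov (2 ^ Suc n * s - real k) (2 ^ Suc n * t - real k))"
    unfolding power_Suc[of "2::nat"] by (rule sum_lessThan_double[symmetric])
  finally show ?case using Suc.IH by simp
qed (simp add: bridge_cov_def)

text \<open>The remainder after n refinements is at most 2^(-n), because the cells of one level are
  disjoint and the bridge covariance is bounded by 1.\<close>

lemma schauder_kernel:
  assumes "s \<in> {0..1}" "t \<in> {0..1}"
  shows "(\<lambda>n. \<Sum>l<n. \<Sum>k<2 ^ (l - 1). schauder l k s * schauder l k t) \<longlonglongrightarrow> min s t"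
proof -
  have "(\<lambda>n. (1 / 2) ^ n * (\<Sum>k<2 ^ n. bridge_cov (2 ^ n * s - real k) (2 ^ n * t - real k))) \<longlonglongrightarrow> 0"
  proof (rule Lim_null_comparison)
    show "(\<lambda>n. (1 / 2 :: real) ^ n) \<longlonglongrightarrow> 0" by (intro LIMSEQ_power_zero) simp
    have le: "(\<Sum>k<m. bridge_cov (x - real k) (y - real k)) \<le> 1" for m x y
    proof -
      have "(\<Sum>k<m. bridge_cov (x - real k) (y - real k)) \<le> (\<Sum>k<m. (if \<lfloor>x - real k\<rfloor> = 0 then 1 else 0))"
        by (intro sum_mono bridge_cov_bounds)
      also have "\<dots> \<le> 1" by (rule sum_le_one_if_floor) auto
      finally show ?thesis .
    qed
    show "\<forall>\<^sub>F n in sequentially. norm ((1 / 2) ^ n * (\<Sum>k<2 ^ n. bridge_cov (2 ^ n * s - real k) (2 ^ n * t - real k))) \<le> (1 / 2) ^ n"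
      using le bridge_cov_bounds(1) by (auto simp: abs_mult sum_nonneg intro!: always_eventually mult_left_le)
  qed
  from tendsto_diff[OF tendsto_const[of "bridge_cov s t"] this]
  have "(\<lambda>n. (\<Sum>l<n. (1 / 2) ^ l / 4 * (\<Sum>k<2 ^ l. hat (2 ^ l * s - real k) * hat (2 ^ l * t - real k)))) \<longlonglongrightarrow> bridge_cov s t"
  proof -
    have "bridge_cov s t - (1 / 2) ^ n * (\<Sum>k<2 ^ n. bridge_cov (2 ^ n * s - real k) (2 ^ n * t - real k)) =
      (\<Sum>l<n. (1 / 2) ^ l / 4 * (\<Sum>k<2 ^ l. hat (2 ^ l * s - real k) * hat (2 ^ l * t - real k)))" for n
      using bridge_cov_expansion[of s t n] by linarith
    then show ?thesis
      using \<open>(\<lambda>n. bridge_cov s t - (1 / 2) ^ n * (\<Sum>k<2 ^ n. bridge_cov (2 ^ n * s - real k) (2 ^ n * t - real k))) \<longlonglongrightarrow> bridge_cov s t - 0\<close>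
      by (simp only: diff_zero)
  qed
  moreover have "(1 / 2) ^ l / 4 * (\<Sum>k<2 ^ l. hat (2 ^ l * s - real k) * hat (2 ^ l * t - real k)) =
    (\<Sum>k<2 ^ (Suc l - 1). schauder (Suc l) k s * schauder (Suc l) k t)" for l
  proof -
    have "(1 / 2 :: real) ^ l = (1 / sqrt 2) ^ l * (1 / sqrt 2) ^ l"
      by (simp add: power_mult_distrib[symmetric])
    then show ?thesis by (simp only: schauder.simps diff_Suc_1) (simp add: sum_distrib_left mult_ac)
  qed
  ultimately have "(\<lambda>n. (\<Sum>l<n. \<Sum>k<2 ^ (Suc l - 1). schauder (Suc l) k s * schauder (Suc l) k t)) \<longlonglongrightarrow> bridge_cov s t"
    by simp
  \<comment> \<open>The linear function at level 0 contributes \<open>s * t\<close>, which turns the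
    covariance of the bridge into that of Brownian motion.\<close>
  from tendsto_add[OF tendsto_const[of "s * t"] this]
  have "(\<lambda>n. s * t + (\<Sum>l<n. \<Sum>k<2 ^ (Suc l - 1). schauder (Suc l) k s * schauder (Suc l) k t)) \<longlonglongrightarrow> min s t"
    using assms by (simp add: bridge_cov_def)
  moreover have "s * t + (\<Sum>l<n. \<Sum>k<2 ^ (Suc l - 1). schauder (Suc l) k s * schauder (Suc l) k t)
     = (\<Sum>l<Suc n. \<Sum>k<2 ^ (l - 1). schauder l k s * schauder l k t)" for n
    by (subst sum.lessThan_Suc_shift) simp
  ultimately have "(\<lambda>n. \<Sum>l<Suc n. \<Sum>k<2 ^ (l - 1). schauder l k s * schauder l k t) \<longlonglongrightarrow> min s t"
    by (simp only:)
  then show ?thesis by (rule LIMSEQ_imp_Suc)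
qed

text \<open>The tents of one level add up to at most 1, so the level is bounded by one coefficient
  times the noise threshold, that is 2^(-l/2) 2^(l/4).\<close>

lemma schauder_level_bound:
  assumes l: "l \<ge> 1" and z: "\<And>k. k < 2 ^ (l - 1) \<Longrightarrow> \<bar>z (l, k)\<bar> \<le> sqrt (sqrt 2) ^ l"
  shows "\<bar>schauder_level l z t\<bar> \<le> (1 / sqrt (sqrt 2)) ^ l"
proof -
  obtain m where m: "l = Suc m" using l by (cases l) auto
  let ?r = "sqrt (sqrt 2) :: real"
  have "\<bar>schauder_level l z t\<bar> \<le> (\<Sum>k<2 ^ m. \<bar>schauder l k t * z (l, k)\<bar>)"
    unfolding schauder_level_def m diff_Suc_1 by (rule sum_abs)
  also have "\<dots> \<le> (\<Sum>k<2 ^ m. (1 / sqrt 2) ^ m / 2 * ?r ^ l * hat (2 ^ m * t - real k))"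
  proof (rule sum_mono)
    fix k :: nat assume "k \<in> {..<2 ^ m}"
    then have "\<bar>z (l, k)\<bar> \<le> ?r ^ l" using z m by simp
    then have "(1 / sqrt 2) ^ m / 2 * hat (2 ^ m * t - real k) * \<bar>z (l, k)\<bar> \<le> (1 / sqrt 2) ^ m / 2 * hat (2 ^ m * t - real k) * ?r ^ l"
      using hat_nonneg by (intro mult_left_mono) auto
    then show "\<bar>schauder l k t * z (l, k)\<bar> \<le> (1 / sqrt 2) ^ m / 2 * ?r ^ l * hat (2 ^ m * t - real k)"
      using hat_nonneg by (simp add: m abs_mult mult_ac)
  qed
  also have "\<dots> = (1 / sqrt 2) ^ m / 2 * ?r ^ l * (\<Sum>k<2 ^ m. hat (2 ^ m * t - real k))"
    by (simp add: sum_distrib_left)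
  also have "\<dots> \<le> (1 / sqrt 2) ^ m / 2 * ?r ^ l"
    using hat_sum_le hat_nonneg by (intro mult_left_le) (auto intro!: sum_nonneg)
  also have "\<dots> \<le> (1 / sqrt 2) ^ l * ?r ^ l"
  proof -
    \<comment> \<open>The spare factor 1/2 of the tents makes up for the index shift between
      \<open>m\<close> and \<open>l = Suc m\<close>.\<close>
    have "1 / 2 \<le> 1 / sqrt 2" by (intro divide_left_mono) (auto simp: real_le_lsqrt real_sqrt_le_iff)
    then have "(1 / sqrt 2) ^ m * (1 / 2) \<le> (1 / sqrt 2) ^ m * (1 / sqrt 2)" by (intro mult_left_mono) auto
    then show ?thesis by (intro mult_right_mono) (auto simp: m)
  qed
  also have "\<dots> = (1 / ?r) ^ l"
  proof -
    have "1 / sqrt 2 * ?r = 1 / ?r" by (simp add: field_simps)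
    then show ?thesis by (simp add: power_mult_distrib[symmetric])
  qed
  finally show ?thesis .
qed

lemma continuous_on_schauder_level: "continuous_on S (schauder_level l z)"
proof -
  have "continuous_on S (schauder l k)" for k
    by (cases l) (auto simp: hat_def[abs_def] intro!: continuous_intros)
  then show ?thesis unfolding schauder_level_def[abs_def] by (intro continuous_intros) auto
qed

lemma tame_uniform_limit:
  assumes "tame z"
  shows "uniform_limit UNIV (\<lambda>n t. \<Sum>l<n. schauder_level l z t) (brownian z) sequentially"
proof -
  from assms obtain L where L: "\<And>l k. l \<ge> L \<Longrightarrow> k < 2 ^ (l - 1) \<Longrightarrow> \<bar>z (l, k)\<bar> \<le> sqrt (sqrt 2) ^ l"
    unfolding tame_def by blast
  have "uniform_limit UNIV (\<lambda>n t. \<Sum>l<n. schauder_level l z t) (\<lambda>t. \<Sum>l. schauder_level l z t) sequentially"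
  proof (rule Weierstrass_m_test_ev)
    show "\<forall>\<^sub>F l in sequentially. \<forall>t\<in>UNIV. norm (schauder_level l z t) \<le> (1 / sqrt (sqrt 2)) ^ l"
      using eventually_ge_at_top[of "max 1 L"]
    proof eventually_elim
      case (elim l)
      then show ?case using schauder_level_bound[of l z] L by simp
    qed
    show "summable (\<lambda>l. (1 / sqrt (sqrt 2)) ^ l :: real)" by (intro summable_geometric) simp
  qed
  moreover have "brownian z = (\<lambda>t. \<Sum>l. schauder_level l z t)" using assms by (auto simp: brownian_def)
  ultimately show ?thesis by simp
qed

lemma continuous_on_brownian: "continuous_on S (brownian z)"
proof (cases "tame z")
  case True
  have "continuous_on UNIV (brownian z)"
    by (rule uniform_limit_theorem[OF _ tame_uniform_limit[OF True]])
       (auto intro!: always_eventually continuous_on_sum continuous_on_schauder_level)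
  then show ?thesis by (rule continuous_on_subset) simp
next
  case False
  then have "brownian z = (\<lambda>_. 0)" by (auto simp: brownian_def)
  then show ?thesis by simp
qed

lemma tame_measurable[measurable]: "Measurable.pred white_noise tame"
  unfolding tame_def[abs_def] by measurable

lemma schauder_level_measurable[measurable]: "(\<lambda>z. schauder_level l z t) \<in> borel_measurable white_noise"
  unfolding schauder_level_def by measurable

lemma brownian_measurable: "(\<lambda>z. brownian z t) \<in> borel_measurable white_noise"
  unfolding brownian_def by measurable

text \<open>Markov's inequality with the eighth moment, since (2^(l/4))^8 = 4^l: each variable fails
  with probability C 4^(-l), and the union over 2^(l-1) variables is still summable, as
  Borel-Cantelli requires. A fourth moment would leave a constant bound.\<close>

lemma AE_tame: "AE z in white_noise. tame z"
proof -
  interpret prob_space white_noise by (rule prob_space_white_noise)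
  interpret N: prob_space std_normal_distribution using prob_space_normal_density by auto
  let ?r = "sqrt (sqrt 2) :: real"
  have r4: "?r ^ 4 = 2"
  proof -
    have "?r ^ 4 = (?r\<^sup>2)\<^sup>2" unfolding power_mult[symmetric] by simp
    also have "?r\<^sup>2 = sqrt 2" by (rule real_sqrt_pow2) simp
    also have "(sqrt 2)\<^sup>2 = (2::real)" by (rule real_sqrt_pow2) simp
    finally show ?thesis .
  qed
  have r8: "(?r ^ l) ^ 8 = 4 ^ l" for l
  proof -
    have "(?r ^ l) ^ 8 = ((?r ^ 4) ^ 2) ^ l" by (simp only: power_mult[symmetric] mult.commute) (simp add: mult.commute)
    then show ?thesis using r4 by simp
  qed
  obtain C where C: "C \<ge> 0" "(\<integral>x. x ^ 8 \<partial>std_normal_distribution) = C"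
  proof (rule that)
    show "0 \<le> (\<integral>x. x ^ 8 \<partial>std_normal_distribution)" by (rule Bochner_Integration.integral_nonneg) simp
  qed (rule refl)
  have tail: "prob {z \<in> space white_noise. \<bar>z i\<bar> > ?r ^ l} \<le> C / 4 ^ l" for i l
  proof -
    have d: "distr white_noise std_normal_distribution (\<lambda>z. z i) = std_normal_distribution"
      using distr_PiM_component[of UNIV "\<lambda>_. std_normal_distribution" i] N.prob_space_axioms by simp
    have "prob {z \<in> space white_noise. \<bar>z i\<bar> > ?r ^ l} = measure (distr white_noise std_normal_distribution (\<lambda>z. z i)) {x. \<bar>x\<bar> > ?r ^ l}"
      by (subst measure_distr) (auto simp: space_PiM intro!: arg_cong[where f = prob])
    also have "\<dots> \<le> measure std_normal_distribution {x \<in> space std_normal_distribution. x ^ 8 \<ge> 4 ^ l}"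
      unfolding d
    proof (rule N.finite_measure_mono)
      show "{x. \<bar>x\<bar> > ?r ^ l} \<subseteq> {x \<in> space std_normal_distribution. x ^ 8 \<ge> 4 ^ l}"
      proof
        fix x assume "x \<in> {x. \<bar>x\<bar> > ?r ^ l}"
        then have "(?r ^ l) ^ 8 \<le> \<bar>x\<bar> ^ 8" by (intro power_mono) auto
        then show "x \<in> {x \<in> space std_normal_distribution. x ^ 8 \<ge> 4 ^ l}" unfolding r8 by simp
      qed
    qed auto
    also have "\<dots> \<le> (\<integral>x. x ^ 8 \<partial>std_normal_distribution) / 4 ^ l"
      by (rule integral_Markov_inequality_measure[where A = "{}"]) (auto intro: integrable_std_normal_distribution_moment)
    finally show ?thesis using C by simp
  qed
  define A where "A l = {z \<in> space white_noise. \<exists>k<2 ^ (l - 1). \<bar>z (l, k)\<bar> > ?r ^ l}" for l :: nat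
  have A_meas[measurable]: "A l \<in> sets white_noise" for l unfolding A_def by measurable
  have A_le: "prob (A l) \<le> C * (1 / 2) ^ l" for l
  proof -
    have "A l = (\<Union>k<2 ^ (l - 1). {z \<in> space white_noise. \<bar>z (l, k)\<bar> > ?r ^ l})" by (auto simp: A_def)
    then have "prob (A l) \<le> (\<Sum>k<2 ^ (l - 1). prob {z \<in> space white_noise. \<bar>z (l, k)\<bar> > ?r ^ l})"
      by (simp only:) (intro finite_measure_subadditive_finite, auto)
    also have "\<dots> \<le> (\<Sum>k<(2::nat) ^ (l - 1). C / 4 ^ l)" by (intro sum_mono tail)
    also have "\<dots> = 2 ^ (l - 1) * (C / 4 ^ l)" by simp
    also have "\<dots> \<le> 2 ^ l * (C / 4 ^ l)" using C(1) by (intro mult_right_mono power_increasing) auto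
    also have "\<dots> = C * (2 / 4) ^ l" by (simp only: power_divide times_divide_eq_right mult.commute)
    finally show ?thesis by simp
  qed
  have "AE z in white_noise. eventually (\<lambda>l. z \<in> space white_noise - A l) sequentially"
  proof (rule borel_cantelli_AE1)
    show "summable (\<lambda>l. prob (A l))"
      by (rule summable_comparison_test[OF _ summable_mult[OF summable_geometric[of "1/2::real"], of C]]) (use A_le in auto)
  qed (auto simp: emeasure_eq_measure)
  then show ?thesis
  proof eventually_elim
    case (elim z)
    then obtain L where "\<And>l. l \<ge> L \<Longrightarrow> z \<in> space white_noise - A l" unfolding eventually_sequentially by blast
    then have "\<bar>z (l, k)\<bar> \<le> ?r ^ l" if "l \<ge> L" "k < 2 ^ (l - 1)" for l k
      using that unfolding A_def by (metis (no_types, lifting) DiffE mem_Collect_eq not_less)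
    then show ?case unfolding tame_def by blast
  qed
qed

section \<open>Finite-dimensional laws of the series\<close>

lemma white_noise_char:
  fixes I :: "(nat \<times> nat) set"
  assumes "finite I"
  shows "(CLINT z|white_noise. iexp (\<Sum>i\<in>I. b i * z i)) = complex_of_real (exp (- (\<Sum>i\<in>I. (b i)\<^sup>2) / 2))"
proof -
  interpret N: prob_space std_normal_distribution using prob_space_normal_density by auto
  interpret P: product_prob_space "\<lambda>_::nat \<times> nat. std_normal_distribution" UNIV ..
  have "(CLINT z|white_noise. iexp (\<Sum>i\<in>I. b i * z i)) = (CLINT z|white_noise. (\<Prod>i\<in>I. iexp (b i * restrict z I i)))"
    by (intro Bochner_Integration.integral_cong refl)
       (simp add: exp_sum[symmetric] sum_distrib_left assms)
  also have "\<dots> = (CLINT z|distr white_noise (PiM I (\<lambda>_. std_normal_distribution)) (\<lambda>x. restrict x I). (\<Prod>i\<in>I. iexp (b i * z i)))"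
    by (rule integral_distr[symmetric]) (auto intro!: measurable_restrict_subset simp del: restrict_apply)
  also have "distr white_noise (PiM I (\<lambda>_. std_normal_distribution)) (\<lambda>x. restrict x I) = PiM I (\<lambda>_. std_normal_distribution)"
    by (rule P.distr_PiM_restrict_finite) (use assms in auto)
  also have "(CLINT z|PiM I (\<lambda>_. std_normal_distribution). (\<Prod>i\<in>I. iexp (b i * z i))) = (\<Prod>i\<in>I. CLINT x|std_normal_distribution. iexp (b i * x))"
    by (rule P.product_integral_prod[where f = "\<lambda>i x. iexp (b i * x)", OF assms]) (rule N.integrable_const_bound[where B = 1], auto)
  also have "\<dots> = (\<Prod>i\<in>I. complex_of_real (exp (- ((b i)\<^sup>2) / 2)))"
    using char_std_normal_distribution unfolding char_def fun_eq_iff by (intro prod.cong) auto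
  also have "\<dots> = complex_of_real (exp (- (\<Sum>i\<in>I. (b i)\<^sup>2) / 2))"
    unfolding of_real_prod[symmetric] exp_sum[OF assms, symmetric] by (simp add: sum_negf sum_divide_distrib)
  finally show ?thesis .
qed

text \<open>A linear combination of partial sums is a finite combination of the noise, hence exactly
  Gaussian, and its variance is a quadratic form in the partial sums of the Schauder kernel. Almost
  sure convergence passes this to the limit.\<close>

lemma brownian_char:
  fixes tt c :: "nat \<Rightarrow> real"
  assumes J: "finite J" and tt: "\<And>j. j \<in> J \<Longrightarrow> tt j \<in> {0..1}"
  shows "(CLINT z|white_noise. iexp (\<Sum>j\<in>J. c j * brownian z (tt j))) =
    complex_of_real (exp (- (\<Sum>i\<in>J. \<Sum>j\<in>J. c i * c j * min (tt i) (tt j)) / 2))"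
proof (rule LIMSEQ_unique)
  interpret prob_space white_noise by (rule prob_space_white_noise)
  let ?I = "\<lambda>n. Sigma {..<n} (\<lambda>l. {..<2 ^ (l - 1)}) :: (nat \<times> nat) set"
  define W where "W n z t = (\<Sum>l<n. schauder_level l z t)" for n z t
  define b where "b i = (\<Sum>j\<in>J. c j * schauder (fst i) (snd i) (tt j))" for i
  have W: "(\<Sum>j\<in>J. c j * W n z (tt j)) = (\<Sum>i\<in>?I n. b i * z i)" for n z
  proof -
    have "(\<Sum>i\<in>?I n. b i * z i) = (\<Sum>i\<in>?I n. \<Sum>j\<in>J. c j * (schauder (fst i) (snd i) (tt j) * z i))"
      by (simp add: b_def sum_distrib_right mult.assoc)
    also have "\<dots> = (\<Sum>j\<in>J. \<Sum>i\<in>?I n. c j * (schauder (fst i) (snd i) (tt j) * z i))"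
      by (rule sum.swap)
    also have "\<dots> = (\<Sum>j\<in>J. c j * W n z (tt j))"
      by (simp add: W_def schauder_level_def sum.Sigma sum_distrib_left split_beta)
    finally show ?thesis by simp
  qed
  have b2: "(\<Sum>i\<in>?I n. (b i)\<^sup>2) = (\<Sum>i\<in>J. \<Sum>j\<in>J. c i * c j * (\<Sum>l<n. \<Sum>k<2 ^ (l - 1). schauder l k (tt i) * schauder l k (tt j)))" for n
  proof -
    have "(\<Sum>i\<in>?I n. (b i)\<^sup>2) = (\<Sum>p\<in>?I n. \<Sum>i\<in>J. \<Sum>j\<in>J. c i * c j * (schauder (fst p) (snd p) (tt i) * schauder (fst p) (snd p) (tt j)))"
      unfolding b_def power2_eq_square sum_product by (simp add: mult_ac)
    also have "\<dots> = (\<Sum>i\<in>J. \<Sum>p\<in>?I n. \<Sum>j\<in>J. c i * c j * (schauder (fst p) (snd p) (tt i) * schauder (fst p) (snd p) (tt j)))"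
      by (rule sum.swap)
    also have "\<dots> = (\<Sum>i\<in>J. \<Sum>j\<in>J. \<Sum>p\<in>?I n. c i * c j * (schauder (fst p) (snd p) (tt i) * schauder (fst p) (snd p) (tt j)))"
      by (intro sum.cong refl sum.swap)
    finally show ?thesis by (simp add: sum_distrib_left[symmetric] sum.Sigma split_beta)
  qed
  have "(\<lambda>n. complex_of_real (exp (- (\<Sum>i\<in>?I n. (b i)\<^sup>2) / 2))) \<longlonglongrightarrow>
    complex_of_real (exp (- (\<Sum>i\<in>J. \<Sum>j\<in>J. c i * c j * min (tt i) (tt j)) / 2))"
    unfolding b2 by (intro tendsto_intros schauder_kernel tt) auto
  moreover have "(CLINT z|white_noise. iexp (\<Sum>j\<in>J. c j * W n z (tt j))) = complex_of_real (exp (- (\<Sum>i\<in>?I n. (b i)\<^sup>2) / 2))" for n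
    unfolding W by (rule white_noise_char) auto
  ultimately show "(\<lambda>n. CLINT z|white_noise. iexp (\<Sum>j\<in>J. c j * W n z (tt j))) \<longlonglongrightarrow>
    complex_of_real (exp (- (\<Sum>i\<in>J. \<Sum>j\<in>J. c i * c j * min (tt i) (tt j)) / 2))" by simp
  show "(\<lambda>n. CLINT z|white_noise. iexp (\<Sum>j\<in>J. c j * W n z (tt j))) \<longlonglongrightarrow>
    (CLINT z|white_noise. iexp (\<Sum>j\<in>J. c j * brownian z (tt j)))"
  proof (rule integral_dominated_convergence[where w = "\<lambda>_. 1"])
    have [measurable]: "(\<lambda>z. brownian z t) \<in> borel_measurable white_noise" for t by (rule brownian_measurable)
    show "(\<lambda>z. iexp (\<Sum>j\<in>J. c j * brownian z (tt j))) \<in> borel_measurable white_noise" by measurable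
    show "(\<lambda>z. iexp (\<Sum>j\<in>J. c j * W n z (tt j))) \<in> borel_measurable white_noise" for n unfolding W_def by measurable
    show "AE z in white_noise. (\<lambda>n. iexp (\<Sum>j\<in>J. c j * W n z (tt j))) \<longlonglongrightarrow> iexp (\<Sum>j\<in>J. c j * brownian z (tt j))"
      using AE_tame
    proof eventually_elim
      case (elim z)
      have "(\<lambda>n. W n z t) \<longlonglongrightarrow> brownian z t" for t
        using tendsto_uniform_limitI[OF tame_uniform_limit[OF elim], of t] by (simp add: W_def)
      then show ?case by (intro tendsto_intros)
    qed
  qed auto
qed

section \<open>Exponential moments of Levy processes\<close>

text \<open>Cauchy's functional equation with a one-sided bound: a value below x f(1) would, through
  large multiples of x reduced modulo 1, push \<open>f\<close> below every bound on [0, 1]. The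
  reverse inequality follows by reflection.\<close>

lemma additive_bounded_below_linear:
  fixes f :: "real \<Rightarrow> real"
  assumes add: "\<And>s t. 0 \<le> s \<Longrightarrow> 0 \<le> t \<Longrightarrow> f (s + t) = f s + f t"
    and d: "d > 0" and bd: "\<And>t. 0 \<le> t \<Longrightarrow> t \<le> d \<Longrightarrow> - 1 \<le> f t"
    and t: "0 \<le> t"
  shows "f t = t * f 1"
proof -
  have f0: "f 0 = 0" using add[of 0 0] by simp
  have mult: "f (real n * x) = real n * f x" if "x \<ge> 0" for n x
  proof (induction n)
    case (Suc n)
    have "f (x + real n * x) = f x + f (real n * x)" using that by (intro add) auto
    then show ?case using Suc by (simp add: algebra_simps)
  qed (simp add: f0)
  obtain N :: nat where N: "1 / d < N" using reals_Archimedean2 by blast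
  moreover have "0 < 1 / d" using d by simp
  ultimately have N0: "real N > 0" by linarith
  have lb: "- real N \<le> f r" if "0 \<le> r" "r \<le> 1" for r
  proof -
    have "r / N \<le> 1 / N" using that N0 by (intro divide_right_mono) auto
    also have "1 / N < d" using N N0 d by (simp add: field_simps)
    finally have "- 1 \<le> f (r / N)" using that by (intro bd) auto
    then have "real N * - 1 \<le> real N * f (r / N)" using N0 by (intro mult_left_mono) auto
    also have "\<dots> = f r" using mult[of "r / N" N] that N0 by simp
    finally show ?thesis by simp
  qed
  have ge: "x * f 1 \<le> f x" if x: "0 \<le> x" for x
  proof (rule ccontr)
    assume "\<not> x * f 1 \<le> f x"
    then have pos: "0 < x * f 1 - f x" by simp
    \<comment> \<open>\<open>n\<close> times the deficit must exceed what the fractional part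
      \<open>r\<close> of \<open>n * x\<close> can account for, namely \<open>real N\<close> from
      the lower bound on \<open>f r\<close> plus \<open>\<bar>f 1\<bar>\<close>.\<close>
    obtain n :: nat where n: "(real N + \<bar>f 1\<bar>) / (x * f 1 - f x) < n" using reals_Archimedean2 by blast
    then have n': "real N + \<bar>f 1\<bar> < real n * (x * f 1 - f x)" using pos by (simp add: field_simps)
    define k where "k = nat \<lfloor>real n * x\<rfloor>"
    define r where "r = real n * x - real k"
    have "0 \<le> real n * x" using x by simp
    then have r: "0 \<le> r" "r < 1" unfolding r_def k_def by linarith+
    have "f (real k * 1 + r) = f (real k * 1) + f r" using r by (intro add) auto
    then have "real n * f x = real k * f 1 + f r" using mult[OF x, of n] mult[of 1 k] by (simp add: r_def)
    then have "real n * (x * f 1 - f x) = r * f 1 - f r" by (simp add: r_def algebra_simps)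
    moreover have "r * f 1 \<le> \<bar>f 1\<bar>"
    proof -
      have "r * f 1 \<le> r * \<bar>f 1\<bar>" using r by (intro mult_left_mono) auto
      also have "\<dots> \<le> \<bar>f 1\<bar>" using r by (intro mult_left_le_one_le) auto
      finally show ?thesis .
    qed
    ultimately show False using lb[of r] r n' by linarith
  qed
  \<comment> \<open>Reflecting \<open>t\<close> to \<open>K - t\<close> converts the inequality just
    proved into the opposite one, because \<open>f\<close> is exact at integers.\<close>
  obtain K :: nat where K: "t \<le> K" using real_arch_simple by blast
  have "f (t + (real K - t)) = f t + f (real K - t)" using t K by (intro add) auto
  moreover have "(real K - t) * f 1 \<le> f (real K - t)" using K by (intro ge) auto
  ultimately have "f t \<le> t * f 1" using mult[of 1 K] by (simp add: algebra_simps)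
  with ge[OF t] show ?thesis by simp
qed

locale levy =
  fixes M :: "'a measure" and X :: "real \<Rightarrow> 'a \<Rightarrow> real"
  assumes levy: "levy_process M X"
    and expmom1: "\<And>u. integrable M (\<lambda>\<omega>. exp (u * X 1 \<omega>))"
begin

sublocale prob_space M using levy unfolding levy_process_def by blast

lemma meas: "t \<ge> 0 \<Longrightarrow> X t \<in> borel_measurable M"
  using levy unfolding levy_process_def by blast

lemma start: "\<omega> \<in> space M \<Longrightarrow> X 0 \<omega> = 0"
  using levy unfolding levy_process_def by blast

lemma path: "\<omega> \<in> space M \<Longrightarrow> cadlag_on {0..} (\<lambda>t. X t \<omega>)"
  using levy unfolding levy_process_def by blast

lemma stationary: "0 \<le> s \<Longrightarrow> s \<le> t \<Longrightarrow> distr M borel (\<lambda>\<omega>. X t \<omega> - X s \<omega>) = distr M borel (X (t - s))"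
  using levy unfolding levy_process_def by blast

lemma indep_increments:
  fixes tt :: "nat \<Rightarrow> real"
  shows "0 \<le> tt 0 \<Longrightarrow> strict_mono tt \<Longrightarrow> indep_vars (\<lambda>_. borel) (\<lambda>k \<omega>. X (tt (Suc k)) \<omega> - X (tt k) \<omega>) {..<n}"
  using levy unfolding levy_process_def by blast

definition \<psi> :: "real \<Rightarrow> real" where
  "\<psi> u = ln (expectation (\<lambda>\<omega>. exp (u * X 1 \<omega>)))"

text \<open>Valued in \<open>ennreal\<close>, so that multiplicativity in time can be proved before
  finiteness is known.\<close>

definition emom :: "real \<Rightarrow> real \<Rightarrow> ennreal" where
  "emom u t = (\<integral>\<^sup>+\<omega>. ennreal (exp (u * X t \<omega>)) \<partial>M)"

lemma emom_0: "emom u 0 = 1"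
proof -
  have "emom u 0 = (\<integral>\<^sup>+\<omega>. 1 \<partial>M)" unfolding emom_def by (intro nn_integral_cong) (simp add: start)
  then show ?thesis by (simp add: emeasure_space_1)
qed

lemma emom_increment:
  assumes "0 \<le> s" "s \<le> t"
  shows "(\<integral>\<^sup>+\<omega>. ennreal (exp (u * (X t \<omega> - X s \<omega>))) \<partial>M) = emom u (t - s)"
proof -
  have [measurable]: "X s \<in> borel_measurable M" "X t \<in> borel_measurable M" "X (t - s) \<in> borel_measurable M"
    using meas assms by auto
  have "(\<integral>\<^sup>+\<omega>. ennreal (exp (u * (X t \<omega> - X s \<omega>))) \<partial>M) = (\<integral>\<^sup>+x. ennreal (exp (u * x)) \<partial>distr M borel (\<lambda>\<omega>. X t \<omega> - X s \<omega>))"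
    by (subst nn_integral_distr) auto
  also have "\<dots> = emom u (t - s)" unfolding stationary[OF assms] emom_def by (subst nn_integral_distr) auto
  finally show ?thesis .
qed

lemma emom_two_increments:
  assumes "0 \<le> s" "s \<le> t"
  shows "(\<integral>\<^sup>+\<omega>. ennreal (exp (u * X s \<omega> + v * (X t \<omega> - X s \<omega>))) \<partial>M) = emom u s * emom v (t - s)"
proof -
  \<comment> \<open>Independence of increments is available for strictly increasing times, so the
    two degenerate cases are separate.\<close>
  consider "s = 0" | "s = t" | "0 < s" "s < t" using assms by linarith
  then show ?thesis
  proof cases
    case 1
    have "(\<integral>\<^sup>+\<omega>. ennreal (exp (u * X s \<omega> + v * (X t \<omega> - X s \<omega>))) \<partial>M) = (\<integral>\<^sup>+\<omega>. ennreal (exp (v * (X t \<omega> - X s \<omega>))) \<partial>M)"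
      using 1 by (intro nn_integral_cong) (simp add: start)
    then show ?thesis using emom_increment[OF assms, of v] 1 by (simp add: emom_0)
  next
    case 2
    then show ?thesis by (simp add: emom_0) (simp add: emom_def)
  next
    case 3
    \<comment> \<open>The partition 0, s, t is continued by unit steps only to be strictly
      increasing on all naturals; just its first two increments are used.\<close>
    define tt where "tt k = (if k = 0 then 0 else if k = 1 then s else t + real (k - 2))" for k :: nat
    have "tt k < tt (Suc k)" for k using 3 by (cases k; cases "k - 1") (auto simp: tt_def)
    then have "strict_mono tt" by (simp add: strict_mono_Suc_iff)
    moreover have "0 \<le> tt 0" by (simp add: tt_def)
    ultimately have ind: "indep_vars (\<lambda>_. borel) (\<lambda>k \<omega>. X (tt (Suc k)) \<omega> - X (tt k) \<omega>) {..<2}"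
      by (intro indep_increments)
    have "indep_vars (\<lambda>_. borel) (\<lambda>k \<omega>. ennreal (exp ((if k = 0 then u else v) * (X (tt (Suc k)) \<omega> - X (tt k) \<omega>)))) {..<2}"
      by (rule indep_vars_compose2[OF ind]) measurable
    from indep_vars_nn_integral[OF _ this]
    have "(\<integral>\<^sup>+\<omega>. (\<Prod>k<2. ennreal (exp ((if k = 0 then u else v) * (X (tt (Suc k)) \<omega> - X (tt k) \<omega>)))) \<partial>M) =
      (\<Prod>k<2. \<integral>\<^sup>+\<omega>. ennreal (exp ((if k = 0 then u else v) * (X (tt (Suc k)) \<omega> - X (tt k) \<omega>))) \<partial>M)" by auto
    moreover have "(\<Prod>k<2. f k) = f 0 * f (1::nat)" for f :: "nat \<Rightarrow> ennreal"
      by (simp add: numeral_2_eq_2)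
    moreover have "tt 0 = 0" "tt (Suc 0) = s" "tt (Suc (Suc 0)) = t" by (auto simp: tt_def)
    ultimately have "(\<integral>\<^sup>+\<omega>. ennreal (exp (u * (X s \<omega> - X 0 \<omega>))) * ennreal (exp (v * (X t \<omega> - X s \<omega>))) \<partial>M) =
      (\<integral>\<^sup>+\<omega>. ennreal (exp (u * (X s \<omega> - X 0 \<omega>))) \<partial>M) * (\<integral>\<^sup>+\<omega>. ennreal (exp (v * (X t \<omega> - X s \<omega>))) \<partial>M)"
      by simp
    moreover have "(\<integral>\<^sup>+\<omega>. ennreal (exp (u * (X s \<omega> - X 0 \<omega>))) * ennreal (exp (v * (X t \<omega> - X s \<omega>))) \<partial>M) =
      (\<integral>\<^sup>+\<omega>. ennreal (exp (u * X s \<omega> + v * (X t \<omega> - X s \<omega>))) \<partial>M)"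
      by (intro nn_integral_cong) (simp add: start exp_add ennreal_mult)
    ultimately show ?thesis using emom_increment[of 0 s u] emom_increment[OF assms, of v] 3 by simp
  qed
qed

lemma emom_add: "0 \<le> s \<Longrightarrow> 0 \<le> t \<Longrightarrow> emom u (s + t) = emom u s * emom u t"
  using emom_two_increments[of s "s + t" u u] by (simp add: emom_def algebra_simps)

lemma emom_pos: assumes "t \<ge> 0" shows "emom u t > 0"
proof -
  have [measurable]: "X t \<in> borel_measurable M" using meas assms by auto
  have "emom u t \<noteq> 0"
  proof
    assume "emom u t = 0"
    then have "AE \<omega> in M. ennreal (exp (u * X t \<omega>)) = 0" unfolding emom_def by (subst (asm) nn_integral_0_iff_AE) auto
    then have "AE \<omega> in M. False" by (rule AE_mp) (auto simp: ennreal_eq_0_iff not_le)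
    then show False by simp
  qed
  then show ?thesis by (simp add: zero_less_iff_neq_zero)
qed

text \<open>Finite at integer times as a power of the moment at time 1. For t below n, the moments
  at t and n - t have a finite product and the second is positive.\<close>

lemma emom_finite: assumes "t \<ge> 0" shows "emom u t < \<infinity>"
proof -
  have fin: "emom u (real n) < \<infinity>" for n
  proof (induction n)
    case (Suc n)
    have "emom u 1 < \<infinity>"
      unfolding emom_def using expmom1[of u] by (simp add: integrable_iff_bounded)
    then show ?case using Suc emom_add[of 1 "real n" u] by (simp add: ennreal_mult_less_top)
  qed (simp add: emom_0)
  obtain n :: nat where n: "t \<le> n" using real_arch_simple by blast
  then have "emom u t * emom u (real n - t) < \<infinity>" using fin[of n] emom_add[of t "real n - t" u] assms by simp
  moreover have "emom u (real n - t) > 0" using n by (intro emom_pos) auto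
  ultimately show ?thesis by (auto simp: ennreal_mult_less_top)
qed

lemma integrable_exp: assumes "t \<ge> 0" shows "integrable M (\<lambda>\<omega>. exp (u * X t \<omega>))"
  using emom_finite[OF assms, of u] meas[OF assms] unfolding emom_def
  by (intro integrableI_bounded) (auto intro!: borel_measurable_exp borel_measurable_times)

lemma emom_eq: assumes "t \<ge> 0" shows "emom u t = ennreal (expectation (\<lambda>\<omega>. exp (u * X t \<omega>)))"
  unfolding emom_def by (rule nn_integral_eq_integral[OF integrable_exp[OF assms]]) simp

lemma expectation_exp_pos: assumes "t \<ge> 0" shows "expectation (\<lambda>\<omega>. exp (u * X t \<omega>)) > 0"
  using emom_pos[OF assms, of u] unfolding emom_eq[OF assms] by simp

text \<open>Right continuity at \<open>0\<close> enters only through Fatou's lemma, which bounds the additive function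
  \<open>t \<mapsto> ln E exp (u X(t))\<close> from below near \<open>0\<close>.\<close>

lemma expectation_exp_lower_near_0:
  "\<exists>d>0. \<forall>t. 0 \<le> t \<longrightarrow> t \<le> d \<longrightarrow> exp (- 1) \<le> expectation (\<lambda>\<omega>. exp (u * X t \<omega>))"
proof (rule ccontr)
  assume "\<not> ?thesis"
  then have "\<exists>t. 0 \<le> t \<and> t \<le> inverse (real (Suc n)) \<and> expectation (\<lambda>\<omega>. exp (u * X t \<omega>)) < exp (- 1)" for n
    using not_le inverse_positive_iff_positive of_nat_0_less_iff by (metis zero_less_Suc)
  then obtain r where r: "\<And>n. 0 \<le> r n" "\<And>n. r n \<le> inverse (real (Suc n))"
    "\<And>n. expectation (\<lambda>\<omega>. exp (u * X (r n) \<omega>)) < exp (- 1)" by metis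
  have [measurable]: "X (r n) \<in> borel_measurable M" for n using meas r(1) by auto
  have lim: "(\<lambda>n. ennreal (exp (u * X (r n) \<omega>))) \<longlonglongrightarrow> 1" if w: "\<omega> \<in> space M" for \<omega>
  proof -
    have "((\<lambda>t. X t \<omega>) \<longlongrightarrow> X 0 \<omega>) (at 0 within {0..})"
      using path[OF w] unfolding cadlag_on_def continuous_within by (auto dest!: bspec[of _ _ 0])
    then have "continuous (at 0 within {0..}) (\<lambda>t. X t \<omega>)" by (simp add: continuous_within)
    moreover have "r \<longlonglongrightarrow> 0"
      by (rule tendsto_sandwich[OF _ _ tendsto_const LIMSEQ_inverse_real_of_nat]) (use r in auto)
    ultimately have "(\<lambda>n. X (r n) \<omega>) \<longlonglongrightarrow> X 0 \<omega>"
      using r(1) by (auto simp: continuous_within_sequentially comp_def)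
    then have "(\<lambda>n. exp (u * X (r n) \<omega>)) \<longlonglongrightarrow> exp (u * X 0 \<omega>)" by (intro tendsto_intros)
    then show ?thesis using start[OF w] by (simp add: tendsto_ennrealI ennreal_1[symmetric] del: ennreal_1)
  qed
  have "1 = (\<integral>\<^sup>+\<omega>. 1 \<partial>M)" by (simp add: emeasure_space_1)
  also have "\<dots> = (\<integral>\<^sup>+\<omega>. liminf (\<lambda>n. ennreal (exp (u * X (r n) \<omega>))) \<partial>M)"
    by (intro nn_integral_cong lim_imp_Liminf[symmetric] lim) auto
  also have "\<dots> \<le> liminf (\<lambda>n. emom u (r n))" unfolding emom_def by (rule nn_integral_liminf) measurable
  also have "\<dots> \<le> liminf (\<lambda>n. ennreal (exp (- 1)))"
    using r by (intro Liminf_mono always_eventually allI) (auto simp: emom_eq intro!: ennreal_leI less_imp_le)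
  also have "\<dots> = ennreal (exp (- 1))" by (simp add: Liminf_const)
  also have "\<dots> < 1" by (simp add: ennreal_less_one_iff)
  finally show False by simp
qed

text \<open>The logarithm is additive in time and bounded below near 0, hence linear.\<close>

lemma expectation_exp:
  assumes t: "t \<ge> 0" shows "expectation (\<lambda>\<omega>. exp (u * X t \<omega>)) = exp (t * \<psi> u)"
proof -
  define f where "f t = ln (expectation (\<lambda>\<omega>. exp (u * X t \<omega>)))" for t
  obtain d where d: "d > 0" "\<And>t. 0 \<le> t \<Longrightarrow> t \<le> d \<Longrightarrow> exp (- 1) \<le> expectation (\<lambda>\<omega>. exp (u * X t \<omega>))"
    using expectation_exp_lower_near_0[of u] by blast
  have "f t = t * f 1"
  proof (rule additive_bounded_below_linear[OF _ d(1) _ t])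
    fix s t :: real assume st: "0 \<le> s" "0 \<le> t"
    have "ennreal (expectation (\<lambda>\<omega>. exp (u * X (s + t) \<omega>))) =
      ennreal (expectation (\<lambda>\<omega>. exp (u * X s \<omega>)) * expectation (\<lambda>\<omega>. exp (u * X t \<omega>)))"
      using emom_add[OF st, of u] st by (simp add: emom_eq ennreal_mult)
    then have "expectation (\<lambda>\<omega>. exp (u * X (s + t) \<omega>)) = expectation (\<lambda>\<omega>. exp (u * X s \<omega>)) * expectation (\<lambda>\<omega>. exp (u * X t \<omega>))"
      by (simp add: mult_nonneg_nonneg)
    then show "f (s + t) = f s + f t" using expectation_exp_pos[OF st(1), of u] expectation_exp_pos[OF st(2), of u] unfolding f_def by (simp add: ln_mult)
  next
    fix t assume "0 \<le> t" "t \<le> d"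
    from d(2)[OF this] show "- 1 \<le> f t" unfolding f_def using expectation_exp_pos[OF \<open>0 \<le> t\<close>, of u]
      by (simp add: ln_ge_iff)
  qed
  then have "exp (f t) = exp (t * \<psi> u)" by (simp add: f_def \<psi>_def)
  then show ?thesis using expectation_exp_pos[OF t, of u] by (simp add: f_def)
qed

lemma emom_exp: "t \<ge> 0 \<Longrightarrow> emom u t = ennreal (exp (t * \<psi> u))"
  by (simp add: emom_eq expectation_exp)

lemma expectation_exp_two:
  assumes "0 \<le> s" "s \<le> t"
  shows "integrable M (\<lambda>\<omega>. exp (u * X s \<omega> + v * (X t \<omega> - X s \<omega>)))"
    and "expectation (\<lambda>\<omega>. exp (u * X s \<omega> + v * (X t \<omega> - X s \<omega>))) = exp (s * \<psi> u + (t - s) * \<psi> v)"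
proof -
  have [measurable]: "X s \<in> borel_measurable M" "X t \<in> borel_measurable M" using meas assms by auto
  have eq: "(\<integral>\<^sup>+\<omega>. ennreal (exp (u * X s \<omega> + v * (X t \<omega> - X s \<omega>))) \<partial>M) = ennreal (exp (s * \<psi> u + (t - s) * \<psi> v))"
    using emom_two_increments[OF assms, of u v] assms by (simp add: emom_exp ennreal_mult exp_add)
  show int: "integrable M (\<lambda>\<omega>. exp (u * X s \<omega> + v * (X t \<omega> - X s \<omega>)))"
    by (rule integrableI_bounded) (use eq in auto)
  show "expectation (\<lambda>\<omega>. exp (u * X s \<omega> + v * (X t \<omega> - X s \<omega>))) = exp (s * \<psi> u + (t - s) * \<psi> v)"
    by (rule integral_eq_nn_integral[THEN trans]) (use eq in auto)
qed

lemma expectation_exp_increment: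
  assumes "0 \<le> s" "s \<le> t"
  shows "integrable M (\<lambda>\<omega>. exp (v * (X t \<omega> - X s \<omega>)))"
    and "expectation (\<lambda>\<omega>. exp (v * (X t \<omega> - X s \<omega>))) = exp ((t - s) * \<psi> v)"
proof -
  have "\<psi> 0 = 0" by (simp add: \<psi>_def prob_space)
  then show "integrable M (\<lambda>\<omega>. exp (v * (X t \<omega> - X s \<omega>)))"
    "expectation (\<lambda>\<omega>. exp (v * (X t \<omega> - X s \<omega>))) = exp ((t - s) * \<psi> v)"
    using expectation_exp_two[OF assms, of 0 v] by auto
qed

end

section \<open>Fourth moments and the central limit theorem\<close>

context prob_space
begin

text \<open>Measurability is required separately: it does not follow from that of the fourth power,
  which forgets the sign.\<close>

definition L4 :: "('a \<Rightarrow> real) \<Rightarrow> bool" where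
  "L4 f \<longleftrightarrow> f \<in> borel_measurable M \<and> integrable M (\<lambda>\<omega>. (f \<omega>) ^ 4)"

lemma L4_measurable: "L4 f \<Longrightarrow> f \<in> borel_measurable M" by (simp add: L4_def)

lemma abs_mult4_le: "\<bar>x * y * z * w\<bar> \<le> x ^ 4 + y ^ 4 + z ^ 4 + (w::real) ^ 4"
proof -
  have 1: "\<bar>a * b\<bar> \<le> a\<^sup>2 + b\<^sup>2" for a b :: real
    using sum_squares_bound[of "\<bar>a\<bar>" "\<bar>b\<bar>"] mult_nonneg_nonneg[OF abs_ge_zero[of a] abs_ge_zero[of b]]
    unfolding abs_mult power2_abs mult.assoc by linarith
  have 2: "(a * b)\<^sup>2 \<le> a ^ 4 + b ^ 4" for a b :: real
    using 1[of "a\<^sup>2" "b\<^sup>2"] by (simp add: power_mult_distrib)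
  have "\<bar>(x * y) * (z * w)\<bar> \<le> (x * y)\<^sup>2 + (z * w)\<^sup>2" by (rule 1)
  with 2[of x y] 2[of z w] show ?thesis by (simp add: mult.assoc)
qed

text \<open>This elementary substitute for Hoelder's inequality gives, with constant factors,
  integrability of every monomial of degree at most 4.\<close>

lemma integrable_L4_mult4:
  assumes "L4 f" "L4 g" "L4 h" "L4 k" shows "integrable M (\<lambda>\<omega>. f \<omega> * g \<omega> * h \<omega> * k \<omega>)"
proof (rule Bochner_Integration.integrable_bound)
  show "integrable M (\<lambda>\<omega>. (f \<omega>) ^ 4 + (g \<omega>) ^ 4 + (h \<omega>) ^ 4 + (k \<omega>) ^ 4)"
    using assms by (auto simp: L4_def)
  show "(\<lambda>\<omega>. f \<omega> * g \<omega> * h \<omega> * k \<omega>) \<in> borel_measurable M"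
    using assms by (auto simp: L4_def)
  show "AE \<omega> in M. norm (f \<omega> * g \<omega> * h \<omega> * k \<omega>) \<le> norm ((f \<omega>) ^ 4 + (g \<omega>) ^ 4 + (h \<omega>) ^ 4 + (k \<omega>) ^ 4)"
    using abs_mult4_le by (intro AE_I2) (auto intro: order_trans)
qed

lemma L4_const: "L4 (\<lambda>_. c)" by (simp add: L4_def)

lemma L4_add:
  assumes "L4 f" "L4 g" shows "L4 (\<lambda>\<omega>. f \<omega> + g \<omega>)"
proof -
  have "(x + y) ^ 4 = x * x * x * x + 4 * (x * x * x * y) + 6 * (x * x * y * y) + 4 * (x * y * y * y) + y * y * y * (y::real)" for x y
    by algebra
  then show ?thesis using assms integrable_L4_mult4 by (auto simp: L4_def)
qed

lemma L4_cmult: "L4 f \<Longrightarrow> L4 (\<lambda>\<omega>. c * f \<omega>)"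
  by (auto simp: L4_def power_mult_distrib)

lemma L4_diff: "L4 f \<Longrightarrow> L4 g \<Longrightarrow> L4 (\<lambda>\<omega>. f \<omega> - g \<omega>)"
  using L4_add[OF _ L4_cmult[of g "-1"]] by simp

lemma L4_sum: "(\<And>i. i \<in> I \<Longrightarrow> L4 (f i)) \<Longrightarrow> L4 (\<lambda>\<omega>. \<Sum>i\<in>I. f i \<omega>)"
  by (induction I rule: infinite_finite_induct) (auto intro: L4_add L4_const)

lemma integrable_L4_powers:
  assumes "L4 f"
  shows "integrable M f" "integrable M (\<lambda>\<omega>. (f \<omega>)\<^sup>2)" "integrable M (\<lambda>\<omega>. (f \<omega>) ^ 3)" "integrable M (\<lambda>\<omega>. (f \<omega>) ^ 4)"
proof -
  note c = L4_const[of 1]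
  show "integrable M f" using integrable_L4_mult4[OF assms c c c] by simp
  show "integrable M (\<lambda>\<omega>. (f \<omega>)\<^sup>2)" using integrable_L4_mult4[OF assms assms c c] by (simp add: power2_eq_square)
  show "integrable M (\<lambda>\<omega>. (f \<omega>) ^ 3)" using integrable_L4_mult4[OF assms assms assms c] by (simp add: power3_eq_cube)
  show "integrable M (\<lambda>\<omega>. (f \<omega>) ^ 4)" using assms by (simp add: L4_def)
qed

lemma integrable_L4_cube_mult:
  assumes "L4 f" "L4 g" shows "integrable M (\<lambda>\<omega>. (f \<omega>) ^ 3 * g \<omega>)"
  using integrable_L4_mult4[OF assms(1) assms(1) assms(1) assms(2)] by (simp add: power3_eq_cube)

lemma integrable_L4_mult:
  assumes "L4 f" "L4 g" shows "integrable M (\<lambda>\<omega>. f \<omega> * g \<omega>)"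
  using integrable_L4_mult4[OF assms L4_const L4_const, of 1 1] by simp

text \<open>The orthogonality hypothesis is the martingale property in the only form that Doob's first-passage
  decomposition uses.\<close>

lemma maximal_inequality4:
  fixes S :: "nat \<Rightarrow> 'a \<Rightarrow> real"
  assumes L: "\<And>k. k \<le> n \<Longrightarrow> L4 (S k)" and d: "\<delta> > 0"
    and orth: "\<And>k. k \<le> n \<Longrightarrow>
      expectation (\<lambda>\<omega>. (S k \<omega>) ^ 3 * indicat_real {\<omega> \<in> space M. \<delta> < \<bar>S k \<omega>\<bar> \<and> (\<forall>j<k. \<bar>S j \<omega>\<bar> \<le> \<delta>)} \<omega> * (S n \<omega> - S k \<omega>)) = 0"
  shows "prob {\<omega> \<in> space M. \<exists>k\<le>n. \<delta> < \<bar>S k \<omega>\<bar>} \<le> expectation (\<lambda>\<omega>. (S n \<omega>) ^ 4) / \<delta> ^ 4"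
proof -
  define A where "A k = {\<omega> \<in> space M. \<delta> < \<bar>S k \<omega>\<bar> \<and> (\<forall>j<k. \<bar>S j \<omega>\<bar> \<le> \<delta>)}" for k
  have A[measurable]: "A k \<in> sets M" if "k \<le> n" for k
  proof -
    have [measurable]: "S j \<in> borel_measurable M" if "j \<le> k" for j using L4_measurable[OF L] that \<open>k \<le> n\<close> by auto
    have "A k = {\<omega> \<in> space M. \<delta> < \<bar>S k \<omega>\<bar>} \<inter> {\<omega> \<in> space M. \<forall>j\<in>{..<k}. \<bar>S j \<omega>\<bar> \<le> \<delta>}" by (auto simp: A_def)
    also have "\<dots> \<in> sets M"
      by (intro sets.Int sets.sets_Collect_finite_All borel_measurable_less borel_measurable_le) auto
    finally show ?thesis .
  qed
  have disj: "disjoint_family_on A {..n}"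
    unfolding disjoint_family_on_def
  proof (intro ballI impI)
    fix i j assume "i \<in> {..n}" "j \<in> {..n}" "i \<noteq> j"
    then consider "i < j" | "j < i" by linarith
    then show "A i \<inter> A j = {}" by cases (force simp: A_def)+
  qed
  have un: "{\<omega> \<in> space M. \<exists>k\<le>n. \<delta> < \<bar>S k \<omega>\<bar>} = (\<Union>k\<in>{..n}. A k)"
  proof (intro equalityI subsetI)
    fix \<omega> assume w: "\<omega> \<in> {\<omega> \<in> space M. \<exists>k\<le>n. \<delta> < \<bar>S k \<omega>\<bar>}"
    define k where "k = (LEAST k. \<delta> < \<bar>S k \<omega>\<bar>)"
    from w have "\<exists>k. \<delta> < \<bar>S k \<omega>\<bar>" by blast
    then have "\<delta> < \<bar>S k \<omega>\<bar>" unfolding k_def by (rule LeastI_ex)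
    moreover have "\<forall>j<k. \<bar>S j \<omega>\<bar> \<le> \<delta>" unfolding k_def using not_less_Least not_le by blast
    moreover have "k \<le> n" unfolding k_def using w by (auto intro: Least_le order_trans)
    ultimately show "\<omega> \<in> (\<Union>k\<in>{..n}. A k)" using w by (auto simp: A_def)
  qed (auto simp: A_def)
  have Ln: "L4 (S n)" by (rule L) simp
  have int: "integrable M (\<lambda>\<omega>. (S n \<omega>) ^ 4 * indicat_real (A k) \<omega>)" if "k \<le> n" for k
    using integrable_L4_powers(4)[OF Ln] A[OF that] by (rule integrable_real_mult_indicator[rotated])
  have step: "\<delta> ^ 4 * prob (A k) \<le> expectation (\<lambda>\<omega>. (S n \<omega>) ^ 4 * indicat_real (A k) \<omega>)" if k: "k \<le> n" for k
  proof -
    have Lk: "L4 (S k)" by (rule L[OF k])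
    have intk: "integrable M (\<lambda>\<omega>. (S k \<omega>) ^ 3 * indicat_real (A k) \<omega> * (S n \<omega> - S k \<omega>))"
      using integrable_real_mult_indicator[OF A[OF k] integrable_L4_cube_mult[OF Lk L4_diff[OF Ln Lk]]]
      by (simp add: mult_ac)
    have "\<delta> ^ 4 * prob (A k) = expectation (\<lambda>\<omega>. \<delta> ^ 4 * indicat_real (A k) \<omega> + 4 * ((S k \<omega>) ^ 3 * indicat_real (A k) \<omega> * (S n \<omega> - S k \<omega>)))"
      using intk A[OF k] orth[OF k] by (simp add: A_def[symmetric] emeasure_eq_measure)
    also have "\<dots> \<le> expectation (\<lambda>\<omega>. (S n \<omega>) ^ 4 * indicat_real (A k) \<omega>)"
    proof (rule integral_mono)
      fix \<omega> assume w: "\<omega> \<in> space M"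
      \<comment> \<open>The tangent line bound for the convex fourth power; its linear term is the
        one that vanishes by orthogonality.\<close>
      have conv: "x ^ 4 + 4 * (x ^ 3 * (y - x)) \<le> y ^ 4" for x y :: real
      proof -
        have "y ^ 4 - x ^ 4 - 4 * (x ^ 3 * (y - x)) = (y - x)\<^sup>2 * ((x + y)\<^sup>2 + 2 * x\<^sup>2)" by algebra
        also have "\<dots> \<ge> 0" by simp
        finally show ?thesis by simp
      qed
      show "\<delta> ^ 4 * indicat_real (A k) \<omega> + 4 * ((S k \<omega>) ^ 3 * indicat_real (A k) \<omega> * (S n \<omega> - S k \<omega>)) \<le> (S n \<omega>) ^ 4 * indicat_real (A k) \<omega>"
      proof (cases "\<omega> \<in> A k")
        case True
        then have "\<delta> ^ 4 \<le> \<bar>S k \<omega>\<bar> ^ 4" using d by (intro power_mono) (auto simp: A_def)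
        with conv[of "S k \<omega>" "S n \<omega>"] True show ?thesis by simp
      qed simp
    qed (use intk int[OF k] A[OF k] in \<open>auto simp: emeasure_eq_measure\<close>)
    finally show ?thesis .
  qed
  have "\<delta> ^ 4 * prob {\<omega> \<in> space M. \<exists>k\<le>n. \<delta> < \<bar>S k \<omega>\<bar>} = (\<Sum>k\<le>n. \<delta> ^ 4 * prob (A k))"
    unfolding un using A disj by (subst finite_measure_finite_Union) (auto simp: sum_distrib_left)
  also have "\<dots> \<le> (\<Sum>k\<le>n. expectation (\<lambda>\<omega>. (S n \<omega>) ^ 4 * indicat_real (A k) \<omega>))"
    by (intro sum_mono step) simp
  also have "\<dots> = expectation (\<lambda>\<omega>. \<Sum>k\<le>n. (S n \<omega>) ^ 4 * indicat_real (A k) \<omega>)"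
    using int by (intro Bochner_Integration.integral_sum[symmetric]) auto
  also have "\<dots> \<le> expectation (\<lambda>\<omega>. (S n \<omega>) ^ 4)"
  proof (rule integral_mono)
    fix \<omega>
    have "(\<Sum>k\<le>n. indicat_real (A k) \<omega>) = indicat_real (\<Union>k\<in>{..n}. A k) \<omega>"
      by (rule indicator_UN_disjoint[OF _ disj, symmetric]) simp
    then have "(\<Sum>k\<le>n. indicat_real (A k) \<omega>) \<le> 1" by (simp add: indicator_def)
    then show "(\<Sum>k\<le>n. (S n \<omega>) ^ 4 * indicat_real (A k) \<omega>) \<le> (S n \<omega>) ^ 4"
      unfolding sum_distrib_left[symmetric] by (intro mult_left_le) auto
  qed (rule Bochner_Integration.integrable_sum[OF int] integrable_L4_powers(4)[OF Ln]; simp)+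
  finally show ?thesis using d by (simp add: field_simps)
qed

text \<open>Induction on \<open>n\<close>. In the binomial expansion the terms with an odd power of
  one factor vanish, and the mixed term adds 6 n v^2 per step, which the square of \<open>n\<close>
  absorbs.\<close>

lemma indep_sum_moments:
  fixes U :: "nat \<Rightarrow> 'a \<Rightarrow> real"
  assumes ind: "indep_vars (\<lambda>_. borel) U UNIV" and L: "\<And>i. L4 (U i)"
    and mean: "\<And>i. expectation (U i) = 0" and var: "\<And>i. expectation (\<lambda>\<omega>. (U i \<omega>)\<^sup>2) = v"
    and m4: "\<And>i. expectation (\<lambda>\<omega>. (U i \<omega>) ^ 4) \<le> \<kappa>"
  shows "expectation (\<lambda>\<omega>. \<Sum>i<n. U i \<omega>) = 0"
    and "expectation (\<lambda>\<omega>. (\<Sum>i<n. U i \<omega>)\<^sup>2) = real n * v"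
    and "expectation (\<lambda>\<omega>. (\<Sum>i<n. U i \<omega>) ^ 4) \<le> real n * \<kappa> + 3 * (real n)\<^sup>2 * v\<^sup>2"
proof -
  define S where "S n \<omega> = (\<Sum>i<n. U i \<omega>)" for n \<omega>
  have LS: "L4 (S n)" for n unfolding S_def[abs_def] by (rule L4_sum[OF L])
  have iv: "indep_var borel (U n) borel (S n)" for n
  proof -
    have "indep_vars (\<lambda>_. borel) U (insert n {..<n})" by (rule indep_vars_subset[OF ind]) simp
    from indep_vars_sum[OF _ _ this] show ?thesis unfolding S_def[abs_def] by simp
  qed
  have prod: "expectation (\<lambda>\<omega>. (U n \<omega>) ^ p * (S n \<omega>) ^ q) = expectation (\<lambda>\<omega>. (U n \<omega>) ^ p) * expectation (\<lambda>\<omega>. (S n \<omega>) ^ q)"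
    if "integrable M (\<lambda>\<omega>. (U n \<omega>) ^ p)" "integrable M (\<lambda>\<omega>. (S n \<omega>) ^ q)" for n p q
  proof (rule indep_var_lebesgue_integral[OF _ that])
    show "indep_var borel (\<lambda>\<omega>. (U n \<omega>) ^ p) borel (\<lambda>\<omega>. (S n \<omega>) ^ q)"
      using indep_var_compose[OF iv[of n], of "\<lambda>x. x ^ p" borel "\<lambda>x. x ^ q" borel] by (simp add: comp_def)
  qed
  note iU = integrable_L4_powers[OF L] and iS = integrable_L4_powers[OF LS]
  have S_Suc: "S (Suc n) \<omega> = S n \<omega> + U n \<omega>" for n \<omega> by (simp add: S_def)
  have ES: "expectation (S n) = 0" for n
    unfolding S_def[abs_def] using iU(1) mean by simp
  have int_US: "integrable M (\<lambda>\<omega>. U n \<omega> * S n \<omega>)" for n by (rule integrable_L4_mult[OF L LS])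
  have ES2: "expectation (\<lambda>\<omega>. (S n \<omega>)\<^sup>2) = real n * v" for n
  proof (induction n)
    case (Suc n)
    have "(S (Suc n) \<omega>)\<^sup>2 = (S n \<omega>)\<^sup>2 + 2 * (U n \<omega> * S n \<omega>) + (U n \<omega>)\<^sup>2" for \<omega>
      unfolding S_Suc by (simp add: power2_sum)
    moreover have "expectation (\<lambda>\<omega>. U n \<omega> * S n \<omega>) = 0"
      using prod[of n 1 1] iU(1) iS(1) ES by simp
    ultimately show ?case using int_US iU(2) iS(2) var Suc by (simp add: algebra_simps)
  qed (simp add: S_def)
  have ES4: "expectation (\<lambda>\<omega>. (S n \<omega>) ^ 4) \<le> real n * \<kappa> + 3 * (real n)\<^sup>2 * v\<^sup>2" for n
  proof (induction n)
    case (Suc n)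
    have "(S (Suc n) \<omega>) ^ 4 = (S n \<omega>) ^ 4 + 4 * (U n \<omega> ^ 1 * S n \<omega> ^ 3) + 6 * ((U n \<omega>)\<^sup>2 * (S n \<omega>)\<^sup>2) + 4 * ((U n \<omega>) ^ 3 * S n \<omega> ^ 1) + (U n \<omega>) ^ 4" for \<omega>
      unfolding S_Suc by algebra
    moreover have "integrable M (\<lambda>\<omega>. U n \<omega> ^ 1 * S n \<omega> ^ 3)" "integrable M (\<lambda>\<omega>. (U n \<omega>) ^ 3 * S n \<omega> ^ 1)"
      using integrable_L4_cube_mult[OF LS L, of n n] integrable_L4_cube_mult[OF L LS, of n n] by (simp_all add: mult_ac)
    moreover have "integrable M (\<lambda>\<omega>. (U n \<omega>)\<^sup>2 * (S n \<omega>)\<^sup>2)"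
      using integrable_L4_mult4[OF L L LS LS, of n n n n] by (simp add: power2_eq_square mult_ac)
    moreover have "expectation (\<lambda>\<omega>. U n \<omega> ^ 1 * S n \<omega> ^ 3) = 0" "expectation (\<lambda>\<omega>. (U n \<omega>) ^ 3 * S n \<omega> ^ 1) = 0"
      using prod[of n 1 3] prod[of n 3 1] iU iS ES mean by simp_all
    moreover have "expectation (\<lambda>\<omega>. (U n \<omega>)\<^sup>2 * (S n \<omega>)\<^sup>2) = v * (real n * v)"
      using prod[of n 2 2] iU iS ES2 var by simp
    ultimately have "expectation (\<lambda>\<omega>. (S (Suc n) \<omega>) ^ 4) = expectation (\<lambda>\<omega>. (S n \<omega>) ^ 4) + 6 * (v * (real n * v)) + expectation (\<lambda>\<omega>. (U n \<omega>) ^ 4)"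
      using iU iS by simp
    also have "\<dots> \<le> (real n * \<kappa> + 3 * (real n)\<^sup>2 * v\<^sup>2) + 6 * (v * (real n * v)) + \<kappa>"
      using Suc m4[of n] by simp
    also have "\<dots> \<le> real (Suc n) * \<kappa> + 3 * (real (Suc n))\<^sup>2 * v\<^sup>2"
      by (simp add: power2_eq_square algebra_simps)
    finally show ?case .
  qed (simp add: S_def)
  show "expectation (\<lambda>\<omega>. \<Sum>i<n. U i \<omega>) = 0" "expectation (\<lambda>\<omega>. (\<Sum>i<n. U i \<omega>)\<^sup>2) = real n * v"
    "expectation (\<lambda>\<omega>. (\<Sum>i<n. U i \<omega>) ^ 4) \<le> real n * \<kappa> + 3 * (real n)\<^sup>2 * v\<^sup>2"
    using ES ES2 ES4 by (simp_all add: S_def[abs_def])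
qed

text \<open>A linear combination may be degenerate; for \<open>v = 0\<close> the variables vanish
  almost surely. Otherwise the central limit theorem is read off at the argument sqrt v.\<close>

lemma clt_char:
  fixes U :: "nat \<Rightarrow> 'a \<Rightarrow> real"
  assumes ind: "indep_vars (\<lambda>_. borel) U UNIV" and L: "\<And>i. L4 (U i)"
    and mean: "\<And>i. expectation (U i) = 0" and var: "\<And>i. expectation (\<lambda>\<omega>. (U i \<omega>)\<^sup>2) = v"
    and distr: "\<And>i. distr M borel (U i) = \<mu>"
  shows "(\<lambda>n. CLINT \<omega>|M. iexp ((\<Sum>i<n. U i \<omega>) / sqrt (real n))) \<longlonglongrightarrow> complex_of_real (exp (- v / 2))"
proof -
  have [measurable]: "U i \<in> borel_measurable M" for i using L by (rule L4_measurable)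
  have v0: "v \<ge> 0" using var[of 0] by (metis Bochner_Integration.integral_nonneg zero_le_power2)
  show ?thesis
  proof (cases "v = 0")
    case True
    have "AE \<omega> in M. U i \<omega> = 0" for i
    proof -
      have "AE \<omega> in M. (U i \<omega>)\<^sup>2 = 0"
        using integral_nonneg_eq_0_iff_AE[OF integrable_L4_powers(2)[OF L[of i]]] var[of i] True by simp
      then show ?thesis by simp
    qed
    then have "AE \<omega> in M. \<forall>i. U i \<omega> = 0" by (simp add: AE_all_countable)
    then have "(CLINT \<omega>|M. iexp ((\<Sum>i<n. U i \<omega>) / sqrt (real n))) = (CLINT \<omega>|M. 1)" for n
      by (intro integral_cong_AE) (auto elim!: eventually_mono)
    then show ?thesis using True by (simp add: prob_space)
  next
    case False
    with v0 have v: "v > 0" by simp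
    have "weak_conv_m (\<lambda>n. distr M borel (\<lambda>x. (\<Sum>i<n. U i x) / sqrt (real n * (sqrt v)\<^sup>2))) std_normal_distribution"
    proof (rule central_limit_theorem_zero_mean[OF ind mean _ _ _ distr])
      show "variance (U i) = (sqrt v)\<^sup>2" for i using v var mean by simp
      show "integrable M (\<lambda>x. (U i x)\<^sup>2)" for i by (rule integrable_L4_powers(2)[OF L])
    qed (use v in auto)
    then have "(\<lambda>n. char (distr M borel (\<lambda>x. (\<Sum>i<n. U i x) / sqrt (real n * (sqrt v)\<^sup>2))) (sqrt v)) \<longlonglongrightarrow> char std_normal_distribution (sqrt v)"
      by (intro levy_continuity1 real_dist_normal_dist real_distribution_distr) auto
    moreover have "char (distr M borel (\<lambda>x. (\<Sum>i<n. U i x) / sqrt (real n * (sqrt v)\<^sup>2))) (sqrt v) = (CLINT \<omega>|M. iexp ((\<Sum>i<n. U i \<omega>) / sqrt (real n)))" for n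
      unfolding char_def by (subst integral_distr) (use v in \<open>auto simp: real_sqrt_mult field_simps\<close>)
    ultimately show ?thesis using v by (simp add: char_std_normal_distribution)
  qed
qed

end

section \<open>The normalised martingale\<close>

locale levy_copies =
  fixes M :: "'a measure" and \<xi> :: "nat \<Rightarrow> real \<Rightarrow> 'a \<Rightarrow> real"
  assumes levy_all: "\<And>i. levy_process M (\<xi> i)"
    and copies: "\<And>i. distr M path_space (path_of (\<xi> i)) = distr M path_space (path_of (\<xi> 0))"
    and indep: "prob_space.indep_vars M (\<lambda>_. path_space) (\<lambda>i. path_of (\<xi> i)) UNIV"
    and expmom: "\<And>u. integrable M (\<lambda>\<omega>. exp (u * \<xi> 0 1 \<omega>))"
begin

sublocale L0: levy M "\<xi> 0"
  using levy_all expmom by unfold_locales auto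

abbreviation \<psi> :: "real \<Rightarrow> real" where "\<psi> \<equiv> L0.\<psi>"

lemma eval_path_space [measurable]: "t \<ge> 0 \<Longrightarrow> (\<lambda>x. x t) \<in> borel_measurable path_space"
  unfolding path_space_def by (rule measurable_component_singleton) simp

lemma path_of_apply [simp]: "t \<ge> 0 \<Longrightarrow> path_of X \<omega> t = X t \<omega>"
  by (simp add: path_of_def)

lemma path_of_measurable: "path_of (\<xi> i) \<in> measurable M path_space"
  using indep unfolding L0.indep_vars_def by auto

lemma distr_functional:
  assumes F: "F \<in> borel_measurable path_space"
  shows "distr M borel (\<lambda>\<omega>. F (path_of (\<xi> i) \<omega>)) = distr M borel (\<lambda>\<omega>. F (path_of (\<xi> 0) \<omega>))"
  using distr_distr[OF F path_of_measurable[of i]] distr_distr[OF F path_of_measurable[of 0]] copies[of i]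
  by (simp add: comp_def)

lemma indep_functional:
  assumes F: "F \<in> borel_measurable path_space"
  shows "L0.indep_vars (\<lambda>_. borel) (\<lambda>i \<omega>. F (path_of (\<xi> i) \<omega>)) UNIV"
  by (rule L0.indep_vars_compose2[OF indep]) (rule F)

lemma distr_marginal: "t \<ge> 0 \<Longrightarrow> distr M borel (\<xi> i t) = distr M borel (\<xi> 0 t)"
  using distr_functional[OF eval_path_space, of t i] by simp

lemma levy_i: "levy M (\<xi> i)"
proof
  show "levy_process M (\<xi> i)" by (rule levy_all)
  have [measurable]: "\<xi> i 1 \<in> borel_measurable M" "\<xi> 0 1 \<in> borel_measurable M"
    using levy_all unfolding levy_process_def by auto
  fix u
  have "integrable (distr M borel (\<xi> 0 1)) (\<lambda>x. exp (u * x))"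
    using expmom by (subst integrable_distr_eq) auto
  then have "integrable (distr M borel (\<xi> i 1)) (\<lambda>x. exp (u * x))" unfolding distr_marginal[of 1 i, OF zero_le_one] .
  then show "integrable M (\<lambda>\<omega>. exp (u * \<xi> i 1 \<omega>))" by (subst (asm) integrable_distr_eq) auto
qed

lemma psi_i: "levy.\<psi> M (\<xi> i) u = \<psi> u"
proof -
  interpret I: levy M "\<xi> i" by (rule levy_i)
  have [measurable]: "\<xi> i 1 \<in> borel_measurable M" "\<xi> 0 1 \<in> borel_measurable M" using I.meas L0.meas by auto
  have "(\<integral>\<omega>. exp (u * \<xi> i 1 \<omega>) \<partial>M) = (\<integral>x. exp (u * x) \<partial>distr M borel (\<xi> i 1))" by (subst integral_distr) auto
  also have "\<dots> = (\<integral>\<omega>. exp (u * \<xi> 0 1 \<omega>) \<partial>M)" unfolding distr_marginal[of 1 i, OF zero_le_one] by (subst integral_distr) auto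
  finally show ?thesis by (simp add: I.\<psi>_def L0.\<psi>_def)
qed

definition X :: "nat \<Rightarrow> real \<Rightarrow> 'a \<Rightarrow> real" where
  "X i t \<omega> = exp (\<xi> i t \<omega> - t * \<psi> 1)"

definition b :: real where "b = \<psi> 2 - 2 * \<psi> 1"

definition V :: "nat \<Rightarrow> real \<Rightarrow> 'a \<Rightarrow> real" where
  "V n t \<omega> = (\<Sum>i<n. X i t \<omega> - 1) / sqrt (real n)"

lemma \<xi>_meas: "t \<ge> 0 \<Longrightarrow> \<xi> i t \<in> borel_measurable M"
  using levy.meas[OF levy_i] .

lemma X_meas: "t \<ge> 0 \<Longrightarrow> X i t \<in> borel_measurable M"
  unfolding X_def[abs_def] using \<xi>_meas[of t i] by (auto intro!: borel_measurable_exp borel_measurable_diff)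

lemma V_meas: "t \<ge> 0 \<Longrightarrow> V n t \<in> borel_measurable M"
  unfolding V_def[abs_def] using X_meas
  by (intro borel_measurable_divide borel_measurable_sum borel_measurable_diff) auto

lemma V_cadlag:
  assumes "\<omega> \<in> space M" shows "cadlag_on {0..} (\<lambda>t. V n t \<omega>)"
proof -
  have c: "cadlag_on {0..} (\<lambda>t. - t * \<psi> 1)" "cadlag_on {0..} (\<lambda>_. - 1)" "cadlag_on {0..} (\<lambda>_. inverse (sqrt (real n)))"
    by (intro cadlag_on_continuous continuous_intros)+
  have "cadlag_on {0..} (\<lambda>t. inverse (sqrt (real n)) * (\<Sum>i<n. exp (\<xi> i t \<omega> + - t * \<psi> 1) + - 1))"
    by (intro cadlag_on_mult cadlag_on_sum cadlag_on_add cadlag_on_exp c levy.path[OF levy_i assms])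
  then show ?thesis by (simp add: V_def X_def divide_inverse mult.commute)
qed

lemma X_pow4: "(X i t \<omega>) ^ 4 = exp (- 4 * t * \<psi> 1) * exp (4 * \<xi> i t \<omega>)"
proof -
  have "exp y ^ 4 = exp (4 * y)" for y :: real using exp_of_nat_mult[of 4 y] by simp
  then show ?thesis unfolding X_def mult_exp_exp by (simp add: algebra_simps)
qed

lemma X_L4: "t \<ge> 0 \<Longrightarrow> L0.L4 (X i t)"
  unfolding L0.L4_def X_pow4 using X_meas levy.integrable_exp[OF levy_i, of t 4 i] by simp

lemma X_4th: "t \<ge> 0 \<Longrightarrow> L0.expectation (\<lambda>\<omega>. (X i t \<omega>) ^ 4) = exp (t * (\<psi> 4 - 4 * \<psi> 1))"
  unfolding X_pow4 using levy.expectation_exp[OF levy_i, of t 4 i]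
  unfolding integral_mult_right_zero psi_i[of i] by (simp add: mult_exp_exp) (simp add: algebra_simps)

lemma X_mean: "t \<ge> 0 \<Longrightarrow> L0.expectation (X i t) = 1"
proof -
  assume t: "t \<ge> 0"
  have "L0.expectation (X i t) = L0.expectation (\<lambda>\<omega>. exp (- t * \<psi> 1) * exp (1 * \<xi> i t \<omega>))"
    by (intro Bochner_Integration.integral_cong) (simp_all add: X_def mult_exp_exp)
  also have "\<dots> = 1"
    unfolding integral_mult_right_zero levy.expectation_exp[OF levy_i t] psi_i[of i] by (simp add: exp_minus)
  finally show ?thesis .
qed

text \<open>By independence and the normalisation, the later increment contributes the factor 1, so
  only the second moment at the earlier time remains.\<close>

lemma X_prod:
  assumes "s \<ge> 0" "t \<ge> 0" shows "L0.expectation (\<lambda>\<omega>. X i s \<omega> * X i t \<omega>) = exp (b * min s t)"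
proof -
  have *: "L0.expectation (\<lambda>\<omega>. X i s \<omega> * X i t \<omega>) = exp (b * s)" if "0 \<le> s" "s \<le> t" for s t
  proof -
    have "L0.expectation (\<lambda>\<omega>. X i s \<omega> * X i t \<omega>) =
      L0.expectation (\<lambda>\<omega>. exp (- (s + t) * \<psi> 1) * exp (2 * \<xi> i s \<omega> + 1 * (\<xi> i t \<omega> - \<xi> i s \<omega>)))"
      by (intro Bochner_Integration.integral_cong refl)
         (simp add: X_def mult_exp_exp, simp add: algebra_simps)
    also have "\<dots> = exp (b * s)"
      unfolding integral_mult_right_zero levy.expectation_exp_two(2)[OF levy_i that] psi_i[of i]
      by (simp add: b_def mult_exp_exp) (simp add: algebra_simps)
    finally show ?thesis .
  qed
  show ?thesis
  proof (cases "s \<le> t")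
    case True with *[of s t] assms show ?thesis by simp
  next
    case False
    with *[of t s] assms show ?thesis by (simp add: mult.commute)
  qed
qed

lemma X_centered_prod:
  assumes "s \<ge> 0" "t \<ge> 0"
  shows "integrable M (\<lambda>\<omega>. (X i s \<omega> - 1) * (X i t \<omega> - 1))"
    and "L0.expectation (\<lambda>\<omega>. (X i s \<omega> - 1) * (X i t \<omega> - 1)) = exp (b * min s t) - 1"
proof -
  show "integrable M (\<lambda>\<omega>. (X i s \<omega> - 1) * (X i t \<omega> - 1))"
    by (intro L0.integrable_L4_mult L0.L4_diff X_L4 L0.L4_const assms)
  have "L0.expectation (\<lambda>\<omega>. (X i s \<omega> - 1) * (X i t \<omega> - 1)) =
    L0.expectation (\<lambda>\<omega>. X i s \<omega> * X i t \<omega> - X i s \<omega> - X i t \<omega> + 1)"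
    by (intro Bochner_Integration.integral_cong) (auto simp: algebra_simps)
  also have "\<dots> = exp (b * min s t) - 1"
    using L0.integrable_L4_mult[OF X_L4[OF assms(1)] X_L4[OF assms(2)], of i i]
      L0.integrable_L4_powers(1)[OF X_L4[OF assms(1)], of i] L0.integrable_L4_powers(1)[OF X_L4[OF assms(2)], of i]
    by (simp add: X_prod[OF assms] X_mean assms L0.prob_space)
  finally show "L0.expectation (\<lambda>\<omega>. (X i s \<omega> - 1) * (X i t \<omega> - 1)) = exp (b * min s t) - 1" .
qed

text \<open>exp b - 1 is the second moment of \<open>X 0 1 - 1\<close>.\<close>

lemma b_nonneg: "b \<ge> 0"
proof -
  have "0 \<le> L0.expectation (\<lambda>\<omega>. (X 0 1 \<omega> - 1) * (X 0 1 \<omega> - 1))"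
    by (rule Bochner_Integration.integral_nonneg) simp
  then show ?thesis using X_centered_prod(2)[of 1 1 0] by simp
qed

lemma linear_functional_measurable:
  fixes tt :: "nat \<Rightarrow> real"
  assumes "\<And>j. j \<in> J \<Longrightarrow> tt j \<ge> 0"
  shows "(\<lambda>x. \<Sum>j\<in>J. c j * (exp (x (tt j) - tt j * \<psi> 1) - 1)) \<in> borel_measurable path_space"
  using assms by (intro borel_measurable_sum borel_measurable_times borel_measurable_diff borel_measurable_exp eval_path_space) auto

text \<open>A linear combination of values at several times is one functional of the path of a copy,
  so over the copies it is a scalar i.i.d. sequence. This reduces joint convergence to the scalar
  central limit theorem and also covers increments.\<close>

lemma linear_functional_iid:
  fixes tt c :: "nat \<Rightarrow> real"
  assumes tt: "\<And>j. j \<in> J \<Longrightarrow> tt j \<ge> 0"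
  defines "U \<equiv> \<lambda>i \<omega>. \<Sum>j\<in>J. c j * (X i (tt j) \<omega> - 1)"
  shows "L0.indep_vars (\<lambda>_. borel) U UNIV" and "distr M borel (U i) = distr M borel (U 0)"
    and "L0.L4 (U i)" and "L0.expectation (U i) = 0"
    and "L0.expectation (\<lambda>\<omega>. (U i \<omega>)\<^sup>2) = (\<Sum>k\<in>J. \<Sum>j\<in>J. c k * c j * (exp (b * min (tt k) (tt j)) - 1))"
proof -
  note F = linear_functional_measurable[of J tt c, OF tt]
  show "L0.indep_vars (\<lambda>_. borel) U UNIV"
    using indep_functional[OF F] unfolding U_def by (simp add: X_def tt)
  show "distr M borel (U i) = distr M borel (U 0)"
    using distr_functional[OF F, of i] unfolding U_def by (simp add: X_def tt)
  show "L0.L4 (U i)" unfolding U_def using tt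
    by (intro L0.L4_sum L0.L4_cmult L0.L4_diff X_L4 L0.L4_const)
  have "integrable M (X i (tt j))" if "j \<in> J" for j
    using tt[OF that] by (intro L0.integrable_L4_powers(1) X_L4)
  then show "L0.expectation (U i) = 0" unfolding U_def using tt
    by (subst Bochner_Integration.integral_sum) (auto simp: X_mean L0.prob_space)
  have "L0.expectation (\<lambda>\<omega>. (U i \<omega>)\<^sup>2) = L0.expectation (\<lambda>\<omega>. \<Sum>k\<in>J. \<Sum>j\<in>J. c k * c j * ((X i (tt k) \<omega> - 1) * (X i (tt j) \<omega> - 1)))"
    unfolding U_def power2_eq_square sum_product by (simp add: mult_ac)
  also have "\<dots> = (\<Sum>k\<in>J. \<Sum>j\<in>J. c k * c j * (exp (b * min (tt k) (tt j)) - 1))"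
    using tt X_centered_prod by (simp add: Bochner_Integration.integral_sum Bochner_Integration.integrable_sum)
  finally show "L0.expectation (\<lambda>\<omega>. (U i \<omega>)\<^sup>2) = (\<Sum>k\<in>J. \<Sum>j\<in>J. c k * c j * (exp (b * min (tt k) (tt j)) - 1))" .
qed

lemma fdd_char:
  fixes tt c :: "nat \<Rightarrow> real"
  assumes J: "finite J" and tt: "\<And>j. j \<in> J \<Longrightarrow> tt j \<ge> 0"
  shows "(\<lambda>n. CLINT \<omega>|M. iexp (\<Sum>j\<in>J. c j * V n (tt j) \<omega>)) \<longlonglongrightarrow>
    complex_of_real (exp (- (\<Sum>k\<in>J. \<Sum>j\<in>J. c k * c j * (exp (b * min (tt k) (tt j)) - 1)) / 2))"
proof -
  note iid = linear_functional_iid[of J tt c, OF tt]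
  have "(\<Sum>j\<in>J. c j * V n (tt j) \<omega>) = (\<Sum>i<n. \<Sum>j\<in>J. c j * (X i (tt j) \<omega> - 1)) / sqrt (real n)" for n \<omega>
    unfolding V_def by (subst sum.swap) (simp add: sum_distrib_left sum_divide_distrib)
  then show ?thesis
    using L0.clt_char[OF iid(1) iid(3) iid(4) iid(5) iid(2)] by simp
qed

lemma increment_4th_moment:
  assumes s: "0 \<le> s" "s \<le> t" "t \<le> T" and n: "n > 0"
  shows "L0.expectation (\<lambda>\<omega>. (V n t \<omega> - V n s \<omega>) ^ 4)
    \<le> 16 * exp (T * \<bar>\<psi> 4 - 4 * \<psi> 1\<bar>) / n + 3 * (b * exp (b * T) * (t - s))\<^sup>2"
proof -
  \<comment> \<open>The increment is written as a combination with coefficients 1 and -1, in which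
    the centrings cancel.\<close>
  define U where "U i \<omega> = (\<Sum>j\<in>{0, 1::nat}. (if j = 0 then 1 else - 1) * (X i (if j = 0 then t else s) \<omega> - 1))" for i \<omega>
  have U: "U i \<omega> = X i t \<omega> - X i s \<omega>" for i \<omega> by (simp add: U_def)
  have t0: "t \<ge> 0" using s by simp
  note iid = linear_functional_iid[of "{0, 1}" "\<lambda>j::nat. if j = 0 then t else s" "\<lambda>j. if j = 0 then 1 else - 1", folded U_def[abs_def]]
  have iid1: "L0.indep_vars (\<lambda>_. borel) U UNIV" "\<And>i. L0.L4 (U i)" "\<And>i. L0.expectation (U i) = 0"
    using iid(1) iid(3,4) s t0 by (auto simp: U_def[abs_def])
  define v where "v = exp (b * t) - exp (b * s)"
  have v: "L0.expectation (\<lambda>\<omega>. (U i \<omega>)\<^sup>2) = v" for i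
    using iid(5)[of i] s t0 by (simp add: v_def min_def U_def split: if_splits)
  define E where "E = exp (T * \<bar>\<psi> 4 - 4 * \<psi> 1\<bar>)"
  have m4: "L0.expectation (\<lambda>\<omega>. (U i \<omega>) ^ 4) \<le> 16 * E" for i
  proof -
    have le: "exp (r * (\<psi> 4 - 4 * \<psi> 1)) \<le> E" if "0 \<le> r" "r \<le> T" for r
    proof -
      have "r * (\<psi> 4 - 4 * \<psi> 1) \<le> r * \<bar>\<psi> 4 - 4 * \<psi> 1\<bar>" using that by (intro mult_left_mono) auto
      also have "\<dots> \<le> T * \<bar>\<psi> 4 - 4 * \<psi> 1\<bar>" using that by (intro mult_right_mono) auto
      finally show ?thesis by (simp add: E_def)
    qed
    have i4: "integrable M (\<lambda>\<omega>. (X i t \<omega>) ^ 4)" "integrable M (\<lambda>\<omega>. (X i s \<omega>) ^ 4)"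
      using X_L4 s t0 by (auto intro: L0.integrable_L4_powers(4))
    have "(x - y) ^ 4 \<le> 8 * x ^ 4 + 8 * (y::real) ^ 4" for x y
    proof -
      have "8 * x ^ 4 + 8 * y ^ 4 - (x - y) ^ 4 = (x + y) ^ 4 + 6 * (x\<^sup>2 - y\<^sup>2)\<^sup>2" by algebra
      also have "\<dots> \<ge> 0" by simp
      finally show ?thesis by simp
    qed
    then have "L0.expectation (\<lambda>\<omega>. (U i \<omega>) ^ 4) \<le> L0.expectation (\<lambda>\<omega>. 8 * (X i t \<omega>) ^ 4 + 8 * (X i s \<omega>) ^ 4)"
      using i4 L0.integrable_L4_powers(4)[OF iid1(2)] unfolding U by (intro integral_mono) auto
    also have "\<dots> = 8 * exp (t * (\<psi> 4 - 4 * \<psi> 1)) + 8 * exp (s * (\<psi> 4 - 4 * \<psi> 1))"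
      using i4 s t0 by (simp add: X_4th)
    also have "\<dots> \<le> 16 * E" using le[of t] le[of s] s t0 by simp
    finally show ?thesis .
  qed
  have "V n t \<omega> - V n s \<omega> = (\<Sum>i<n. U i \<omega>) / sqrt (real n)" for \<omega>
    unfolding V_def U diff_divide_distrib[symmetric] sum_subtractf[symmetric] by simp
  moreover have "sqrt (real n) ^ 4 = (real n)\<^sup>2"
  proof -
    have "sqrt (real n) ^ 4 = ((sqrt (real n))\<^sup>2)\<^sup>2" unfolding power_mult[symmetric] by simp
    then show ?thesis by simp
  qed
  ultimately have "L0.expectation (\<lambda>\<omega>. (V n t \<omega> - V n s \<omega>) ^ 4) = L0.expectation (\<lambda>\<omega>. (\<Sum>i<n. U i \<omega>) ^ 4) / (real n)\<^sup>2"
    by (simp add: power_divide)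
  also have "\<dots> \<le> (real n * (16 * E) + 3 * (real n)\<^sup>2 * v\<^sup>2) / (real n)\<^sup>2"
    by (intro divide_right_mono L0.indep_sum_moments(3)[OF iid1 v m4]) auto
  also have "\<dots> = 16 * E / n + 3 * v\<^sup>2" using n by (simp add: field_simps power2_eq_square)
  also have "v\<^sup>2 \<le> (b * exp (b * T) * (t - s))\<^sup>2"
  proof (rule power_mono)
    have "b * s \<le> b * t" using b_nonneg s by (intro mult_left_mono) auto
    then show "0 \<le> v" by (simp add: v_def)
    \<comment> \<open>Gives exp (b t) - exp (b s) at most b exp (b t) (t - s), the linear modulus
      whose square is the h^2 term.\<close>
    have "1 + b * (s - t) \<le> exp (b * (s - t))" by (rule exp_ge_add_one_self)
    then have "exp (b * t) * (1 - exp (b * (s - t))) \<le> exp (b * t) * (b * (t - s))"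
      by (intro mult_left_mono) (auto simp: algebra_simps)
    moreover have "exp (b * t) * exp (b * (s - t)) = exp (b * s)"
      unfolding mult_exp_exp by (simp add: algebra_simps)
    moreover have "exp (b * t) * (b * (t - s)) \<le> exp (b * T) * (b * (t - s))"
      using b_nonneg s by (intro mult_right_mono) (auto intro: mult_left_mono)
    ultimately show "v \<le> b * exp (b * T) * (t - s)"
      unfolding v_def right_diff_distrib by (simp add: mult_ac)
  qed
  finally show ?thesis by (simp add: E_def)
qed

text \<open>The two kinds of independence are combined: conditions on one row form an event
  \<open>B i\<close> of the path of copy \<open>i\<close>, so probabilities factor over copies first
  and then, by independent increments, within each row.\<close>

lemma grid_increments_indep:
  assumes h: "h > 0" and N: "N > 0" and n: "n > 0"
  shows "L0.indep_vars (\<lambda>_. borel) (\<lambda>p \<omega>. \<xi> (fst p) (h * real (Suc (snd p))) \<omega> - \<xi> (fst p) (h * real (snd p)) \<omega>) ({..<N} \<times> {..<n::nat})"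
proof -
  let ?D = "\<lambda>p \<omega>. \<xi> (fst p) (h * real (Suc (snd p))) \<omega> - \<xi> (fst p) (h * real (snd p)) \<omega>"
  have Dm: "?D p \<in> borel_measurable M" for p
    using h by (intro borel_measurable_diff \<xi>_meas) auto
  have sets_borel: "sets (borel :: real measure) = sigma_sets (space borel) (sets borel)"
    by (metis sets.sigma_sets_eq)
  show ?thesis
  proof (subst L0.indep_vars_finite[where E = "\<lambda>_. sets borel"])
    show "\<forall>A\<in>{..<N} \<times> {..<n} \<rightarrow> sets borel. L0.prob (\<Inter>p\<in>{..<N} \<times> {..<n}. ?D p -` A p \<inter> space M) =
      (\<Prod>p\<in>{..<N} \<times> {..<n}. L0.prob (?D p -` A p \<inter> space M))"
    proof
      fix A assume A: "A \<in> {..<N} \<times> {..<n} \<rightarrow> sets (borel :: real measure)"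
      define B where "B i = {x \<in> space path_space. \<forall>l\<in>{..<n}. x (h * real (Suc l)) - x (h * real l) \<in> A (i, l)}" for i
      have [measurable]: "(\<lambda>x. x (h * real l)) \<in> borel_measurable path_space" for l
        using h by (intro eval_path_space) auto
      have Bm: "B i \<in> sets path_space" if "i < N" for i
        unfolding B_def
      proof (rule sets.sets_Collect_finite_All)
        fix l assume "l \<in> {..<n}"
        with A that have [measurable]: "A (i, l) \<in> sets borel" by auto
        show "{x \<in> space path_space. x (h * real (Suc l)) - x (h * real l) \<in> A (i, l)} \<in> sets path_space" by measurable
      qed simp
      have eq: "path_of (\<xi> i) -` B i \<inter> space M = (\<Inter>l\<in>{..<n}. ?D (i, l) -` A (i, l) \<inter> space M)" for i
        using n h measurable_space[OF path_of_measurable[of i]] by (auto simp: B_def)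
      have row: "L0.prob (path_of (\<xi> i) -` B i \<inter> space M) = (\<Prod>l<n. L0.prob (?D (i, l) -` A (i, l) \<inter> space M))" if "i < N" for i
      proof -
        interpret I: levy M "\<xi> i" by (rule levy_i)
        have "L0.indep_vars (\<lambda>_. borel) (\<lambda>k \<omega>. \<xi> i (h * real (Suc k)) \<omega> - \<xi> i (h * real k) \<omega>) {..<n}"
          by (rule I.indep_increments) (use h in \<open>auto simp: strict_mono_def\<close>)
        from L0.indep_varsD_finite[OF this, of "\<lambda>l. A (i, l)"] show ?thesis
          unfolding eq using n A that by (auto simp: Pi_iff)
      qed
      have "(\<Inter>p\<in>{..<N} \<times> {..<n}. ?D p -` A p \<inter> space M) = (\<Inter>i\<in>{..<N}. path_of (\<xi> i) -` B i \<inter> space M)"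
        unfolding eq using n N by auto
      also have "L0.prob \<dots> = (\<Prod>i<N. L0.prob (path_of (\<xi> i) -` B i \<inter> space M))"
        by (rule L0.indep_varsD[OF indep]) (use N Bm in auto)
      also have "\<dots> = (\<Prod>i<N. \<Prod>l<n. L0.prob (?D (i, l) -` A (i, l) \<inter> space M))"
        by (intro prod.cong row) auto
      also have "\<dots> = (\<Prod>p\<in>{..<N} \<times> {..<n}. L0.prob (?D p -` A p \<inter> space M))"
        by (simp add: prod.cartesian_product split_beta)
      finally show "L0.prob (\<Inter>p\<in>{..<N} \<times> {..<n}. ?D p -` A p \<inter> space M) = (\<Prod>p\<in>{..<N} \<times> {..<n}. L0.prob (?D p -` A p \<inter> space M))" .
    qed
  qed (use N n Dm sets_borel in \<open>auto simp: sets.Int_stable intro: sets.sets_into_space\<close>)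
qed

text \<open>\<open>X\<close> is written as a function of the increment array so that the independence of past and future
  blocks of increments applies.\<close>

definition X_grid :: "real \<Rightarrow> nat \<Rightarrow> nat \<Rightarrow> (nat \<times> nat \<Rightarrow> real) \<Rightarrow> real" where
  "X_grid h i k d = exp ((\<Sum>l<k. d (i, l)) - h * real k * \<psi> 1)"

definition increments :: "real \<Rightarrow> nat \<times> nat \<Rightarrow> 'a \<Rightarrow> real" where
  "increments h p \<omega> = \<xi> (fst p) (h * real (Suc (snd p))) \<omega> - \<xi> (fst p) (h * real (snd p)) \<omega>"

lemma X_grid_increments:
  assumes "h > 0" "\<omega> \<in> space M" "\<And>l. l < k \<Longrightarrow> (i, l) \<in> P"
  shows "X_grid h i k (restrict (\<lambda>p. increments h p \<omega>) P) = X i (h * real k) \<omega>"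
proof -
  have "(\<Sum>l<k. restrict (\<lambda>p. increments h p \<omega>) P (i, l)) = (\<Sum>l<k. \<xi> i (h * real (Suc l)) \<omega> - \<xi> i (h * real l) \<omega>)"
    using assms(3) by (intro sum.cong) (auto simp: increments_def)
  also have "\<dots> = \<xi> i (h * real k) \<omega> - \<xi> i (h * real 0) \<omega>" by (rule sum_lessThan_telescope)
  also have "\<xi> i (h * real 0) \<omega> = 0" using levy.start[OF levy_i assms(2), of i] by simp
  finally show ?thesis by (simp add: X_grid_def X_def)
qed

lemma X_grid_measurable:
  assumes "\<And>l. l < k \<Longrightarrow> (i, l) \<in> P"
  shows "X_grid h i k \<in> borel_measurable (PiM P (\<lambda>_. borel))"
proof -
  have "(\<lambda>d. \<Sum>l<k. d (i, l)) \<in> borel_measurable (PiM P (\<lambda>_. borel :: real measure))"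
    by (intro borel_measurable_sum measurable_component_singleton) (use assms in auto)
  then show ?thesis unfolding X_grid_def[abs_def] by measurable
qed

text \<open>The exponential is the ratio of \<open>X i\<close> at two grid times, which has mean 1
  by stationarity of the increments.\<close>

lemma future_factor_mean:
  assumes "h > 0" "k \<le> e"
  shows "integrable M (\<lambda>\<omega>. exp ((\<Sum>l\<in>{k..<e}. increments h (i, l) \<omega>) - h * real (e - k) * \<psi> 1) - 1)"
    and "L0.expectation (\<lambda>\<omega>. exp ((\<Sum>l\<in>{k..<e}. increments h (i, l) \<omega>) - h * real (e - k) * \<psi> 1) - 1) = 0"
proof -
  interpret I: levy M "\<xi> i" by (rule levy_i)
  have s: "0 \<le> h * real k" "h * real k \<le> h * real e" using assms by auto
  have "(\<Sum>l\<in>{k..<e}. increments h (i, l) \<omega>) = \<xi> i (h * real e) \<omega> - \<xi> i (h * real k) \<omega>" for \<omega>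
    unfolding increments_def fst_conv snd_conv using assms(2)
    by (rule sum_Suc_diff'[where f = "\<lambda>l. \<xi> i (h * real l) \<omega>"])
  then have eq: "exp ((\<Sum>l\<in>{k..<e}. increments h (i, l) \<omega>) - h * real (e - k) * \<psi> 1) =
    exp (- (h * real (e - k) * \<psi> 1)) * exp (1 * (\<xi> i (h * real e) \<omega> - \<xi> i (h * real k) \<omega>))" for \<omega>
    unfolding mult_exp_exp by simp
  note E = I.expectation_exp_increment[OF s, of 1]
  show "integrable M (\<lambda>\<omega>. exp ((\<Sum>l\<in>{k..<e}. increments h (i, l) \<omega>) - h * real (e - k) * \<psi> 1) - 1)"
    unfolding eq by (intro Bochner_Integration.integrable_diff integrable_mult_right E(1)) simp
  have "L0.expectation (\<lambda>\<omega>. exp ((\<Sum>l\<in>{k..<e}. increments h (i, l) \<omega>) - h * real (e - k) * \<psi> 1) - 1) =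
    exp (- (h * real (e - k) * \<psi> 1)) * exp ((h * real e - h * real k) * \<psi> 1) - 1"
    unfolding eq using E by (simp add: psi_i[of i] L0.prob_space)
  also have "\<dots> = 0" unfolding mult_exp_exp using assms(2) by (simp add: of_nat_diff algebra_simps)
  finally show "L0.expectation (\<lambda>\<omega>. exp ((\<Sum>l\<in>{k..<e}. increments h (i, l) \<omega>) - h * real (e - k) * \<psi> 1) - 1) = 0" .
qed

lemma V_L4: "t \<ge> 0 \<Longrightarrow> L0.L4 (V n t)"
proof -
  assume t: "t \<ge> 0"
  have "V n t = (\<lambda>\<omega>. inverse (sqrt (real n)) * (\<Sum>i<n. X i t \<omega> - 1))" by (auto simp: V_def divide_inverse mult.commute)
  then show ?thesis using t by (auto intro!: L0.L4_cmult L0.L4_sum L0.L4_diff X_L4 L0.L4_const)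
qed

text \<open>Each summand of \<open>S n - S k\<close> is \<open>X i\<close> at the present grid time
  times a centred factor of future increments. The present value joins the cube and the
  first-passage indicator as a function of the past, and independence of the two blocks makes every
  product centred.\<close>

lemma V_orthogonal:
  fixes a N k n :: nat
  assumes h: "h > 0" and k: "k \<le> n"
  defines "S \<equiv> \<lambda>k \<omega>. V N (h * real (a + k)) \<omega> - V N (h * real a) \<omega>"
  shows "L0.expectation (\<lambda>\<omega>. (S k \<omega>) ^ 3 * indicat_real {\<omega> \<in> space M. \<delta> < \<bar>S k \<omega>\<bar> \<and> (\<forall>j<k. \<bar>S j \<omega>\<bar> \<le> \<delta>)} \<omega> * (S n \<omega> - S k \<omega>)) = 0"
\<comment> \<open>In both cases the difference \<open>S n - S k\<close> is 0; otherwise the future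
  block is non-empty.\<close>
proof (cases "k = n \<or> N = 0")
  case True
  then show ?thesis by (auto simp: S_def V_def)
next
  case False
  then have kn: "k < n" and N: "N > 0" using k by auto
  define A where "A = {\<omega> \<in> space M. \<delta> < \<bar>S k \<omega>\<bar> \<and> (\<forall>j<k. \<bar>S j \<omega>\<bar> \<le> \<delta>)}"
  define e where "e = a + n"
  define P where "P = {..<N} \<times> {..<a + k}"
  define F where "F = {..<N} \<times> {a + k..<e}"
  define Sg where "Sg j d = (\<Sum>i<N. X_grid h i (a + j) d - 1) / sqrt (real N) - (\<Sum>i<N. X_grid h i a d - 1) / sqrt (real N)" for j d
  define R where "R i d = exp ((\<Sum>l\<in>{a + k..<e}. d (i, l)) - h * real (e - (a + k)) * \<psi> 1) - 1" for i and d :: "nat \<times> nat \<Rightarrow> real"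
  define G where "G i d = (Sg k d) ^ 3 * (if \<delta> < \<bar>Sg k d\<bar> \<and> (\<forall>j\<in>{..<k}. \<bar>Sg j d\<bar> \<le> \<delta>) then 1 else 0) * X_grid h i (a + k) d" for i d
  let ?past = "\<lambda>\<omega>. restrict (\<lambda>p. increments h p \<omega>) P" and ?fut = "\<lambda>\<omega>. restrict (\<lambda>p. increments h p \<omega>) F"
  have pos: "h * real j \<ge> 0" for j using h by simp
  have LS: "L0.L4 (S j)" for j unfolding S_def by (intro L0.L4_diff V_L4 pos)
  have Am: "A \<in> sets M"
  proof -
    have "A = {\<omega> \<in> space M. \<delta> < \<bar>S k \<omega>\<bar>} \<inter> {\<omega> \<in> space M. \<forall>j\<in>{..<k}. \<bar>S j \<omega>\<bar> \<le> \<delta>}" by (auto simp: A_def)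
    also have "\<dots> \<in> sets M" using L0.L4_measurable[OF LS]
      by (intro sets.Int sets.sets_Collect_finite_All borel_measurable_less borel_measurable_le) auto
    finally show ?thesis .
  qed
  have Xg: "X_grid h i j (?past \<omega>) = X i (h * real j) \<omega>" if "\<omega> \<in> space M" "i < N" "j \<le> a + k" for i j \<omega>
    by (rule X_grid_increments[OF h that(1)]) (use that in \<open>auto simp: P_def\<close>)
  have Sgp: "Sg j (?past \<omega>) = S j \<omega>" if "\<omega> \<in> space M" "j \<le> k" for j \<omega>
    using that by (simp add: Sg_def S_def V_def Xg)
  have Gp: "G i (?past \<omega>) = (S k \<omega>) ^ 3 * indicat_real A \<omega> * X i (h * real (a + k)) \<omega>" if "\<omega> \<in> space M" "i < N" for i \<omega>
    using that by (auto simp: G_def Sgp Xg A_def indicator_def)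
  have ind: "L0.indep_vars (\<lambda>_. borel) (increments h) ({..<N} \<times> {..<e})"
    using grid_increments_indep[OF h N, of e] kn unfolding increments_def[abs_def] e_def by simp
  have pf: "L0.indep_var (PiM P (\<lambda>_. borel)) ?past (PiM F (\<lambda>_. borel)) ?fut"
    by (rule L0.indep_var_restrict[OF ind]) (use kn in \<open>auto simp: P_def F_def e_def\<close>)
  have Xm[measurable]: "X_grid h i j \<in> borel_measurable (PiM P (\<lambda>_. borel))" if "i < N" "j \<le> a + k" for i j
    by (rule X_grid_measurable) (use that in \<open>auto simp: P_def\<close>)
  have Sgm[measurable]: "Sg j \<in> borel_measurable (PiM P (\<lambda>_. borel))" if "j \<le> k" for j
    unfolding Sg_def[abs_def] using that
    by (intro borel_measurable_diff borel_measurable_divide borel_measurable_sum borel_measurable_const Xm) auto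
  have Gm: "G i \<in> borel_measurable (PiM P (\<lambda>_. borel))" if "i < N" for i
  proof -
    have "Measurable.pred (PiM P (\<lambda>_. borel)) (\<lambda>d. \<bar>Sg j d\<bar> \<le> \<delta>)" if "j \<le> k" for j
    proof -
      have [measurable]: "Sg j \<in> borel_measurable (PiM P (\<lambda>_. borel))" by (rule Sgm[OF that])
      show ?thesis by measurable
    qed
    then have [measurable]: "Measurable.pred (PiM P (\<lambda>_. borel)) (\<lambda>d. \<forall>j\<in>{..<k}. \<bar>Sg j d\<bar> \<le> \<delta>)"
      by (intro pred_intros_finite) auto
    have [measurable]: "Sg k \<in> borel_measurable (PiM P (\<lambda>_. borel))" "X_grid h i (a + k) \<in> borel_measurable (PiM P (\<lambda>_. borel))"
      using Sgm[of k] Xm[OF that, of "a + k"] by auto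
    show ?thesis unfolding G_def[abs_def] by measurable
  qed
  have Rm: "R i \<in> borel_measurable (PiM F (\<lambda>_. borel))" if "i < N" for i
  proof -
    have "(\<lambda>d. \<Sum>l\<in>{a + k..<e}. d (i, l)) \<in> borel_measurable (PiM F (\<lambda>_. borel :: real measure))"
      by (intro borel_measurable_sum measurable_component_singleton) (use that in \<open>auto simp: F_def\<close>)
    then show ?thesis unfolding R_def[abs_def] by measurable
  qed
  have Rf: "R i (?fut \<omega>) = exp ((\<Sum>l\<in>{a + k..<e}. increments h (i, l) \<omega>) - h * real (e - (a + k)) * \<psi> 1) - 1" if "i < N" for i \<omega>
    using that by (simp add: R_def F_def)
  have ke: "a + k \<le> e" using kn by (simp add: e_def)
  have term0: "integrable M (\<lambda>\<omega>. G i (?past \<omega>) * R i (?fut \<omega>))" "L0.expectation (\<lambda>\<omega>. G i (?past \<omega>) * R i (?fut \<omega>)) = 0" if i: "i < N" for i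
  proof -
    have iv: "L0.indep_var borel (\<lambda>\<omega>. G i (?past \<omega>)) borel (\<lambda>\<omega>. R i (?fut \<omega>))"
      using L0.indep_var_compose[OF pf Gm[OF i] Rm[OF i]] by (simp add: comp_def)
    have "integrable M (\<lambda>\<omega>. (S k \<omega>) ^ 3 * indicat_real A \<omega> * X i (h * real (a + k)) \<omega>)"
      using integrable_real_mult_indicator[OF Am L0.integrable_L4_cube_mult[OF LS X_L4[OF pos]], of k i "a + k"]
      by (simp add: mult_ac)
    then have int1: "integrable M (\<lambda>\<omega>. G i (?past \<omega>))"
      by (rule Bochner_Integration.integrable_cong[THEN iffD1, rotated -1]) (use Gp i in auto)
    have int2: "integrable M (\<lambda>\<omega>. R i (?fut \<omega>))" "L0.expectation (\<lambda>\<omega>. R i (?fut \<omega>)) = 0"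
      unfolding Rf[OF i] using future_factor_mean[OF h ke] by auto
    show "integrable M (\<lambda>\<omega>. G i (?past \<omega>) * R i (?fut \<omega>))"
      by (rule L0.indep_var_integrable[OF iv int1 int2(1)])
    show "L0.expectation (\<lambda>\<omega>. G i (?past \<omega>) * R i (?fut \<omega>)) = 0"
      using L0.indep_var_lebesgue_integral[OF iv int1 int2(1)] int2(2) by simp
  qed
  have "(S k \<omega>) ^ 3 * indicat_real A \<omega> * (S n \<omega> - S k \<omega>) = (\<Sum>i<N. G i (?past \<omega>) * R i (?fut \<omega>)) / sqrt (real N)"
    if w: "\<omega> \<in> space M" for \<omega>
  proof -
    \<comment> \<open>The martingale difference in multiplicative form: present value times future
      ratio minus 1.\<close>
    have XR: "X i (h * real e) \<omega> - X i (h * real (a + k)) \<omega> = X i (h * real (a + k)) \<omega> * R i (?fut \<omega>)" if i: "i < N" for i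
    proof -
      have "(\<Sum>l\<in>{a + k..<e}. increments h (i, l) \<omega>) = \<xi> i (h * real e) \<omega> - \<xi> i (h * real (a + k)) \<omega>"
        unfolding increments_def fst_conv snd_conv using ke
        by (rule sum_Suc_diff'[where f = "\<lambda>l. \<xi> i (h * real l) \<omega>"])
      then have r: "R i (?fut \<omega>) = exp ((\<xi> i (h * real e) \<omega> - \<xi> i (h * real (a + k)) \<omega>) - h * real (e - (a + k)) * \<psi> 1) - 1"
        unfolding Rf[OF i] by simp
      have hd: "h * real (e - (a + k)) * \<psi> 1 = h * real e * \<psi> 1 - h * real (a + k) * \<psi> 1"
        using ke by (simp add: of_nat_diff algebra_simps)
      have ee: "exp (\<xi> i (h * real (a + k)) \<omega> - h * real (a + k) * \<psi> 1) *
        exp ((\<xi> i (h * real e) \<omega> - \<xi> i (h * real (a + k)) \<omega>) - (h * real e * \<psi> 1 - h * real (a + k) * \<psi> 1)) =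
        exp (\<xi> i (h * real e) \<omega> - h * real e * \<psi> 1)"
        unfolding mult_exp_exp by (rule arg_cong[where f = exp]) simp
      show ?thesis by (simp only: X_def r hd right_diff_distrib ee mult_1_right)
    qed
    have "S n \<omega> - S k \<omega> = (\<Sum>i<N. X i (h * real e) \<omega> - X i (h * real (a + k)) \<omega>) / sqrt (real N)"
      by (simp add: S_def V_def e_def diff_divide_distrib[symmetric] sum_subtractf[symmetric])
    also have "\<dots> = (\<Sum>i<N. X i (h * real (a + k)) \<omega> * R i (?fut \<omega>)) / sqrt (real N)"
      by (intro arg_cong[where f = "\<lambda>x. x / sqrt (real N)"] sum.cong refl XR) simp
    finally show ?thesis
      using w by (simp add: sum_distrib_left Gp mult.assoc)
  qed
  then have "L0.expectation (\<lambda>\<omega>. (S k \<omega>) ^ 3 * indicat_real A \<omega> * (S n \<omega> - S k \<omega>)) =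
    L0.expectation (\<lambda>\<omega>. (\<Sum>i<N. G i (?past \<omega>) * R i (?fut \<omega>)) / sqrt (real N))"
    by (intro Bochner_Integration.integral_cong) auto
  also have "\<dots> = 0" using term0 by (simp add: Bochner_Integration.integral_sum)
  finally show ?thesis unfolding A_def .
qed

section \<open>Maximal inequality and tightness\<close>

lemma V_grid_maximal:
  assumes h: "h > 0" and d: "\<delta> > 0"
  shows "L0.prob {\<omega> \<in> space M. \<exists>k\<le>n. \<delta> < \<bar>V N (h * real (a + k)) \<omega> - V N (h * real a) \<omega>\<bar>}
    \<le> L0.expectation (\<lambda>\<omega>. (V N (h * real (a + n)) \<omega> - V N (h * real a) \<omega>) ^ 4) / \<delta> ^ 4"
  by (rule L0.maximal_inequality4[OF _ d V_orthogonal[OF h]])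
     (use h in \<open>auto intro!: L0.L4_diff V_L4\<close>)

text \<open>Dyadic refinement and right continuity extend the maximal inequality from grids to the whole
  interval.\<close>

lemma V_interval_maximal:
  assumes d: "\<delta> > 0" and s: "0 \<le> s" "s < t" "t \<le> T" and N: "N > 0" and grid: "\<exists>a h. h > 0 \<and> s = h * real (a::nat) \<and> t = h * real (Suc a)"
  shows "\<exists>A\<in>sets M. L0.prob A \<le> (16 * exp (T * \<bar>\<psi> 4 - 4 * \<psi> 1\<bar>) / N + 3 * (b * exp (b * T) * (t - s))\<^sup>2) / \<delta> ^ 4 \<and>
    (\<forall>\<omega>\<in>space M - A. \<forall>r. s \<le> r \<longrightarrow> r < t \<longrightarrow> \<bar>V N r \<omega> - V N s \<omega>\<bar> \<le> \<delta>)"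
proof -
  obtain a :: nat and h where h: "h > 0" and sa: "s = h * real a" and ta: "t = h * real (Suc a)" using grid by blast
  define hp where "hp p = h / 2 ^ p" for p :: nat
  have hp: "hp p > 0" for p using h by (simp add: hp_def)
  \<comment> \<open>As \<open>s\<close> and \<open>t\<close> are neighbouring multiples of one mesh,
    they remain grid points of every dyadic refinement.\<close>
  have sp: "hp p * real (a * 2 ^ p) = s" "hp p * real (a * 2 ^ p + 2 ^ p) = t" for p
    by (simp_all add: hp_def sa ta field_simps)
  define A where "A p = {\<omega> \<in> space M. \<exists>k\<le>2 ^ p. \<delta> < \<bar>V N (hp p * real (a * 2 ^ p + k)) \<omega> - V N s \<omega>\<bar>}" for p
  let ?B = "(16 * exp (T * \<bar>\<psi> 4 - 4 * \<psi> 1\<bar>) / N + 3 * (b * exp (b * T) * (t - s))\<^sup>2) / \<delta> ^ 4"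
  have Am[measurable]: "A p \<in> sets M" for p
  proof -
    have "{\<omega> \<in> space M. \<exists>k\<in>{..2 ^ p}. \<delta> < \<bar>V N (hp p * real (a * 2 ^ p + k)) \<omega> - V N s \<omega>\<bar>} \<in> sets M"
      using hp[of p] s by (intro sets.sets_Collect_finite_Ex borel_measurable_less borel_measurable_abs borel_measurable_diff V_meas) auto
    then show ?thesis unfolding A_def Bex_def atMost_iff .
  qed
  have prob_A: "L0.prob (A p) \<le> ?B" for p
  proof -
    have "L0.prob (A p) \<le> L0.expectation (\<lambda>\<omega>. (V N t \<omega> - V N s \<omega>) ^ 4) / \<delta> ^ 4"
      using V_grid_maximal[OF hp[of p] d, of "2 ^ p" N "a * 2 ^ p"] unfolding sp A_def .
    also have "\<dots> \<le> ?B" using d s N by (intro divide_right_mono increment_4th_moment) auto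
    finally show ?thesis .
  qed
  \<comment> \<open>Refinement keeps the old grid points, with doubled index, so one uniform bound
    passes to the union by continuity from below.\<close>
  have inc: "incseq A"
  proof (rule incseq_SucI, rule subsetI)
    fix p \<omega> assume "\<omega> \<in> A p"
    then obtain k where w: "\<omega> \<in> space M" and k: "k \<le> 2 ^ p" "\<delta> < \<bar>V N (hp p * real (a * 2 ^ p + k)) \<omega> - V N s \<omega>\<bar>"
      by (auto simp: A_def)
    have "hp (Suc p) * real (a * 2 ^ Suc p + 2 * k) = hp p * real (a * 2 ^ p + k)" by (simp add: hp_def field_simps)
    with k have "2 * k \<le> 2 ^ Suc p" "\<delta> < \<bar>V N (hp (Suc p) * real (a * 2 ^ Suc p + 2 * k)) \<omega> - V N s \<omega>\<bar>" by auto
    with w show "\<omega> \<in> A (Suc p)" unfolding A_def by blast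
  qed
  have "(\<lambda>p. L0.prob (A p)) \<longlonglongrightarrow> L0.prob (\<Union>p. A p)"
    by (rule L0.finite_Lim_measure_incseq[OF _ inc]) auto
  then have "L0.prob (\<Union>p. A p) \<le> ?B" by (rule LIMSEQ_le_const2) (use prob_A in blast)
  moreover have "\<bar>V N r \<omega> - V N s \<omega>\<bar> \<le> \<delta>" if w: "\<omega> \<in> space M - (\<Union>p. A p)" and r: "s \<le> r" "r < t" for \<omega> r
  proof (rule field_le_epsilon)
    fix e :: real assume e: "e > 0"
    have "r \<in> {0..}" using r s by simp
    then obtain d' where d': "d' > 0" "\<And>q. q \<in> {0..} \<Longrightarrow> r \<le> q \<Longrightarrow> q < r + d' \<Longrightarrow> \<bar>V N q \<omega> - V N r \<omega>\<bar> < e"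
      using cadlag_on_right[OF V_cadlag _ e] w by (metis DiffD1)
    obtain p where p: "h / d' < 2 ^ p" using real_arch_pow[of 2 "h / d'"] by auto
    then have hpd: "hp p < d'" using d'(1) h by (simp add: hp_def field_simps)
    \<comment> \<open>The first grid point at or after \<open>r\<close>: approaching from the right
      is what right continuity permits, and it does not pass \<open>t\<close>.\<close>
    define k where "k = nat \<lceil>r / hp p\<rceil>"
    have "0 \<le> r / hp p" using r s hp[of p] by simp
    then have k: "r / hp p \<le> real k" "real k < r / hp p + 1" unfolding k_def by linarith+
    have q: "r \<le> hp p * real k" "hp p * real k < r + hp p"
      using k hp[of p] by (simp_all add: field_simps)
    have "real (a * 2 ^ p) \<le> r / hp p" using sp(1)[of p] r(1) hp[of p] by (simp add: field_simps)
    then have "a * 2 ^ p \<le> k" using k(1) by (metis of_nat_le_iff order_trans)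
    then obtain k' where k': "k = a * 2 ^ p + k'" using le_Suc_ex by blast
    have "r / hp p < real (a * 2 ^ p + 2 ^ p)" using sp(2)[of p] r(2) hp[of p] by (simp add: pos_divide_less_eq mult.commute)
    then have "\<lceil>r / hp p\<rceil> \<le> int (a * 2 ^ p + 2 ^ p)" by (simp add: ceiling_le_iff del: of_nat_add of_nat_mult)
    then have "k \<le> a * 2 ^ p + 2 ^ p" unfolding k_def by linarith
    then have "k' \<le> 2 ^ p" by (simp add: k')
    moreover have "\<omega> \<in> space M" "\<omega> \<notin> A p" using w by auto
    ultimately have "\<bar>V N (hp p * real k) \<omega> - V N s \<omega>\<bar> \<le> \<delta>" unfolding A_def k' by (auto simp: not_less)
    moreover have "\<bar>V N (hp p * real k) \<omega> - V N r \<omega>\<bar> < e" using q hpd \<open>r \<in> {0..}\<close> by (intro d'(2)) auto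
    ultimately show "\<bar>V N r \<omega> - V N s \<omega>\<bar> \<le> \<delta> + e" by linarith
  qed
  ultimately show ?thesis by (intro bexI[of _ "\<Union>p. A p"]) auto
qed

text \<open>Each of the m cells fails with probability at most D/n + C/m^2, together m D/n + C/m.
  The mesh makes the second part at most half of \<open>\<eta>\<close>, and then \<open>n\<close>
  does so for the first.\<close>

lemma V_tight:
  assumes T: "T > 0" and d: "\<delta> > 0" and eta: "\<eta> > 0"
  shows "\<exists>m0. \<forall>m\<ge>m0. \<exists>N0. \<forall>n\<ge>N0. \<exists>A\<in>sets M. measure M A \<le> \<eta> \<and>
      (\<forall>\<omega>\<in>space M - A. \<forall>t\<in>{0..T}. \<bar>V n t \<omega> - V n (grid T m (nat \<lfloor>real m / T * t\<rfloor>)) \<omega>\<bar> \<le> \<delta>)"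
proof -
  define C where "C = 3 * (b * exp (b * T) * T)\<^sup>2 / \<delta> ^ 4"
  define D where "D = 16 * exp (T * \<bar>\<psi> 4 - 4 * \<psi> 1\<bar>) / \<delta> ^ 4"
  have CD: "C \<ge> 0" "D \<ge> 0" using d by (auto simp: C_def D_def)
  obtain m0 :: nat where m0: "2 * C / \<eta> < m0" using reals_Archimedean2 by blast
  have "\<exists>N0. \<forall>n\<ge>N0. \<exists>A\<in>sets M. measure M A \<le> \<eta> \<and>
      (\<forall>\<omega>\<in>space M - A. \<forall>t\<in>{0..T}. \<bar>V n t \<omega> - V n (grid T m (nat \<lfloor>real m / T * t\<rfloor>)) \<omega>\<bar> \<le> \<delta>)" if m: "m \<ge> max m0 1" for m
  proof -
    have mpos: "m > 0" using m by simp
    have "2 * C / \<eta> < m" using m m0 by simp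
    then have Cm: "C / m \<le> \<eta> / 2" using mpos eta by (simp add: field_simps)
    obtain N0 :: nat where N0: "2 * real m * D / \<eta> < N0" using reals_Archimedean2 by blast
    have "\<exists>A\<in>sets M. measure M A \<le> \<eta> \<and>
      (\<forall>\<omega>\<in>space M - A. \<forall>t\<in>{0..T}. \<bar>V n t \<omega> - V n (grid T m (nat \<lfloor>real m / T * t\<rfloor>)) \<omega>\<bar> \<le> \<delta>)" if n: "n \<ge> max N0 1" for n
    proof -
      have npos: "n > 0" using n by simp
      have "2 * real m * D / \<eta> < n" using n N0 by simp
      then have Dn: "real m * (D / n) \<le> \<eta> / 2" using npos eta by (simp add: field_simps)
      have "\<forall>j\<in>{..<m}. \<exists>A\<in>sets M. L0.prob A \<le> D / n + C / (real m)\<^sup>2 \<and>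
        (\<forall>\<omega>\<in>space M - A. \<forall>r. grid T m j \<le> r \<longrightarrow> r < grid T m (Suc j) \<longrightarrow> \<bar>V n r \<omega> - V n (grid T m j) \<omega>\<bar> \<le> \<delta>)"
      proof
        fix j assume j: "j \<in> {..<m}"
        have h: "grid T m i = (T / m) * real i" for i by (simp add: grid_def)
        have "(16 * exp (T * \<bar>\<psi> 4 - 4 * \<psi> 1\<bar>) / n + 3 * (b * exp (b * T) * (grid T m (Suc j) - grid T m j))\<^sup>2) / \<delta> ^ 4
          = D / n + C / (real m)\<^sup>2"
        proof -
          have "grid T m (Suc j) - grid T m j = T / m" using mpos by (simp add: grid_def field_simps)
          then show ?thesis by (simp add: C_def D_def add_divide_distrib power_divide mult_ac)
        qed
        moreover have "0 \<le> grid T m j" "grid T m j < grid T m (Suc j)" "grid T m (Suc j) \<le> T"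
          using T mpos j grid_mem[OF T, of "Suc j" m] by (auto simp: grid_def divide_strict_right_mono)
        moreover have "\<exists>a h. h > 0 \<and> grid T m j = h * real (a::nat) \<and> grid T m (Suc j) = h * real (Suc a)"
          unfolding h using T mpos by (intro exI[of _ j] exI[of _ "T / m"]) auto
        ultimately show "\<exists>A\<in>sets M. L0.prob A \<le> D / n + C / (real m)\<^sup>2 \<and>
          (\<forall>\<omega>\<in>space M - A. \<forall>r. grid T m j \<le> r \<longrightarrow> r < grid T m (Suc j) \<longrightarrow> \<bar>V n r \<omega> - V n (grid T m j) \<omega>\<bar> \<le> \<delta>)"
          using V_interval_maximal[OF d, of "grid T m j" "grid T m (Suc j)" T n] npos by simp
      qed
      from bchoice[OF this[unfolded Bex_def]] obtain A where A': "\<forall>j\<in>{..<m}. A j \<in> sets M \<and> L0.prob (A j) \<le> D / n + C / (real m)\<^sup>2 \<and>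
        (\<forall>\<omega>\<in>space M - A j. \<forall>r. grid T m j \<le> r \<longrightarrow> r < grid T m (Suc j) \<longrightarrow> \<bar>V n r \<omega> - V n (grid T m j) \<omega>\<bar> \<le> \<delta>)" ..
      then have A: "\<And>j. j < m \<Longrightarrow> A j \<in> sets M" "\<And>j. j < m \<Longrightarrow> L0.prob (A j) \<le> D / n + C / (real m)\<^sup>2"
        "\<And>j \<omega> r. j < m \<Longrightarrow> \<omega> \<in> space M - A j \<Longrightarrow> grid T m j \<le> r \<Longrightarrow> r < grid T m (Suc j) \<Longrightarrow> \<bar>V n r \<omega> - V n (grid T m j) \<omega>\<bar> \<le> \<delta>"
        by blast+
      have "L0.prob (\<Union>j\<in>{..<m}. A j) \<le> (\<Sum>j<m. L0.prob (A j))"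
        using A(1) by (intro L0.finite_measure_subadditive_finite) auto
      also have "\<dots> \<le> (\<Sum>j<m. D / n + C / (real m)\<^sup>2)" by (intro sum_mono A(2)) simp
      also have "\<dots> = real m * (D / n) + C / m" using mpos by (simp add: field_simps power2_eq_square)
      also have "\<dots> \<le> \<eta>" using Cm Dn by linarith
      finally have "L0.prob (\<Union>j\<in>{..<m}. A j) \<le> \<eta>" .
      moreover have "\<bar>V n t \<omega> - V n (grid T m (nat \<lfloor>real m / T * t\<rfloor>)) \<omega>\<bar> \<le> \<delta>"
        if w: "\<omega> \<in> space M - (\<Union>j\<in>{..<m}. A j)" and t: "t \<in> {0..T}" for \<omega> t
      proof -
        define j where "j = nat \<lfloor>real m / T * t\<rfloor>"
        note gb = grid_floor_bounds[OF T t mpos, folded j_def]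
        have "j \<le> m" unfolding j_def by (rule grid_index_le[OF T t])
        then consider "j < m" | "j = m" by linarith
        then show ?thesis
        proof cases
          case 1
          have "t < grid T m (Suc j)" using gb(2) mpos by (simp add: grid_def field_simps)
          with A(3)[OF 1, of \<omega> t] w 1 gb(1) show ?thesis by (auto simp: j_def)
        next
          case 2
          \<comment> \<open>The index \<open>m\<close> occurs only for \<open>t = T\<close>, where
            the path is compared with itself.\<close>
          then have "grid T m j = T" using mpos by (simp add: grid_def)
          then have "t = grid T m j" using gb(1) t by auto
          then have "V n t \<omega> = V n (grid T m j) \<omega>" by (rule arg_cong)
          then show ?thesis unfolding j_def[symmetric] using d by simp
        qed
      qed
      moreover have "(\<Union>j\<in>{..<m}. A j) \<in> sets M" using A(1) by auto
      ultimately show ?thesis by blast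
    qed
    then show ?thesis by blast
  qed
  then show ?thesis by blast
qed

end

section \<open>The functional central limit theorem\<close>

text \<open>Needed because the rescaled sum is identified with the weighted martingale at
  nonnegative times only.\<close>

lemma cadlag_on_cong:
  assumes "cadlag_on S f" "\<And>t. t \<in> S \<Longrightarrow> f t = g t" shows "cadlag_on S g"
  unfolding cadlag_on_def
proof (intro conjI ballI)
  fix t assume t: "t \<in> S"
  have ev: "eventually (\<lambda>s. f s = g s) (at t within (S \<inter> A))" for A
    unfolding eventually_at_filter using assms(2) by (auto intro: always_eventually)
  have "(f \<longlongrightarrow> f t) (at t within (S \<inter> {t..}))" "\<exists>l. (f \<longlongrightarrow> l) (at t within (S \<inter> {..<t}))"
    using assms(1) t unfolding cadlag_on_def continuous_within by auto
  then show "continuous (at t within (S \<inter> {t..})) g" "\<exists>l. (g \<longlongrightarrow> l) (at t within (S \<inter> {..<t}))"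
    unfolding continuous_within using Lim_transform_eventually[OF _ ev] assms(2)[OF t] by metis+
qed

context levy_copies
begin

text \<open>Division by exp (b T) brings the clock exp (b t) - 1 into [0, 1], and the square root
  restores the variance. The divisor exp (b T), unlike exp (b T) - 1, is positive for
  \<open>b = 0\<close> too.\<close>

definition W :: "real \<Rightarrow> real \<Rightarrow> (nat \<times> nat \<Rightarrow> real) \<Rightarrow> real" where
  "W T t z = sqrt (exp (b * T)) * brownian z ((exp (b * t) - 1) / exp (b * T))"

lemma W_meas: "W T t \<in> borel_measurable white_noise"
  unfolding W_def[abs_def] by (intro borel_measurable_times borel_measurable_const brownian_measurable)

lemma W_continuous: "continuous_on A (\<lambda>t. W T t z)"
proof -
  have "continuous_on A (\<lambda>t. (exp (b * t) - 1) / exp (b * T))" by (intro continuous_intros) auto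
  then have "continuous_on A (\<lambda>t. brownian z ((exp (b * t) - 1) / exp (b * T)))"
    by (rule continuous_on_compose2[OF continuous_on_brownian[of UNIV]]) simp
  then show ?thesis unfolding W_def by (intro continuous_intros)
qed

lemma W_char:
  fixes tt c :: "nat \<Rightarrow> real"
  assumes J: "finite J" and tt: "\<And>j. j \<in> J \<Longrightarrow> tt j \<in> {0..T}"
  shows "(CLINT z|white_noise. iexp (\<Sum>j\<in>J. c j * W T (tt j) z)) =
    complex_of_real (exp (- (\<Sum>i\<in>J. \<Sum>j\<in>J. c i * c j * (exp (b * min (tt i) (tt j)) - 1)) / 2))"
proof -
  let ?S = "exp (b * T)" and ?\<tau> = "\<lambda>t. (exp (b * t) - 1) / exp (b * T)"
  have tau: "?\<tau> t \<in> {0..1}" if "t \<in> {0..T}" for t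
  proof -
    have "0 \<le> b * t" "b * t \<le> b * T" using that b_nonneg by (auto intro: mult_left_mono)
    then have "1 \<le> exp (b * t)" "exp (b * t) \<le> ?S" by auto
    then have "0 \<le> exp (b * t) - 1" "exp (b * t) - 1 \<le> ?S" by linarith+
    then show ?thesis by (simp add: divide_le_eq_1)
  qed
  have tau_min: "?S * min (?\<tau> s) (?\<tau> t) = exp (b * min s t) - 1" for s t
  proof (cases "s \<le> t")
    case True
    then have "exp (b * s) \<le> exp (b * t)" using b_nonneg by (auto intro: mult_left_mono)
    then have "?\<tau> s \<le> ?\<tau> t" by (intro divide_right_mono) auto
    then show ?thesis using True by simp
  next
    case False
    then have "exp (b * t) \<le> exp (b * s)" using b_nonneg by (auto intro: mult_left_mono)
    then have "?\<tau> t \<le> ?\<tau> s" by (intro divide_right_mono) auto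
    then show ?thesis using False by (simp add: min_absorb2)
  qed
  have "(\<Sum>j\<in>J. c j * W T (tt j) z) = (\<Sum>j\<in>J. (c j * sqrt ?S) * brownian z (?\<tau> (tt j)))" for z
    by (simp add: W_def mult.assoc)
  moreover have "(CLINT z|white_noise. iexp (\<Sum>j\<in>J. (c j * sqrt ?S) * brownian z (?\<tau> (tt j)))) =
    complex_of_real (exp (- (\<Sum>i\<in>J. \<Sum>j\<in>J. (c i * sqrt ?S) * (c j * sqrt ?S) * min (?\<tau> (tt i)) (?\<tau> (tt j))) / 2))"
    by (rule brownian_char[OF J tau[OF tt]])
  moreover have "(c i * sqrt ?S) * (c j * sqrt ?S) * min (?\<tau> (tt i)) (?\<tau> (tt j)) = c i * c j * (exp (b * min (tt i) (tt j)) - 1)" for i j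
  proof -
    have "(c i * sqrt ?S) * (c j * sqrt ?S) * min (?\<tau> (tt i)) (?\<tau> (tt j)) = c i * c j * ((sqrt ?S * sqrt ?S) * min (?\<tau> (tt i)) (?\<tau> (tt j)))"
      by (simp only: mult_ac)
    also have "sqrt ?S * sqrt ?S = ?S" by simp
    finally show ?thesis unfolding tau_min .
  qed
  ultimately show ?thesis by simp
qed

lemma skor_approx_V_W:
  assumes T: "T > 0"
  shows "skor_approx T M white_noise (\<lambda>t. exp (\<psi> 1 * t)) V (W T)"
proof (rule skor_approx.intro)
  show "prob_space M" by (rule L0.prob_space_axioms)
  show "prob_space white_noise" by (rule prob_space_white_noise)
  show "continuous_on {0..T} (\<lambda>t. exp (\<psi> 1 * t))" by (intro continuous_intros)
  show "V n t \<in> borel_measurable M" if "t \<in> {0..T}" for n t using that by (intro V_meas) auto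
  show "(\<lambda>t. V n t \<omega>) \<in> skor_D T" if "\<omega> \<in> space M" for n \<omega>
    unfolding skor_D_def using cadlag_on_subset[OF V_cadlag[OF that]] by auto
  show "(\<lambda>n. CLINT \<omega>|M. iexp (\<Sum>j\<le>m. c j * V n (tt j) \<omega>)) \<longlonglongrightarrow> (CLINT z|white_noise. iexp (\<Sum>j\<le>m. c j * W T (tt j) z))"
    if "\<And>j. j \<le> m \<Longrightarrow> tt j \<in> {0..T}" for m and tt c :: "nat \<Rightarrow> real"
    using fdd_char[of "{..m}" tt c] W_char[of "{..m}" tt T c] that by simp
qed (use T W_meas W_continuous V_tight in auto)

lemma Y_eq:
  assumes "t \<ge> 0"
  shows "((\<Sum>i<N. exp (\<xi> i t \<omega>)) - (\<integral>\<omega>'. (\<Sum>i<N. exp (\<xi> i t \<omega>')) \<partial>M)) / sqrt (real N) = exp (\<psi> 1 * t) * V N t \<omega>"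
proof -
  have "integrable M (\<lambda>\<omega>. exp (1 * \<xi> i t \<omega>))" "(\<integral>\<omega>. exp (1 * \<xi> i t \<omega>) \<partial>M) = exp (t * \<psi> 1)" for i
    using levy.integrable_exp[OF levy_i assms, of 1 i] levy.expectation_exp[OF levy_i assms, of 1 i] by (simp_all add: psi_i[of i])
  then have "(\<integral>\<omega>'. (\<Sum>i<N. exp (\<xi> i t \<omega>')) \<partial>M) = (\<Sum>i<N. exp (\<psi> 1 * t))"
    by (subst Bochner_Integration.integral_sum) (simp_all add: mult.commute)
  moreover have "exp (\<xi> i t \<omega>) - exp (\<psi> 1 * t) = exp (\<psi> 1 * t) * (X i t \<omega> - 1)" for i
    unfolding X_def right_diff_distrib mult_exp_exp by (simp add: mult.commute)
  then have "(\<Sum>i<N. exp (\<xi> i t \<omega>)) - (\<Sum>i<N. exp (\<psi> 1 * t)) = (\<Sum>i<N. exp (\<psi> 1 * t) * (X i t \<omega> - 1))"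
    unfolding sum_subtractf[symmetric] by simp
  ultimately show ?thesis by (simp add: V_def sum_distrib_left)
qed

text \<open>Since the maximum is s + t minus the minimum, the covariance in the theorem splits into
  the two weights and the covariance of the time-changed Brownian motion.\<close>

lemma K_eq: "exp (\<psi> 2 * min s t + \<psi> 1 * (max s t - min s t)) - exp (\<psi> 1 * (s + t))
  = exp (\<psi> 1 * s) * exp (\<psi> 1 * t) * (exp (b * min s t) - 1)"
proof -
  have "max s t = s + t - min s t" by (simp add: min_def max_def)
  then show ?thesis unfolding right_diff_distrib mult_exp_exp b_def by (simp add: algebra_simps)
qed

end

theorem theorem1p1:
  fixes M :: "'a measure" and \<xi> :: "nat \<Rightarrow> real \<Rightarrow> 'a \<Rightarrow> real" and T :: real
  assumes levy: "\<And>i. levy_process M (\<xi> i)"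
    and copies: "\<And>i. distr M path_space (path_of (\<xi> i)) = distr M path_space (path_of (\<xi> 0))"
    and indep: "prob_space.indep_vars M (\<lambda>_. path_space) (\<lambda>i. path_of (\<xi> i)) UNIV"
    and nondeg: "\<not> (\<exists>c. AE \<omega> in M. \<xi> 0 1 \<omega> = c)"
    and expmom: "\<And>u. integrable M (\<lambda>\<omega>. exp (u * \<xi> 0 1 \<omega>))"
    and T: "T > 0"
  shows "let \<psi> = (\<lambda>u. ln (\<integral>\<omega>. exp (u * \<xi> 0 1 \<omega>) \<partial>M));
             Z = (\<lambda>N t \<omega>. \<Sum>i<N. exp (\<xi> i t \<omega>));
             Y = (\<lambda>N \<omega> t. (Z N t \<omega> - (\<integral>\<omega>'. Z N t \<omega>' \<partial>M)) / sqrt (real N));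
             K = (\<lambda>s t. exp (\<psi> 2 * min s t + \<psi> 1 * (max s t - min s t)) - exp (\<psi> 1 * (s + t)))
         in \<exists>mu. prob_space mu \<and> sets mu = sets (skor_borel T) \<and>
                 centered_gaussian_on T mu K \<and> skor_weak_conv T M Y mu"
proof -
  interpret levy_copies M \<xi> using levy copies indep expmom by unfold_locales auto
  interpret skor_approx T M white_noise "\<lambda>t. exp (\<psi> 1 * t)" V "W T" by (rule skor_approx_V_W[OF T])
  interpret Q: prob_space white_noise by (rule prob_space_white_noise)
  define Y where "Y N \<omega> t = ((\<Sum>i<N. exp (\<xi> i t \<omega>)) - (\<integral>\<omega>'. (\<Sum>i<N. exp (\<xi> i t \<omega>')) \<partial>M)) / sqrt (real N)" for N \<omega> t
  define K where "K s t = exp (\<psi> 2 * min s t + \<psi> 1 * (max s t - min s t)) - exp (\<psi> 1 * (s + t))" for s t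
  define G where "G z t = exp (\<psi> 1 * t) * W T t z" for z t
  define mu where "mu = distr white_noise (skor_borel T) G"
  have G[measurable]: "G \<in> measurable white_noise (skor_borel T)"
    by (rule continuous_process_skor_measurable[OF T])
       (auto simp: G_def intro!: borel_measurable_times W_meas continuous_intros W_continuous)
  have "centered_gaussian_on T mu K"
    unfolding centered_gaussian_on_def
  proof (intro allI impI conjI)
    fix n :: nat and tt c :: "nat \<Rightarrow> real" and u :: real
    assume tt: "\<forall>k<n. tt k \<in> {0..T}"
    have f: "(\<lambda>x. \<Sum>k<n. c k * x (tt k)) \<in> borel_measurable (skor_borel T)"
      by (intro borel_measurable_sum borel_measurable_times borel_measurable_const skor_borel_measurable_eval[OF T]) (use tt in auto)
    then show "(\<lambda>x. \<Sum>k<n. c k * x (tt k)) \<in> borel_measurable mu" by (simp add: mu_def)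
    have "distr mu borel (\<lambda>x. \<Sum>k<n. c k * x (tt k)) = distr white_noise borel (\<lambda>z. \<Sum>k<n. c k * G z (tt k))"
      unfolding mu_def by (subst distr_distr[OF f G]) (simp add: comp_def)
    then have "char (distr mu borel (\<lambda>x. \<Sum>k<n. c k * x (tt k))) u = (CLINT z|white_noise. iexp (u * (\<Sum>k<n. c k * G z (tt k))))"
      unfolding char_def using measurable_compose[OF G f] by (simp add: integral_distr)
    \<comment> \<open>The argument \<open>u\<close> and the weights are absorbed into the
      coefficients, so that the formula for \<open>W\<close> applies directly.\<close>
    also have "\<dots> = (CLINT z|white_noise. iexp (\<Sum>k\<in>{..<n}. (u * c k * exp (\<psi> 1 * tt k)) * W T (tt k) z))"
      by (simp add: G_def sum_distrib_left mult.assoc)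
    also have "\<dots> = complex_of_real (exp (- (\<Sum>i<n. \<Sum>j<n. (u * c i * exp (\<psi> 1 * tt i)) * (u * c j * exp (\<psi> 1 * tt j)) * (exp (b * min (tt i) (tt j)) - 1)) / 2))"
      by (rule W_char) (use tt in auto)
    also have "(\<Sum>i<n. \<Sum>j<n. (u * c i * exp (\<psi> 1 * tt i)) * (u * c j * exp (\<psi> 1 * tt j)) * (exp (b * min (tt i) (tt j)) - 1)) =
      (\<Sum>i<n. \<Sum>j<n. c i * c j * K (tt i) (tt j)) * u\<^sup>2"
      unfolding K_def K_eq by (simp add: sum_distrib_left sum_distrib_right power2_eq_square mult_ac)
    finally show "char (distr mu borel (\<lambda>x. \<Sum>k<n. c k * x (tt k))) u =
      complex_of_real (exp (- ((\<Sum>i<n. \<Sum>j<n. c i * c j * K (tt i) (tt j)) * u\<^sup>2 / 2)))" by simp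
  qed
  moreover have "skor_weak_conv T M Y mu"
    unfolding skor_weak_conv_def
  proof (intro allI impI)
    fix f assume f: "skor_continuous T f" and "skor_bounded T f"
    then obtain B where B: "\<And>x. x \<in> skor_D T \<Longrightarrow> \<bar>f x\<bar> \<le> B" unfolding skor_bounded_def by blast
    \<comment> \<open>Both paths agree on [0, T] but need not agree at negative times, so they are
      exchanged through Skorokhod continuity of \<open>f\<close>.\<close>
    have "f (Y N \<omega>) = f (\<lambda>t. exp (\<psi> 1 * t) * V N t \<omega>)" if w: "\<omega> \<in> space M" for N \<omega>
    proof (rule skor_continuous_cong[OF _ f])
      have eq: "Y N \<omega> t = exp (\<psi> 1 * t) * V N t \<omega>" if "t \<in> {0..T}" for t
        unfolding Y_def using that by (intro Y_eq) simp
      then show "\<And>t. t \<in> {0..T} \<Longrightarrow> Y N \<omega> t = exp (\<psi> 1 * t) * V N t \<omega>" .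
      show "(\<lambda>t. exp (\<psi> 1 * t) * V N t \<omega>) \<in> skor_D T" by (rule gV_path[OF w])
      then show "Y N \<omega> \<in> skor_D T" unfolding skor_D_def mem_Collect_eq
        by (rule cadlag_on_cong) (use eq in auto)
    qed (use T in simp)
    then have "(\<integral>\<omega>. f (Y N \<omega>) \<partial>M) = (\<integral>\<omega>. f (\<lambda>t. exp (\<psi> 1 * t) * V N t \<omega>) \<partial>M)" for N
      by (intro Bochner_Integration.integral_cong) auto
    moreover have "(\<integral>x. f x \<partial>mu) = (\<integral>z. f (\<lambda>t. exp (\<psi> 1 * t) * W T t z) \<partial>white_noise)"
      unfolding mu_def by (subst integral_distr[OF G skor_continuous_measurable[OF f]]) (simp add: G_def[abs_def])
    ultimately show "(\<lambda>N. \<integral>\<omega>. f (Y N \<omega>) \<partial>M) \<longlonglongrightarrow> (\<integral>x. f x \<partial>mu)"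
      using skor_weak_limit[OF f B] by simp
  qed
  moreover have "prob_space mu" unfolding mu_def by (rule Q.prob_space_distr[OF G])
  moreover have "sets mu = sets (skor_borel T)" by (simp add: mu_def)
  ultimately have "\<exists>mu. prob_space mu \<and> sets mu = sets (skor_borel T) \<and> centered_gaussian_on T mu K \<and> skor_weak_conv T M Y mu"
    by blast
  then show ?thesis
    unfolding Let_def K_def[abs_def] Y_def[abs_def] L0.\<psi>_def .
qed

end
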